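(* Assume one of the polynomials $h_i$ defining $\mathcal{D}$ equals $R_{\mathcal{D}}-\|\bm{d}\|^2$ for some constant $R_{\mathcal{D}}\ge 0$. Then there exist a positive integer $N$ and a sequence of polynomials $\{\psi_{k+N}\}_{k=1}^{\infty}$ with $\psi_{k+N}\in\mathbb{R}_{k+N}[\bm{x},t]$, each satisfying the sum-of-squares constraints (SOS) given in the context, such that $\psi_{k+N}\to u$ uniformly on $B(\bm{0},R)\times[0,T]$ as $k\to\infty$.
   Context: Setting. $n,m$ are positive integers, $T>0$, $\|\cdot\|$ is the Euclidean norm. $\bm{f}:\mathbb{R}^n\times\mathbb{R}^m\to\mathbb{R}^n$ has polynomial components $f_i\in\mathbb{R}[\bm{x},\bm{d}]$. $\mathcal{D}=\{\bm{d}\in\mathbb{R}^m\mid h_i(\bm{d})\ge0,\ i=1,\dots,n_{\mathcal{D}}\}$ is a (nonempty) compact set with $h_i\in\mathbb{R}[\bm{d}]$. For $t\in[0,T]$, $\mathcal{X}_t=\{\bm{x}\in\mathbb{R}^n\mid g_i(\bm{x},t)\le0,\ i=1,\dots,n_{\mathcal{X}}\}$ is compact, with $g_i\in\mathbb{R}[\bm{x},t]$ and $\partial\mathcal{X}_t=\bigcup_{i}\{\bm{x}\in\mathcal{X}_t\mid g_i(\bm{x},t)=0\}$. The target is $\mathtt{TR}=\{\bm{x}\in\mathbb{R}^n\mid l_i(\bm{x})\le0,\ i=1,\dots,n_{\mathtt{TR}}\}$ with $l_i\in\mathbb{R}[\bm{x}]$ and $\partial\mathtt{TR}=\bigcup_i\{\bm{x}\in\mathtt{TR}\mid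 l_i(\bm{x})=0\}$. $R>0$ is a number and $B(\bm{0},R)=\{\bm{x}\in\mathbb{R}^n\mid g_R(\bm{x})\ge0\}$ with $g_R(\bm{x})=R-\sum_{i=1}^n x_i^2$, chosen so that for all $t\in[0,T]$: $\mathcal{X}_t\subseteq B(\bm{0},R)$ and $\partial\mathcal{X}_t\cap\partial B(\bm{0},R)=\emptyset$. $\bm{F}:\mathbb{R}^n\times\mathcal{D}\to\mathbb{R}^n$ is a continuous map, globally Lipschitz in $\bm{x}\in\mathbb{R}^n$ uniformly in $\bm{d}\in\mathcal{D}$, with $\bm{F}=\bm{f}$ on $B(\bm{0},R)\times\mathcal{D}$. $\mathcal{M}_t$ is the set of measurable functions $\bm{d}:[t,T]\to\mathcal{D}$; for $\bm{d}\in\mathcal{M}_t$, $\bm{\phi}_{\bm{x},t}^{\bm{d}}:[t,T]\to\mathbb{R}^n$ is the absolutely continuous solution of $\dot{\bm{x}}(s)=\bm{F}(\bm{x}(s),\bm{d}(s))$ a.e. with value $\bm{x}$ at time $t$. Value function: for $(\bm{x},t)\in\mathbb{R}^n\times[0,T]$, \[u(\bm{x},t)=\sup_{\bm{d}\in\mathcal{M}_t}\max\Big\{\max_{i}l_i(\bm{\phi}_{\bm{x},t}^{\bm{d}}(T)),\ \max_{i}\max_{s\in[t,T]}g_i(\bm{\phi}_{\bm{x},t}^{\bm{d}}(s),s)\Big\}.\] $\mathbb{R}_k[\cdot]$ denotes the real polynomials of total degree $\le k$ in the listed variables. A polynomial $\psi\in\mathbb{R}[\bm{x},t]$ satisfies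 (SOS) if there exist sum-of-squares polynomials $s_0,s_1,s_2,s'_r$ ($r=1,\dots,n_{\mathcal{D}}$) in $(\bm{x},t,\bm{d})$, $s_{3,i},s_{4,i},s_{5,i}$ ($i=1,\dots,n_{\mathcal{X}}$) in $(\bm{x},t)$, and $s_{6,j},s_{7,j}$ ($j=1,\dots,n_{\mathtt{TR}}$) in $\bm{x}$ (of any degrees) such that, as polynomial identities, \[-\big(\partial_t\psi(\bm{x},t)+\nabla_{\bm{x}}\psi(\bm{x},t)\cdot\bm{f}(\bm{x},\bm{d})\big)=s_0+s_1g_R(\bm{x})+s_2\,t(T-t)+\sum_{r=1}^{n_{\mathcal{D}}}s'_r h_r(\bm{d}),\] \[\psi(\bm{x},t)-g_i(\bm{x},t)=s_{3,i}+s_{4,i}g_R(\bm{x})+s_{5,i}\,t(T-t),\quad i=1,\dots,n_{\mathcal{X}},\] \[\psi(\bm{x},T)-l_j(\bm{x})=s_{6,j}+s_{7,j}g_R(\bm{x}),\quad j=1,\dots,n_{\mathtt{TR}}.\] *)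

theory Defs
  imports "HOL-Analysis.Analysis" "HOL-Library.Poly_Mapping"
begin

section \<open>Real multivariate polynomials\<close>

text \<open>
  \<^typ>\<open>('v \<Rightarrow>\<^sub>0 nat) \<Rightarrow>\<^sub>0 real\<close> is the polynomial ring over the reals with variables indexed by
  the type \<open>'v\<close>; its multiplication is the convolution product of
  \<^theory>\<open>HOL-Library.Poly_Mapping\<close>. A polynomial ring in given groups of variables is selected by
  the index type: with \<open>x\<close> indexed by \<open>'n\<close>, \<open>d\<close> indexed by \<open>'m\<close> and \<open>t\<close> a single variable,
  we use \<open>'n\<close> for \<open>\<real>[x]\<close>, \<open>'m\<close> for \<open>\<real>[d]\<close>, \<open>'n + unit\<close> for \<open>\<real>[x,t]\<close>, \<open>'n + 'm\<close> for \<open>\<real>[x,d]\<close>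
  and \<open>('n + unit) + 'm\<close> for \<open>\<real>[x,t,d]\<close>.
\<close>

type_synonym 'v mpoly = "('v \<Rightarrow>\<^sub>0 nat) \<Rightarrow>\<^sub>0 real"

definition mconst :: "real \<Rightarrow> 'v mpoly" where
  "mconst c = Poly_Mapping.single 0 c"

definition mvar :: "'v \<Rightarrow> 'v mpoly" where
  "mvar v = Poly_Mapping.single (Poly_Mapping.single v 1) 1"

definition meval :: "'v mpoly \<Rightarrow> ('v \<Rightarrow> real) \<Rightarrow> real" where
  "meval p a = (\<Sum>m\<in>Poly_Mapping.keys p. Poly_Mapping.lookup p m * (\<Prod>v\<in>Poly_Mapping.keys m. a v ^ Poly_Mapping.lookup m v))"

definition msubst :: "('v \<Rightarrow> 'w mpoly) \<Rightarrow> 'v mpoly \<Rightarrow> 'w mpoly" where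
  "msubst \<sigma> p = (\<Sum>m\<in>Poly_Mapping.keys p. mconst (Poly_Mapping.lookup p m) * (\<Prod>v\<in>Poly_Mapping.keys m. \<sigma> v ^ Poly_Mapping.lookup m v))"

definition mrename :: "('v \<Rightarrow> 'w) \<Rightarrow> 'v mpoly \<Rightarrow> 'w mpoly" where
  "mrename \<rho> = msubst (\<lambda>v. mvar (\<rho> v))"

text \<open>
  Formal partial derivative. The subtraction of exponent vectors truncates only if \<open>v\<close> does not
  occur in the monomial, and then the coefficient is zero.
\<close>

definition mpartial :: "'v \<Rightarrow> 'v mpoly \<Rightarrow> 'v mpoly" where
  "mpartial v p = (\<Sum>m\<in>Poly_Mapping.keys p.
     Poly_Mapping.single (m - Poly_Mapping.single v 1) (Poly_Mapping.lookup p m * real (Poly_Mapping.lookup m v)))"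

definition total_degree_le :: "nat \<Rightarrow> 'v mpoly \<Rightarrow> bool" where
  "total_degree_le k p \<longleftrightarrow> (\<forall>m\<in>Poly_Mapping.keys p. (\<Sum>v\<in>Poly_Mapping.keys m. Poly_Mapping.lookup m v) \<le> k)"

definition is_sos :: "'v mpoly \<Rightarrow> bool" where
  "is_sos p \<longleftrightarrow> (\<exists>qs. p = (\<Sum>q\<leftarrow>qs. q ^ 2))"

definition eval_xt :: "('n + unit) mpoly \<Rightarrow> real ^ 'n \<Rightarrow> real \<Rightarrow> real" where
  "eval_xt p x t = meval p (case_sum (\<lambda>i. x $ i) (\<lambda>_. t))"

definition eval_xd :: "('n + 'm) mpoly \<Rightarrow> real ^ 'n \<Rightarrow> real ^ 'm \<Rightarrow> real" where
  "eval_xd p x d = meval p (case_sum (\<lambda>i. x $ i) (\<lambda>j. d $ j))"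

text \<open>\<open>ball_poly r\<close> is \<open>r - \<parallel>x\<parallel>\<^sup>2\<close>, so \<open>r\<close> is the square of the radius.\<close>

definition ball_poly :: "real \<Rightarrow> 'v::finite mpoly" where
  "ball_poly r = mconst r - (\<Sum>v\<in>UNIV. mvar v ^ 2)"

definition ball_set :: "real \<Rightarrow> (real ^ 'n) set" where
  "ball_set r = {x. meval (ball_poly r) (\<lambda>i. x $ i) \<ge> 0}"

definition time_poly :: "real \<Rightarrow> ('n + unit) mpoly" where
  "time_poly T = mvar (Inr ()) * (mconst T - mvar (Inr ()))"

section \<open>Constraint sets\<close>

definition disturbance_set :: "nat \<Rightarrow> (nat \<Rightarrow> 'm mpoly) \<Rightarrow> (real ^ 'm) set" where
  "disturbance_set nD h = {d. \<forall>i\<in>{1..nD}. meval (h i) (\<lambda>j. d $ j) \<ge> 0}"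

definition state_set :: "nat \<Rightarrow> (nat \<Rightarrow> ('n + unit) mpoly) \<Rightarrow> real \<Rightarrow> (real ^ 'n) set" where
  "state_set nX g t = {x. \<forall>i\<in>{1..nX}. eval_xt (g i) x t \<le> 0}"

definition state_boundary :: "nat \<Rightarrow> (nat \<Rightarrow> ('n + unit) mpoly) \<Rightarrow> real \<Rightarrow> (real ^ 'n) set" where
  "state_boundary nX g t = (\<Union>i\<in>{1..nX}. {x \<in> state_set nX g t. eval_xt (g i) x t = 0})"

section \<open>Trajectories and the value function\<close>

definition admissible :: "(real ^ 'm) set \<Rightarrow> real \<Rightarrow> real \<Rightarrow> (real \<Rightarrow> real ^ 'm) set" where
  "admissible D t T =
     {d. d \<in> borel_measurable (lebesgue_on {t..T}) \<and> (\<forall>s\<in>{t..T}. d s \<in> D)}"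

definition abs_continuous_ivl :: "real \<Rightarrow> real \<Rightarrow> (real \<Rightarrow> 'a::real_normed_vector) \<Rightarrow> bool" where
  "abs_continuous_ivl a b \<phi> \<longleftrightarrow>
     (\<forall>\<epsilon>>0. \<exists>\<delta>>0. \<forall>(N::nat) (p::nat \<Rightarrow> real) (q::nat \<Rightarrow> real).
        (\<forall>i<N. a \<le> p i \<and> p i \<le> q i \<and> q i \<le> b) \<and>
        (\<forall>i<N. \<forall>j<N. i \<noteq> j \<longrightarrow> {p i<..<q i} \<inter> {p j<..<q j} = {}) \<and>
        (\<Sum>i<N. q i - p i) < \<delta>
        \<longrightarrow> (\<Sum>i<N. norm (\<phi> (q i) - \<phi> (p i))) < \<epsilon>)"

definition is_solution ::
  "(real ^ 'n \<Rightarrow> real ^ 'm \<Rightarrow> real ^ 'n) \<Rightarrow> (real \<Rightarrow> real ^ 'm) \<Rightarrow> real \<Rightarrow> real \<Rightarrow> real ^ 'n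
     \<Rightarrow> (real \<Rightarrow> real ^ 'n) \<Rightarrow> bool" where
  "is_solution F d t T x \<phi> \<longleftrightarrow>
     abs_continuous_ivl t T \<phi> \<and> \<phi> t = x \<and>
     (AE s in lebesgue_on {t..T}.
        (\<phi> has_vector_derivative F (\<phi> s) (d s)) (at s within {t..T}))"

text \<open>
  The solution is a function on \<open>[t,T]\<close>: extensionality fixes its values elsewhere, which makes
  the description unique.
\<close>

definition trajectory ::
  "(real ^ 'n \<Rightarrow> real ^ 'm \<Rightarrow> real ^ 'n) \<Rightarrow> (real \<Rightarrow> real ^ 'm) \<Rightarrow> real \<Rightarrow> real \<Rightarrow> real ^ 'n
     \<Rightarrow> real \<Rightarrow> real ^ 'n" where
  "trajectory F d t T x = (THE \<phi>. \<phi> \<in> extensional {t..T} \<and> is_solution F d t T x \<phi>)"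

definition cost ::
  "nat \<Rightarrow> (nat \<Rightarrow> ('n + unit) mpoly) \<Rightarrow> nat \<Rightarrow> (nat \<Rightarrow> 'n mpoly) \<Rightarrow> real \<Rightarrow> real
     \<Rightarrow> (real \<Rightarrow> real ^ 'n) \<Rightarrow> real" where
  "cost nX g nTR l t T \<phi> =
     max (MAX j\<in>{1..nTR}. meval (l j) (\<lambda>i. \<phi> T $ i))
         (MAX i\<in>{1..nX}. SUP s\<in>{t..T}. eval_xt (g i) (\<phi> s) s)"

definition value_function ::
  "(real ^ 'n \<Rightarrow> real ^ 'm \<Rightarrow> real ^ 'n) \<Rightarrow> (real ^ 'm) set \<Rightarrow> nat \<Rightarrow> (nat \<Rightarrow> ('n + unit) mpoly)
     \<Rightarrow> nat \<Rightarrow> (nat \<Rightarrow> 'n mpoly) \<Rightarrow> real \<Rightarrow> real ^ 'n \<Rightarrow> real \<Rightarrow> real" where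
  "value_function F D nX g nTR l T x t =
     (SUP d\<in>admissible D t T. cost nX g nTR l t T (trajectory F d t T x))"

section \<open>The sum-of-squares constraints\<close>

text \<open>
  \<open>mrename Inl\<close> regards a polynomial in \<open>\<real>[x]\<close> as one in \<open>\<real>[x,t]\<close>, or one in \<open>\<real>[x,t]\<close> as one in
  \<open>\<real>[x,t,d]\<close>; \<open>mrename Inr\<close> embeds \<open>\<real>[d]\<close>, and \<open>mrename (map_sum Inl id)\<close> embeds \<open>\<real>[x,d]\<close>,
  into \<open>\<real>[x,t,d]\<close>.
\<close>

definition sos_constraints ::
  "('n::finite \<Rightarrow> ('n + 'm) mpoly) \<Rightarrow> nat \<Rightarrow> (nat \<Rightarrow> 'm mpoly) \<Rightarrow> nat \<Rightarrow> (nat \<Rightarrow> ('n + unit) mpoly)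
     \<Rightarrow> nat \<Rightarrow> (nat \<Rightarrow> 'n mpoly) \<Rightarrow> real \<Rightarrow> real \<Rightarrow> ('n + unit) mpoly \<Rightarrow> bool" where
  "sos_constraints f nD h nX g nTR l R T \<psi> \<longleftrightarrow>
     (\<exists>(s0 :: (('n + unit) + 'm) mpoly) s1 s2 (s' :: nat \<Rightarrow> (('n + unit) + 'm) mpoly)
        (s3 :: nat \<Rightarrow> ('n + unit) mpoly) s4 s5
        (s6 :: nat \<Rightarrow> 'n mpoly) s7.
        is_sos s0 \<and> is_sos s1 \<and> is_sos s2 \<and> (\<forall>r\<in>{1..nD}. is_sos (s' r)) \<and>
        (\<forall>i\<in>{1..nX}. is_sos (s3 i) \<and> is_sos (s4 i) \<and> is_sos (s5 i)) \<and>
        (\<forall>j\<in>{1..nTR}. is_sos (s6 j) \<and> is_sos (s7 j)) \<and>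
        - (mrename Inl (mpartial (Inr ()) \<psi>)
            + (\<Sum>i\<in>UNIV. mrename Inl (mpartial (Inl i) \<psi>) * mrename (map_sum Inl id) (f i)))
          = s0 + s1 * mrename (Inl \<circ> Inl) (ball_poly R) + s2 * mrename Inl (time_poly T)
            + (\<Sum>r\<in>{1..nD}. s' r * mrename Inr (h r)) \<and>
        (\<forall>i\<in>{1..nX}. \<psi> - g i
          = s3 i + s4 i * mrename Inl (ball_poly R) + s5 i * time_poly T) \<and>
        (\<forall>j\<in>{1..nTR}. msubst (case_sum mvar (\<lambda>_. mconst T)) \<psi> - l j
          = s6 j + s7 j * ball_poly R))"

end

theory Submission
  imports Defs "HOL-Real_Asymp.Real_Asymp"
begin

text \<open>
  The value function \<open>u\<close> is locally Lipschitz, dominates the constraint functions, and by dynamic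
  programming satisfies \<open>u (x + h F(x,d), t + h) \<le> u (x, t) + O(h\<^sup>2)\<close> for every disturbance value \<open>d\<close>.
  Extend \<open>u\<close> in time and convolve it with the polynomial kernel \<open>(1 - \<parallel>z\<parallel>\<^sup>2 / \<rho>\<^sup>2)\<^sup>N\<close>: the result is a polynomial
  close to \<open>u\<close>, and since convolution averages difference quotients, its derivative along \<open>(F(x,d), 1)\<close> is at most
  a small constant. Adding a small multiple of \<open>T - t\<close> and a small constant makes all inequalities
  strict on the compact set where \<open>g\<^sub>R\<close>, \<open>t (T - t)\<close> and the \<open>h\<^sub>i\<close> are nonnegative. The generators \<open>g\<^sub>R\<close>, \<open>t (T - t)\<close> and
  \<open>R\<^sub>D - \<parallel>d\<parallel>\<^sup>2\<close> make the quadratic modules archimedean, so Putinar's Positivstellensatz yields the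
  certificates.

  Putinar's theorem is reduced to a box: subtracting \<open>(1 - g\<^sub>i)\<^sup>2\<^sup>k g\<^sub>i\<close> (with \<open>g\<^sub>i \<le> 1\<close> on the box)
  makes the polynomial positive on the whole box, where it is a nonnegative combination of products
  of the factors \<open>c \<plusminus> x\<^sub>v\<close>. These lie in the quadratic module of the single polynomial
  \<open>c\<^sup>2 - \<parallel>x\<parallel>\<^sup>2\<close>, which is closed under multiplication.
\<close>

text \<open>\<open>u\<close> is a supremum of maxima over trajectories, so it cannot be expected to
  be differentiable, and its Hamilton-Jacobi inequality is only available through one-sided
  difference quotients with an O(h^2) error. Uniform approximation of \<open>u\<close> alone would
  say nothing about derivatives; an average with nonnegative weights inherits upper bounds on
  difference quotients. The price is that the field is frozen at \<open>z\<close> while the kernel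
  samples at \<open>z - y\<close>: this costs a term of order |y| h, so what has to be small is the
  first moment of the kernel. The Landau kernel is truncated outside a ball, but on the ball that is
  ever sampled it is itself a polynomial, so one convolution yields both regularity and membership
  in R[x,t]. Positivity must become strict because Putinar's theorem fails for mere nonnegativity.
  Controls are merely measurable, so trajectories are differentiable only almost everywhere. All
  estimates on them (speed bounds, Gronwall, uniqueness) rest on one monotonicity statement,
  \<open>abs_continuous_ivl_antimono\<close>; existence rests on differentiating integrals almost
  everywhere.\<close>

definition mmono :: "('v::finite \<Rightarrow>\<^sub>0 nat) \<Rightarrow> ('v \<Rightarrow> real) \<Rightarrow> real" where
  "mmono m a = (\<Prod>v\<in>UNIV. a v ^ Poly_Mapping.lookup m v)"

section \<open>Monomials, and evaluation as a ring homomorphism\<close>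

lemma prod_keys_eq_UNIV:
  fixes m :: "'v::finite \<Rightarrow>\<^sub>0 nat" and a :: "'v \<Rightarrow> 'a::comm_monoid_mult"
  shows "(\<Prod>v\<in>Poly_Mapping.keys m. a v ^ Poly_Mapping.lookup m v) = (\<Prod>v\<in>UNIV. a v ^ Poly_Mapping.lookup m v)"
  by (rule prod.mono_neutral_left) (auto simp: in_keys_iff)

text \<open>A common larger index set lets two polynomials be expanded over the same monomials,
  which is what \<open>meval_add\<close> needs.\<close>

lemma meval_eq_superset:
  fixes p :: "'v::finite mpoly"
  assumes "finite A" "Poly_Mapping.keys p \<subseteq> A"
  shows "meval p a = (\<Sum>m\<in>A. Poly_Mapping.lookup p m * mmono m a)"
  unfolding meval_def mmono_def prod_keys_eq_UNIV
  by (rule sum.mono_neutral_left) (use assms in \<open>auto simp: in_keys_iff\<close>)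

lemma mmono_add: "mmono (m + m') a = mmono m a * mmono m' a"
  by (simp add: mmono_def lookup_add power_add prod.distrib)

lemma mmono_0 [simp]: "mmono 0 a = 1"
  by (simp add: mmono_def)

lemma mmono_single [simp]: "mmono (Poly_Mapping.single v k) a = a v ^ k"
proof -
  have "mmono (Poly_Mapping.single v k) a = (\<Prod>w\<in>{v}. a w ^ Poly_Mapping.lookup (Poly_Mapping.single v k) w)"
    unfolding mmono_def by (rule prod.mono_neutral_right) (auto simp: lookup_single when_def)
  thus ?thesis by simp
qed

lemma meval_0 [simp]: "meval 0 a = 0"
  by (simp add: meval_def)

lemma meval_single [simp]:
  fixes m :: "'v::finite \<Rightarrow>\<^sub>0 nat"
  shows "meval (Poly_Mapping.single m c) a = c * mmono m a"
  by (subst meval_eq_superset[of "{m}"]) auto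

lemma meval_add [simp]:
  fixes p q :: "'v::finite mpoly"
  shows "meval (p + q) a = meval p a + meval q a"
proof -
  let ?A = "Poly_Mapping.keys p \<union> Poly_Mapping.keys q"
  have "meval (p+q) a = (\<Sum>m\<in>?A. Poly_Mapping.lookup (p+q) m * mmono m a)"
    by (rule meval_eq_superset) (auto simp: keys_add)
  also have "\<dots> = (\<Sum>m\<in>?A. Poly_Mapping.lookup p m * mmono m a) + (\<Sum>m\<in>?A. Poly_Mapping.lookup q m * mmono m a)"
    by (simp add: lookup_add algebra_simps sum.distrib)
  also have "\<dots> = meval p a + meval q a"
    by (subst (1 2) meval_eq_superset[of ?A]) auto
  finally show ?thesis .
qed

lemma meval_sum [simp]:
  fixes p :: "'i \<Rightarrow> 'v::finite mpoly"
  shows "meval (\<Sum>i\<in>A. p i) a = (\<Sum>i\<in>A. meval (p i) a)"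
  by (induction A rule: infinite_finite_induct) auto

text \<open>A polynomial is the sum of its monomials, so a property that survives addition needs a
  check on single monomials only. Multiplicativity of evaluation, the chain rule and boundedness on
  boxes are obtained this way.\<close>

lemma mpoly_induct [case_names single add]:
  fixes p :: "'v mpoly"
  assumes "\<And>m c. P (Poly_Mapping.single m c)" "\<And>p q. P p \<Longrightarrow> P q \<Longrightarrow> P (p + q)"
  shows "P p"
proof -
  have "P (\<Sum>m\<in>A. Poly_Mapping.single m (Poly_Mapping.lookup p m))" for A
    by (induction A rule: infinite_finite_induct) (use assms(1)[of 0 0] in \<open>auto intro: assms\<close>)
  moreover have "p = (\<Sum>m\<in>Poly_Mapping.keys p. Poly_Mapping.single m (Poly_Mapping.lookup p m))"
    by (rule poly_mapping_eqI) (auto simp: lookup_sum lookup_single when_def in_keys_iff if_distrib cong: if_cong)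
  ultimately show ?thesis by metis
qed

lemma meval_mult [simp]:
  fixes p q :: "'v::finite mpoly"
  shows "meval (p * q) a = meval p a * meval q a"
proof (induction p rule: mpoly_induct)
  case (single m c)
  show ?case
    by (induction q rule: mpoly_induct) (auto simp: mult_single mmono_add distrib_left)
qed (auto simp: distrib_right)

lemma meval_1 [simp]: "meval (1 :: 'v::finite mpoly) a = 1"
  using meval_single[of 0 1 a] by simp

lemma meval_power [simp]:
  fixes p :: "'v::finite mpoly"
  shows "meval (p ^ k) a = meval p a ^ k"
  by (induction k) auto

lemma meval_prod [simp]:
  fixes p :: "'i \<Rightarrow> 'v::finite mpoly"
  shows "meval (\<Prod>i\<in>A. p i) a = (\<Prod>i\<in>A. meval (p i) a)"
  by (induction A rule: infinite_finite_induct) auto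

lemma meval_mconst [simp]: "meval (mconst c :: 'v::finite mpoly) a = c"
  by (simp add: mconst_def)

lemma meval_mvar [simp]: "meval (mvar v :: 'v::finite mpoly) a = a v"
  by (simp add: mvar_def)

lemma meval_uminus [simp]:
  fixes p :: "'v::finite mpoly"
  shows "meval (- p) a = - meval p a"
  using meval_add[of p "-p" a] by (simp del: meval_add)

lemma meval_diff [simp]:
  fixes p q :: "'v::finite mpoly"
  shows "meval (p - q) a = meval p a - meval q a"
  using meval_add[of p "-q" a] by simp

lemma meval_msubst [simp]:
  fixes p :: "'v::finite mpoly" and \<sigma> :: "'v \<Rightarrow> 'w::finite mpoly"
  shows "meval (msubst \<sigma> p) a = meval p (\<lambda>v. meval (\<sigma> v) a)"
  unfolding msubst_def by (simp add: meval_def[of p])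

lemma meval_mrename [simp]:
  fixes p :: "'v::finite mpoly" and \<rho> :: "'v \<Rightarrow> 'w::finite"
  shows "meval (mrename \<rho> p) a = meval p (\<lambda>v. a (\<rho> v))"
  unfolding mrename_def by simp

lemma meval_ball_poly [simp]:
  "meval (ball_poly r :: 'v::finite mpoly) a = r - (\<Sum>v\<in>UNIV. (a v)\<^sup>2)"
  unfolding ball_poly_def by simp

lemma meval_time_poly [simp]:
  "meval (time_poly T :: ('v::finite + unit) mpoly) a = a (Inr ()) * (T - a (Inr ()))"
  unfolding time_poly_def by simp

section \<open>Formal partial derivatives, and polynomials as functions\<close>

lemma mpartial_eq_superset:
  fixes p :: "'v mpoly"
  assumes "finite A" "Poly_Mapping.keys p \<subseteq> A"
  shows "mpartial v p = (\<Sum>m\<in>A. Poly_Mapping.single (m - Poly_Mapping.single v 1) (Poly_Mapping.lookup p m * real (Poly_Mapping.lookup m v)))"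
  unfolding mpartial_def
  by (rule sum.mono_neutral_left) (use assms in \<open>auto simp: in_keys_iff\<close>)

lemma mpartial_add [simp]: "mpartial v (p + q) = mpartial v p + mpartial v q"
proof -
  let ?A = "Poly_Mapping.keys p \<union> Poly_Mapping.keys q"
  show ?thesis
    by (subst (1 2 3) mpartial_eq_superset[of ?A])
       (auto simp: keys_add lookup_add algebra_simps single_add sum.distrib)
qed

lemma mpartial_single [simp]:
  "mpartial v (Poly_Mapping.single m c) = Poly_Mapping.single (m - Poly_Mapping.single v 1) (c * real (Poly_Mapping.lookup m v))"
  by (subst mpartial_eq_superset[of "{m}"]) auto

lemma mmono_minus_single:
  fixes m :: "'v::finite \<Rightarrow>\<^sub>0 nat"
  shows "real (Poly_Mapping.lookup m v) * mmono (m - Poly_Mapping.single v 1) a =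
    real (Poly_Mapping.lookup m v) * a v ^ (Poly_Mapping.lookup m v - 1) * (\<Prod>w\<in>UNIV - {v}. a w ^ Poly_Mapping.lookup m w)"
proof -
  have "mmono (m - Poly_Mapping.single v 1) a = a v ^ (Poly_Mapping.lookup m v - 1) * (\<Prod>w\<in>UNIV - {v}. a w ^ Poly_Mapping.lookup m w)"
    unfolding mmono_def
    by (subst prod.remove[of _ v]) (auto simp: lookup_minus lookup_single when_def intro!: prod.cong)
  thus ?thesis by simp
qed

text \<open>Chain rule, by the product rule on each monomial. It is applied to straight lines:
  coordinate lines in \<open>meval_eq_0_imp\<close>, segments in
  \<open>meval_lipschitz_on_box\<close>, and a line in direction \<open>v\<close> in
  \<open>polynomial_mollification\<close>.\<close>

lemma meval_has_derivative_curve: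
  fixes p :: "'v::finite mpoly"
  assumes "\<And>v. ((\<lambda>s. c s v) has_real_derivative c' v) (at s)"
  shows "((\<lambda>s. meval p (c s)) has_real_derivative (\<Sum>v\<in>UNIV. c' v * meval (mpartial v p) (c s))) (at s)"
proof (induction p rule: mpoly_induct)
  case (single m k)
  have "((\<lambda>s. \<Prod>v\<in>UNIV. c s v ^ Poly_Mapping.lookup m v) has_real_derivative
     (\<Sum>v\<in>UNIV. (real (Poly_Mapping.lookup m v) * c' v * c s v ^ (Poly_Mapping.lookup m v - 1)) * (\<Prod>w\<in>UNIV - {v}. c s w ^ Poly_Mapping.lookup m w))) (at s)"
    by (rule has_field_derivative_prod) (use assms in \<open>auto intro!: derivative_eq_intros\<close>)
  from DERIV_cmult[OF this, of k]
  have "((\<lambda>s. meval (Poly_Mapping.single m k) (c s)) has_real_derivative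
     k * (\<Sum>v\<in>UNIV. (real (Poly_Mapping.lookup m v) * c' v * c s v ^ (Poly_Mapping.lookup m v - 1)) * (\<Prod>w\<in>UNIV - {v}. c s w ^ Poly_Mapping.lookup m w))) (at s)"
    by (simp add: mmono_def)
  also have "k * (\<Sum>v\<in>UNIV. (real (Poly_Mapping.lookup m v) * c' v * c s v ^ (Poly_Mapping.lookup m v - 1)) * (\<Prod>w\<in>UNIV - {v}. c s w ^ Poly_Mapping.lookup m w))
     = (\<Sum>v\<in>UNIV. c' v * k * (real (Poly_Mapping.lookup m v) * c s v ^ (Poly_Mapping.lookup m v - 1) * (\<Prod>w\<in>UNIV - {v}. c s w ^ Poly_Mapping.lookup m w)))"
    by (simp add: sum_distrib_left mult_ac)
  also have "\<dots> = (\<Sum>v\<in>UNIV. c' v * meval (mpartial v (Poly_Mapping.single m k)) (c s))"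
    unfolding mmono_minus_single[symmetric] by (simp add: mult_ac)
  finally show ?case .
next
  case (add p q)
  from DERIV_add[OF this] show ?case by (simp add: sum.distrib distrib_left)
qed

lemma continuous_on_meval [continuous_intros]:
  fixes p :: "'v::finite mpoly"
  assumes "\<And>v. continuous_on S (\<lambda>s. c s v)"
  shows "continuous_on S (\<lambda>s. meval p (c s))"
  unfolding meval_def by (intro continuous_intros assms)

text \<open>A formula for the coefficients free of truncated subtraction; with it
  \<open>meval_eq_0_imp\<close> descends from a coefficient of \<open>p\<close> to one of lower
  degree.\<close>

lemma lookup_mpartial:
  "Poly_Mapping.lookup (mpartial v p) m = real (Poly_Mapping.lookup m v + 1) * Poly_Mapping.lookup p (m + Poly_Mapping.single v 1)"
proof (induction p rule: mpoly_induct)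
  case (single k c)
  show ?case
  proof (cases "k = m + Poly_Mapping.single v 1")
    case True
    thus ?thesis by (simp add: lookup_add)
  next
    case False
    \<comment> \<open>Lowering the exponent of \<open>v\<close> is injective except where it
      truncates, and there the coefficient carries the factor zero.\<close>
    hence "k - Poly_Mapping.single v 1 \<noteq> m \<or> Poly_Mapping.lookup k v = 0"
      unfolding poly_mapping_eq_iff fun_eq_iff lookup_add lookup_minus lookup_single when_def
      by (metis add.right_neutral diff_zero le_add_diff_inverse2 less_one not_less)
    thus ?thesis using False by (auto simp: lookup_single when_def)
  qed
qed (auto simp: lookup_add algebra_simps)

lemma meval_at_0:
  fixes p :: "'v::finite mpoly"
  shows "meval p (\<lambda>_. 0) = Poly_Mapping.lookup p 0"
proof (induction p rule: mpoly_induct)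
  case (single m c)
  have "mmono m (\<lambda>_. 0) = (if m = 0 then 1 else 0)"
    by (auto simp: mmono_def poly_mapping_eq_iff fun_eq_iff power_0_left)
  thus ?case by (simp add: lookup_single when_def)
qed (auto simp: lookup_add)

text \<open>A polynomial function determines its coefficients through its iterated partial derivatives at 0.\<close>

lemma meval_eq_0_imp:
  fixes p :: "'v::finite mpoly"
  assumes "\<And>a. meval p a = 0"
  shows "p = 0"
proof (rule poly_mapping_eqI)
  fix m :: "'v \<Rightarrow>\<^sub>0 nat"
  define N where "N = (\<Sum>v\<in>UNIV. Poly_Mapping.lookup m v)"
  have "Poly_Mapping.lookup p m = 0" using assms N_def
  proof (induction N arbitrary: m p)
    case 0
    hence "\<forall>v. Poly_Mapping.lookup m v = 0"
      by (metis finite_class.finite_UNIV iso_tuple_UNIV_I sum_eq_0_iff)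
    hence "m = 0" by (intro poly_mapping_eqI) simp
    thus ?case using meval_at_0[of p] 0 by simp
  next
    case (Suc N)
    then obtain v where v: "Poly_Mapping.lookup m v > 0"
      by (metis gr0I not_gr_zero sum.neutral Zero_neq_Suc)
    define m' where "m' = m - Poly_Mapping.single v 1"
    have m: "m = m' + Poly_Mapping.single v 1"
      using v by (auto simp: m'_def poly_mapping_eq_iff fun_eq_iff lookup_add lookup_minus lookup_single when_def)
    \<comment> \<open>On the line through \<open>a\<close> in direction \<open>v\<close> the
      polynomial is the zero function, so its derivative there vanishes too.\<close>
    have "meval (mpartial v p) a = 0" for a
    proof -
      have "((\<lambda>s. meval p (\<lambda>w. a w + s * (if w = v then 1 else 0))) has_real_derivative (\<Sum>w\<in>UNIV. (if w = v then 1 else 0) * meval (mpartial w p) (\<lambda>w. a w + 0 * (if w = v then 1 else 0)))) (at 0)"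
        by (rule meval_has_derivative_curve) (auto intro!: derivative_eq_intros)
      hence "((\<lambda>s. 0) has_real_derivative meval (mpartial v p) a) (at 0)"
        using Suc.prems(1) by (simp add: if_distrib[of "\<lambda>x. x * _"] cong: if_cong)
      thus ?thesis using DERIV_unique DERIV_const by blast
    qed
    moreover have "(\<Sum>v\<in>UNIV. Poly_Mapping.lookup m v) = (\<Sum>v\<in>UNIV. Poly_Mapping.lookup m' v) + 1"
      unfolding m by (simp add: lookup_add sum.distrib lookup_single when_def)
    ultimately have "Poly_Mapping.lookup (mpartial v p) m' = 0"
      using Suc.prems(2) by (intro Suc.IH) auto
    thus ?case by (simp add: lookup_mpartial m)
  qed
  thus "Poly_Mapping.lookup p m = Poly_Mapping.lookup 0 m" by simp
qed

text \<open>Turns identities between polynomials into identities between real functions, where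
  ordinary real arithmetic applies. The algebraic certificates below are verified in this
  way.\<close>

lemma mpoly_eqI:
  fixes p q :: "'v::finite mpoly"
  assumes "\<And>a. meval p a = meval q a"
  shows "p = q"
  using meval_eq_0_imp[of "p - q"] assms by simp

section \<open>Bounds and Lipschitz constants on boxes\<close>

lemma meval_bounded_on_box:
  fixes p :: "'v::finite mpoly"
  shows "\<exists>B\<ge>0. \<forall>a. (\<forall>v. \<bar>a v\<bar> \<le> r) \<longrightarrow> \<bar>meval p a\<bar> \<le> B"
proof (induction p rule: mpoly_induct)
  case (single m c)
  have "\<bar>meval (Poly_Mapping.single m c) a\<bar> \<le> \<bar>c\<bar> * mmono m (\<lambda>_. \<bar>r\<bar>)" if "\<forall>v. \<bar>a v\<bar> \<le> r" for a
    using that unfolding meval_single abs_mult mmono_def abs_prod power_abs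
    by (intro mult_left_mono prod_mono conjI power_mono) (auto intro: order_trans)
  moreover have "0 \<le> \<bar>c\<bar> * mmono m (\<lambda>_. \<bar>r\<bar>)"
    by (simp add: mmono_def prod_nonneg)
  ultimately show ?case by blast
next
  case (add p q)
  then obtain B B' where B: "B \<ge> 0" "B' \<ge> 0" "\<And>a. \<forall>v. \<bar>a v\<bar> \<le> r \<Longrightarrow> \<bar>meval p a\<bar> \<le> B"
    "\<And>a. \<forall>v. \<bar>a v\<bar> \<le> r \<Longrightarrow> \<bar>meval q a\<bar> \<le> B'" by blast
  show ?case
    by (rule exI[of _ "B + B'"]) (use B in \<open>auto intro: order_trans[OF abs_triangle_ineq add_mono]\<close>)
qed

text \<open>Mean value theorem on the segment from \<open>b\<close> to \<open>a\<close>, which stays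
  in the box by convexity; \<open>K\<close> dominates every partial derivative there.\<close>

lemma meval_lipschitz_on_box:
  fixes p :: "'v::finite mpoly"
  shows "\<exists>K\<ge>0. \<forall>a b. (\<forall>v. \<bar>a v\<bar> \<le> r) \<longrightarrow> (\<forall>v. \<bar>b v\<bar> \<le> r) \<longrightarrow>
           \<bar>meval p a - meval p b\<bar> \<le> K * (\<Sum>v\<in>UNIV. \<bar>a v - b v\<bar>)"
proof -
  have "\<forall>v. \<exists>B\<ge>0. \<forall>a. (\<forall>v. \<bar>a v\<bar> \<le> r) \<longrightarrow> \<bar>meval (mpartial v p) a\<bar> \<le> B"
    using meval_bounded_on_box by blast
  then obtain B where B: "\<And>v. B v \<ge> 0" "\<And>v a. (\<forall>v. \<bar>a v\<bar> \<le> r) \<Longrightarrow> \<bar>meval (mpartial v p) a\<bar> \<le> B v"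
    by metis
  define K where "K = (\<Sum>v\<in>UNIV. B v)"
  have BK: "B v \<le> K" for v unfolding K_def by (rule member_le_sum) (auto simp: B)
  have "\<bar>meval p a - meval p b\<bar> \<le> K * (\<Sum>v\<in>UNIV. \<bar>a v - b v\<bar>)"
    if a: "\<forall>v. \<bar>a v\<bar> \<le> r" and b: "\<forall>v. \<bar>b v\<bar> \<le> r" for a b
  proof -
    let ?c = "\<lambda>s v. b v + s * (a v - b v)"
    have D: "((\<lambda>s. meval p (?c s)) has_real_derivative (\<Sum>v\<in>UNIV. (a v - b v) * meval (mpartial v p) (?c s))) (at s)" for s
      by (rule meval_has_derivative_curve) (auto intro!: derivative_eq_intros)
    obtain s where s: "0 < s" "s < 1" "meval p (?c 1) - meval p (?c 0) = (1 - 0) * (\<Sum>v\<in>UNIV. (a v - b v) * meval (mpartial v p) (?c s))"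
      using MVT2[of 0 1 "\<lambda>s. meval p (?c s)" "\<lambda>s. \<Sum>v\<in>UNIV. (a v - b v) * meval (mpartial v p) (?c s)"] D by auto
    have box: "\<bar>?c s v\<bar> \<le> r" for v
    proof -
      have "?c s v = (1 - s) * b v + s * a v" by (simp add: algebra_simps)
      also have "\<bar>\<dots>\<bar> \<le> (1 - s) * r + s * r"
        using s a b by (intro order_trans[OF abs_triangle_ineq] add_mono) (auto simp: abs_mult intro!: mult_left_mono)
      finally show ?thesis by (simp add: algebra_simps)
    qed
    have "\<bar>meval p a - meval p b\<bar> = \<bar>\<Sum>v\<in>UNIV. (a v - b v) * meval (mpartial v p) (?c s)\<bar>"
      using s by simp
    also have "\<dots> \<le> (\<Sum>v\<in>UNIV. \<bar>a v - b v\<bar> * K)"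
      by (intro order_trans[OF sum_abs] sum_mono)
         (auto simp: abs_mult intro!: mult_left_mono order_trans[OF B(2) BK] box[rule_format])
    finally show ?thesis by (simp add: sum_distrib_left sum_distrib_right mult.commute)
  qed
  thus ?thesis using B(1) by (intro exI[of _ K]) (auto simp: K_def intro: sum_nonneg)
qed

section \<open>Sums of squares, quadratic modules and semirings\<close>

lemma is_sos_0: "is_sos 0"
  unfolding is_sos_def by (rule exI[of _ "[]"]) simp

lemma is_sos_square: "is_sos (q ^ 2)"
  unfolding is_sos_def by (rule exI[of _ "[q]"]) simp

lemma is_sos_add: "is_sos p \<Longrightarrow> is_sos q \<Longrightarrow> is_sos (p + q)"
  unfolding is_sos_def by (metis map_append sum_list_append)

lemma is_sos_sum: "(\<And>i. i \<in> A \<Longrightarrow> is_sos (p i)) \<Longrightarrow> is_sos (sum p A)"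
  by (induction A rule: infinite_finite_induct) (auto simp: is_sos_0 is_sos_add)

lemma is_sos_mult:
  assumes "is_sos p" "is_sos q"
  shows "is_sos (p * q)"
proof -
  obtain ps qs where p: "p = (\<Sum>r\<leftarrow>ps. r ^ 2)" and q: "q = (\<Sum>r\<leftarrow>qs. r ^ 2)"
    using assms by (auto simp: is_sos_def)
  have 1: "is_sos (r ^ 2 * (\<Sum>r\<leftarrow>qs. r ^ 2))" for r
    by (induction qs) (auto simp: is_sos_0 distrib_left power_mult_distrib[symmetric] intro: is_sos_add is_sos_square)
  show ?thesis unfolding p q
    by (induction ps) (auto simp: is_sos_0 distrib_right intro: is_sos_add 1)
qed

lemma is_sos_mconst:
  assumes "c \<ge> 0"
  shows "is_sos (mconst c :: 'v::finite mpoly)"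
proof -
  have "mconst c = (mconst (sqrt c) :: 'v mpoly) ^ 2"
    by (rule mpoly_eqI) (use assms in simp)
  thus ?thesis using is_sos_square by metis
qed

text \<open>Kept free of generators, so that one version of Putinar's theorem serves the three
  different constraint lists of the certificates.\<close>

definition quadratic_module :: "'v mpoly set \<Rightarrow> bool" where
  "quadratic_module M \<longleftrightarrow> (\<forall>p. is_sos p \<longrightarrow> p \<in> M) \<and> (\<forall>p\<in>M. \<forall>q\<in>M. p + q \<in> M) \<and>
     (\<forall>s. \<forall>p\<in>M. is_sos s \<longrightarrow> s * p \<in> M)"

definition positive_semiring :: "'v mpoly set \<Rightarrow> bool" where
  "positive_semiring P \<longleftrightarrow> (\<forall>c\<ge>0. mconst c \<in> P) \<and> (\<forall>p\<in>P. \<forall>q\<in>P. p + q \<in> P) \<and>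
     (\<forall>p\<in>P. \<forall>q\<in>P. p * q \<in> P)"

lemma quadratic_module_sum:
  assumes "quadratic_module M" "\<And>i. i \<in> A \<Longrightarrow> p i \<in> M"
  shows "sum p A \<in> M"
  using assms(2) by (induction A rule: infinite_finite_induct)
    (use assms(1) in \<open>auto simp: quadratic_module_def is_sos_0\<close>)

lemma positive_semiring_1:
  assumes "positive_semiring (P :: 'v::finite mpoly set)"
  shows "1 \<in> P"
proof -
  have "(mconst 1 :: 'v mpoly) = 1" by (rule mpoly_eqI) simp
  thus ?thesis using assms by (metis positive_semiring_def zero_le_one)
qed

lemma positive_semiring_0:
  assumes "positive_semiring (P :: 'v::finite mpoly set)"
  shows "0 \<in> P"
proof -
  have "(mconst 0 :: 'v mpoly) = 0" by (rule mpoly_eqI) simp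
  thus ?thesis using assms by (metis positive_semiring_def order_refl)
qed

lemma positive_semiring_sum:
  assumes "positive_semiring (P :: 'v::finite mpoly set)" "\<And>i. i \<in> A \<Longrightarrow> p i \<in> P"
  shows "sum p A \<in> P"
  using assms(2) by (induction A rule: infinite_finite_induct)
    (use assms(1) positive_semiring_0[OF assms(1)] in \<open>auto simp: positive_semiring_def\<close>)

lemma positive_semiring_prod:
  assumes "positive_semiring (P :: 'v::finite mpoly set)" "\<And>i. i \<in> A \<Longrightarrow> p i \<in> P"
  shows "prod p A \<in> P"
  using assms(2) by (induction A rule: infinite_finite_induct)
    (use assms(1) positive_semiring_1[OF assms(1)] in \<open>auto simp: positive_semiring_def\<close>)

lemma positive_semiring_power:
  assumes "positive_semiring (P :: 'v::finite mpoly set)" "p \<in> P"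
  shows "p ^ k \<in> P"
  by (induction k) (use assms positive_semiring_1[OF assms(1)] in \<open>auto simp: positive_semiring_def\<close>)

subsection \<open>Bernstein expansions on a box\<close>

text \<open>Multiply \<open>y ^ a\<close> by \<open>(y + (1 - y)) ^ (N - a) = 1\<close>, expand, and
  use \<open>(N choose k) (k choose a) = (N choose a) ((N - a) choose (k - a))\<close>. So the
  Bernstein coefficients of a monomial are exact ratios of binomial coefficients.\<close>

lemma bernstein_monomial:
  fixes y :: real
  assumes "a \<le> N"
  shows "y ^ a = (\<Sum>k\<in>{..N}. (real (k choose a) / real (N choose a)) * (real (N choose k) * y ^ k * (1 - y) ^ (N - k)))"
proof -
  have "(\<Sum>k\<in>{..N}. (real (k choose a) / real (N choose a)) * (real (N choose k) * y ^ k * (1 - y) ^ (N - k)))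
     = (\<Sum>k\<in>{a..N}. (real (k choose a) / real (N choose a)) * (real (N choose k) * y ^ k * (1 - y) ^ (N - k)))"
    by (rule sum.mono_neutral_right) auto
  also have "\<dots> = (\<Sum>k\<in>{a..N}. real ((N - a) choose (k - a)) * y ^ k * (1 - y) ^ (N - k))"
  proof (rule sum.cong[OF refl])
    fix k assume k: "k \<in> {a..N}"
    have "(N choose k) * (k choose a) = (N choose a) * ((N - a) choose (k - a))"
      using k by (intro choose_mult) auto
    hence "real (N choose k) * real (k choose a) = real (N choose a) * real ((N - a) choose (k - a))"
      by (metis of_nat_mult)
    moreover have "N choose a > 0" using assms by simp
    ultimately show "(real (k choose a) / real (N choose a)) * (real (N choose k) * y ^ k * (1 - y) ^ (N - k)) = real ((N - a) choose (k - a)) * y ^ k * (1 - y) ^ (N - k)"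
      by (simp add: field_simps)
  qed
  also have "\<dots> = (\<Sum>j\<in>{..N - a}. real ((N - a) choose j) * y ^ (j + a) * (1 - y) ^ (N - a - j))"
    by (rule sum.reindex_bij_witness[of _ "\<lambda>j. j + a" "\<lambda>k. k - a"]) (use assms in auto)
  also have "\<dots> = y ^ a * (y + (1 - y)) ^ (N - a)"
    unfolding binomial_ring by (simp add: sum_distrib_left power_add mult_ac)
  finally show ?thesis by simp
qed

lemma choose_ratio_le_1: "k \<le> N \<Longrightarrow> real (k choose a) / real (N choose a) \<le> 1"
  using binomial_right_mono[of k N a] by (cases "N choose a = 0") (auto simp: divide_le_eq_1)

text \<open>Bernstein coefficients approach the values at the grid points \<open>k / N\<close>,
  uniformly in \<open>k\<close>. Going from \<open>a\<close> to \<open>Suc a\<close> multiplies the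
  ratio by (k - a) / (N - a), which differs from k / N by at most a / (N - a).\<close>

lemma choose_ratio_close:
  assumes "\<epsilon> > 0"
  shows "eventually (\<lambda>N. \<forall>k\<le>N. \<bar>real (k choose a) / real (N choose a) - (real k / real N) ^ a\<bar> \<le> \<epsilon>) sequentially"
  using assms
proof (induction a arbitrary: \<epsilon>)
  case 0
  thus ?case by simp
next
  case (Suc a)
  have "(\<lambda>N. real a / (real N - real a)) \<longlonglongrightarrow> 0"
    by real_asymp
  hence "eventually (\<lambda>N. real a / (real N - real a) < \<epsilon> / 2) sequentially"
    using Suc.prems by (intro order_tendstoD) auto
  moreover have "eventually (\<lambda>N. N > a) sequentially" by (rule eventually_gt_at_top)
  moreover have "eventually (\<lambda>N. \<forall>k\<le>N. \<bar>real (k choose a) / real (N choose a) - (real k / real N) ^ a\<bar> \<le> \<epsilon> / 2) sequentially"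
    by (rule Suc.IH) (use Suc.prems in simp)
  ultimately show ?case
  proof eventually_elim
    case (elim N)
    show ?case
    proof (intro allI impI)
      fix k assume k: "k \<le> N"
      have aN: "real a < real N" "real N > 0" "real N - real a > 0" using elim by auto
      define A where "A = real (k choose a) / real (N choose a)"
      define B where "B = (real k / real N) ^ a"
      have step: "real (n choose Suc a) = real (n choose a) * (real n - real a) / (real a + 1)" for n
      proof (cases "a \<le> n")
        case True
        have "Suc a * (n choose Suc a) = (n choose a) * (n - a)"
          using binomial_absorb_comp[of n a] binomial_absorption[of a n] by (simp add: mult.commute)
        hence "(real a + 1) * real (n choose Suc a) = real (n choose a) * (real n - real a)"
          using True by (metis of_nat_Suc of_nat_diff of_nat_mult add.commute)
        thus ?thesis by (simp add: field_simps)
      qed (simp add: binomial_eq_0)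
      have eq: "real (k choose Suc a) / real (N choose Suc a) = A * ((real k - real a) / (real N - real a))"
        unfolding A_def step[of k] step[of N] by simp
      have A: "0 \<le> A" "A \<le> 1" unfolding A_def using choose_ratio_le_1[OF k] by auto
      have 1: "A * \<bar>(real k - real a) / (real N - real a) - real k / real N\<bar> \<le> \<epsilon> / 2"
      proof (cases "k < a")
        case True thus ?thesis using Suc.prems by (simp add: A_def binomial_eq_0)
      next
        case False
        have "(real k - real a) / (real N - real a) - real k / real N = - (real a / (real N - real a) * ((real N - real k) / real N))"
        proof -
          have "(real k - real a) * real N - real k * (real N - real a) = - (real a * (real N - real k))"
            by (simp add: algebra_simps)
          thus ?thesis using aN by (simp add: diff_frac_eq)
        qed
        hence "\<bar>(real k - real a) / (real N - real a) - real k / real N\<bar> = real a / (real N - real a) * ((real N - real k) / real N)"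
          using aN k by (simp add: abs_mult)
        also have "\<dots> \<le> real a / (real N - real a) * 1"
          using aN k by (intro mult_left_mono) auto
        also have "\<dots> \<le> \<epsilon> / 2" using elim by simp
        finally show ?thesis using A mult_mono[of A 1 "\<bar>(real k - real a) / (real N - real a) - real k / real N\<bar>" "\<epsilon> / 2"] by simp
      qed
      have 2: "\<bar>A - B\<bar> * (real k / real N) \<le> \<epsilon> / 2"
        using mult_mono[of "\<bar>A - B\<bar>" "\<epsilon> / 2" "real k / real N" 1] elim k
        by (auto simp: A_def B_def divide_le_eq)
      have "real (k choose Suc a) / real (N choose Suc a) - (real k / real N) ^ Suc a
         = A * ((real k - real a) / (real N - real a) - real k / real N) + (A - B) * (real k / real N)"
        unfolding eq B_def by (simp add: algebra_simps)
      also have "\<bar>\<dots>\<bar> \<le> A * \<bar>(real k - real a) / (real N - real a) - real k / real N\<bar> + \<bar>A - B\<bar> * (real k / real N)"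
        using A by (intro order_trans[OF abs_triangle_ineq]) (simp add: abs_mult)
      finally show "\<bar>real (k choose Suc a) / real (N choose Suc a) - (real k / real N) ^ Suc a\<bar> \<le> \<epsilon>"
        using 1 2 by linarith
    qed
  qed
qed

lemma positive_on_compact_bound:
  fixes f :: "'v::finite mpoly"
  assumes "compact S" "\<And>x :: real ^ 'v. x \<in> S \<Longrightarrow> meval f (($) x) > 0"
  shows "\<exists>\<delta>>0. \<forall>x\<in>S. meval f (($) x) \<ge> \<delta>"
proof (cases "S = {}")
  case False
  have "continuous_on S (\<lambda>x. meval f (($) x))" by (intro continuous_intros)
  from continuous_attains_inf[OF assms(1) False this] show ?thesis using assms(2) by blast
qed (auto intro: exI[of _ 1])

text \<open>Bernstein's theorem. For large \<open>N\<close> the coefficient \<open>b k\<close> is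
  within \<delta> of the value of \<open>f\<close> at the grid point k / N, and that value is at
  least \<delta>, the lower bound of \<open>f\<close> on the box.\<close>

lemma positive_on_unit_box_coeffs:
  fixes f :: "'v::finite mpoly"
  assumes pos: "\<And>a. (\<And>v. 0 \<le> a v \<and> a v \<le> 1) \<Longrightarrow> meval f a > 0"
  shows "\<exists>N b. (\<forall>k\<in>UNIV \<rightarrow>\<^sub>E {..N}. b k \<ge> 0) \<and>
     (\<forall>a. meval f a = (\<Sum>k\<in>UNIV \<rightarrow>\<^sub>E {..N}. b k * (\<Prod>v\<in>UNIV. real (N choose (k v)) * a v ^ k v * (1 - a v) ^ (N - k v))))"
proof -
  have "\<exists>\<delta>>0. \<forall>x\<in>cbox 0 (1 :: real ^ 'v). meval f (($) x) \<ge> \<delta>"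
    by (rule positive_on_compact_bound) (auto simp: mem_box_cart intro!: pos)
  then obtain \<delta> where \<delta>: "\<delta> > 0" "\<And>x. x \<in> cbox 0 (1 :: real ^ 'v) \<Longrightarrow> meval f (($) x) \<ge> \<delta>" by blast
  have \<delta>': "meval f a \<ge> \<delta>" if "\<And>v. 0 \<le> a v \<and> a v \<le> 1" for a
  proof -
    have "($) (\<chi> v. a v) = a" by (rule ext) simp
    thus ?thesis using \<delta>(2)[of "\<chi> v. a v"] that by (simp add: mem_box_cart)
  qed
  \<comment> \<open>The \<open>+ 1\<close> keeps \<open>S\<close> positive. Each of the
    \<open>c\<close> variables contributes an error \<epsilon> to a monomial and the coefficients
    add up to less than \<open>S\<close>, so \<epsilon> = \<delta> / (S c) leaves a total error of
    at most \<delta>.\<close>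
  define S where "S = (\<Sum>m\<in>Poly_Mapping.keys f. \<bar>Poly_Mapping.lookup f m\<bar>) + 1"
  define c where "c = real (CARD('v))"
  have S: "S > 0" unfolding S_def by (intro add_nonneg_pos sum_nonneg) auto
  have c: "c > 0" unfolding c_def by simp
  define \<epsilon> where "\<epsilon> = \<delta> / (S * c)"
  have \<epsilon>: "\<epsilon> > 0" using S c \<delta> by (simp add: \<epsilon>_def)
  have "eventually (\<lambda>N. \<forall>m\<in>Poly_Mapping.keys f. \<forall>v\<in>UNIV. \<forall>k\<le>N. \<bar>real (k choose Poly_Mapping.lookup m v) / real (N choose Poly_Mapping.lookup m v) - (real k / real N) ^ Poly_Mapping.lookup m v\<bar> \<le> \<epsilon>) sequentially"
    by (intro eventually_ball_finite finite_keys finite ballI choose_ratio_close \<epsilon>)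
  moreover have "eventually (\<lambda>N. \<forall>m\<in>Poly_Mapping.keys f. \<forall>v\<in>UNIV. N \<ge> Poly_Mapping.lookup m v) sequentially"
    by (intro eventually_ball_finite finite_keys finite ballI eventually_ge_at_top)
  ultimately have "eventually (\<lambda>N. (\<forall>m\<in>Poly_Mapping.keys f. \<forall>v\<in>UNIV. \<forall>k\<le>N. \<bar>real (k choose Poly_Mapping.lookup m v) / real (N choose Poly_Mapping.lookup m v) - (real k / real N) ^ Poly_Mapping.lookup m v\<bar> \<le> \<epsilon>)
    \<and> (\<forall>m\<in>Poly_Mapping.keys f. \<forall>v\<in>UNIV. N \<ge> Poly_Mapping.lookup m v)) sequentially"
    by (rule eventually_conj)
  from eventually_happens'[OF sequentially_bot this] obtain N where
    N': "\<forall>m\<in>Poly_Mapping.keys f. \<forall>v\<in>UNIV. \<forall>k\<le>N. \<bar>real (k choose Poly_Mapping.lookup m v) / real (N choose Poly_Mapping.lookup m v) - (real k / real N) ^ Poly_Mapping.lookup m v\<bar> \<le> \<epsilon>"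
      "\<forall>m\<in>Poly_Mapping.keys f. \<forall>v\<in>UNIV. N \<ge> Poly_Mapping.lookup m v" by blast
  have N: "\<bar>real (k choose Poly_Mapping.lookup m v) / real (N choose Poly_Mapping.lookup m v) - (real k / real N) ^ Poly_Mapping.lookup m v\<bar> \<le> \<epsilon>"
    if "m \<in> Poly_Mapping.keys f" "k \<le> N" for m v k using N'(1) that by simp
  have N2: "N \<ge> Poly_Mapping.lookup m v" if "m \<in> Poly_Mapping.keys f" for m v using N'(2) that by simp
  define r where "r = (\<lambda>k m (v :: 'v). real (k choose Poly_Mapping.lookup m v) / real (N choose Poly_Mapping.lookup m v))"
  \<comment> \<open>The expansion of a product of powers is the product of the univariate
    expansions, so each power is replaced by its own coefficient.\<close>
  define b where "b k = (\<Sum>m\<in>Poly_Mapping.keys f. Poly_Mapping.lookup f m * (\<Prod>v\<in>UNIV. r (k v) m v))" for k :: "'v \<Rightarrow> nat"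
  have "b k \<ge> 0" if k: "k \<in> UNIV \<rightarrow>\<^sub>E {..N}" for k
  proof -
    have kN: "k v \<le> N" for v using PiE_mem[OF k, of v] by simp
    have "\<bar>meval f (\<lambda>v. real (k v) / real N) - b k\<bar> = \<bar>\<Sum>m\<in>Poly_Mapping.keys f. Poly_Mapping.lookup f m * ((\<Prod>v\<in>UNIV. (real (k v) / real N) ^ Poly_Mapping.lookup m v) - (\<Prod>v\<in>UNIV. r (k v) m v))\<bar>"
      by (subst meval_eq_superset[OF finite_keys order_refl]) (simp add: b_def mmono_def sum_subtractf right_diff_distrib)
    also have "\<dots> \<le> (\<Sum>m\<in>Poly_Mapping.keys f. \<bar>Poly_Mapping.lookup f m\<bar> * (c * \<epsilon>))"
    proof (intro order_trans[OF sum_abs] sum_mono)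
      fix m assume m: "m \<in> Poly_Mapping.keys f"
      \<comment> \<open>All factors lie in [0,1], so the difference of the products is bounded by
        the sum of the differences of the factors.\<close>
      have "norm ((\<Prod>v\<in>UNIV. (real (k v) / real N) ^ Poly_Mapping.lookup m v) - (\<Prod>v\<in>UNIV. r (k v) m v))
         \<le> (\<Sum>v\<in>UNIV. norm ((real (k v) / real N) ^ Poly_Mapping.lookup m v - r (k v) m v))"
        using kN by (intro norm_prod_diff) (auto simp: r_def norm_divide choose_ratio_le_1[unfolded divide_le_eq_1] divide_le_eq_1 intro!: power_le_one choose_ratio_le_1 binomial_right_mono)
      also have "\<dots> \<le> (\<Sum>v\<in>(UNIV::'v set). \<epsilon>)"
        using N[OF m kN] by (intro sum_mono) (simp add: r_def abs_minus_commute)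
      finally show "\<bar>Poly_Mapping.lookup f m * ((\<Prod>v\<in>UNIV. (real (k v) / real N) ^ Poly_Mapping.lookup m v) - (\<Prod>v\<in>UNIV. r (k v) m v))\<bar> \<le> \<bar>Poly_Mapping.lookup f m\<bar> * (c * \<epsilon>)"
        unfolding abs_mult by (intro mult_left_mono) (auto simp: c_def)
    qed
    also have "\<dots> = (S - 1) * (c * \<epsilon>)" by (simp add: S_def sum_distrib_right)
    also have "\<dots> \<le> S * (c * \<epsilon>)" using c \<epsilon> by (intro mult_right_mono) auto
    also have "\<dots> = \<delta>" using S c by (simp add: \<epsilon>_def)
    finally have "\<bar>meval f (\<lambda>v. real (k v) / real N) - b k\<bar> \<le> \<delta>" .
    moreover have "meval f (\<lambda>v. real (k v) / real N) \<ge> \<delta>"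
      by (rule \<delta>') (use kN in \<open>auto simp: divide_le_eq_1\<close>)
    ultimately show ?thesis by linarith
  qed
  moreover have "meval f a = (\<Sum>k\<in>UNIV \<rightarrow>\<^sub>E {..N}. b k * (\<Prod>v\<in>UNIV. real (N choose (k v)) * a v ^ k v * (1 - a v) ^ (N - k v)))" for a
  proof -
    have "mmono m a = (\<Sum>k\<in>UNIV \<rightarrow>\<^sub>E {..N}. (\<Prod>v\<in>UNIV. r (k v) m v) * (\<Prod>v\<in>UNIV. real (N choose (k v)) * a v ^ k v * (1 - a v) ^ (N - k v)))"
      if m: "m \<in> Poly_Mapping.keys f" for m
    proof -
      have "mmono m a = (\<Prod>v\<in>UNIV. \<Sum>k\<in>{..N}. r k m v * (real (N choose k) * a v ^ k * (1 - a v) ^ (N - k)))"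
        unfolding mmono_def r_def by (intro prod.cong refl bernstein_monomial N2 m)
      also have "\<dots> = (\<Sum>k\<in>UNIV \<rightarrow>\<^sub>E {..N}. \<Prod>v\<in>UNIV. r (k v) m v * (real (N choose (k v)) * a v ^ k v * (1 - a v) ^ (N - k v)))"
        by (rule prod_sum_PiE) auto
      finally show ?thesis by (simp add: prod.distrib)
    qed
    hence "meval f a = (\<Sum>m\<in>Poly_Mapping.keys f. Poly_Mapping.lookup f m * (\<Sum>k\<in>UNIV \<rightarrow>\<^sub>E {..N}. (\<Prod>v\<in>UNIV. r (k v) m v) * (\<Prod>v\<in>UNIV. real (N choose (k v)) * a v ^ k v * (1 - a v) ^ (N - k v))))"
      by (subst meval_eq_superset[OF finite_keys order_refl]) simp
    also have "\<dots> = (\<Sum>k\<in>UNIV \<rightarrow>\<^sub>E {..N}. b k * (\<Prod>v\<in>UNIV. real (N choose (k v)) * a v ^ k v * (1 - a v) ^ (N - k v)))"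
      unfolding b_def sum_distrib_left sum_distrib_right by (subst sum.swap) (simp add: mult_ac)
    finally show ?thesis .
  qed
  ultimately show ?thesis by blast
qed

lemma positive_on_box_in_semiring:
  fixes f :: "'v::finite mpoly"
  assumes P: "positive_semiring P" and c: "c > 0"
    and lin: "\<And>v. mconst c + mvar v \<in> P" "\<And>v. mconst c - mvar v \<in> P"
    and pos: "\<And>a. (\<And>v. \<bar>a v\<bar> \<le> c) \<Longrightarrow> meval f a > 0"
  shows "f \<in> P"
proof -
  \<comment> \<open>\<open>f'\<close> is \<open>f\<close> in the coordinate y = (c + x) / (2 c),
    which maps [-c,c] onto [0,1]. Then y and 1 - y are the elements \<open>Y v\<close> and
    \<open>Z v\<close> below, nonnegative multiples of \<open>c + x\<close> and
    \<open>c - x\<close>.\<close>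
  define f' where "f' = msubst (\<lambda>v. mconst (2 * c) * mvar v - mconst c) f"
  have "\<And>a. (\<And>v. 0 \<le> a v \<and> a v \<le> 1) \<Longrightarrow> meval f' a > 0"
    unfolding f'_def using c by (auto intro!: pos simp: abs_le_iff)
  from positive_on_unit_box_coeffs[OF this] obtain N b where
    b: "\<And>k. k \<in> UNIV \<rightarrow>\<^sub>E {..N} \<Longrightarrow> b k \<ge> 0" and
    eq: "\<And>a. meval f' a = (\<Sum>k\<in>UNIV \<rightarrow>\<^sub>E {..N}. b k * (\<Prod>v\<in>UNIV. real (N choose (k v)) * a v ^ k v * (1 - a v) ^ (N - k v)))"
    by blast
  define Y where "Y v = mconst (1 / (2 * c)) * (mconst c + mvar v)" for v :: 'v
  define Z where "Z v = mconst (1 / (2 * c)) * (mconst c - mvar v)" for v :: 'v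
  have YZ: "Y v \<in> P" "Z v \<in> P" for v
    using P lin c unfolding Y_def Z_def positive_semiring_def by auto
  have "f = (\<Sum>k\<in>UNIV \<rightarrow>\<^sub>E {..N}. mconst (b k) * (\<Prod>v\<in>UNIV. mconst (real (N choose (k v))) * Y v ^ k v * Z v ^ (N - k v)))"
  proof (rule mpoly_eqI)
    fix a :: "'v \<Rightarrow> real"
    have "meval f a = meval f' (\<lambda>v. 1 / (2 * c) * (c + a v))"
      using c by (simp add: f'_def)
    also have "\<dots> = (\<Sum>k\<in>UNIV \<rightarrow>\<^sub>E {..N}. b k * (\<Prod>v\<in>UNIV. real (N choose (k v)) * (1 / (2 * c) * (c + a v)) ^ k v * (1 / (2 * c) * (c - a v)) ^ (N - k v)))"
    proof -
      have "1 - 1 / (2 * c) * (c + a v) = 1 / (2 * c) * (c - a v)" for v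
        using c by (simp add: field_simps)
      thus ?thesis unfolding eq by (simp only:)
    qed
    finally show "meval f a = meval (\<Sum>k\<in>UNIV \<rightarrow>\<^sub>E {..N}. mconst (b k) * (\<Prod>v\<in>UNIV. mconst (real (N choose (k v))) * Y v ^ k v * Z v ^ (N - k v))) a"
      by (simp add: Y_def Z_def)
  qed
  also have "\<dots> \<in> P"
  proof (rule positive_semiring_sum[OF P])
    fix k :: "'v \<Rightarrow> nat" assume k: "k \<in> UNIV \<rightarrow>\<^sub>E {..N}"
    have *: "p \<in> P \<Longrightarrow> q \<in> P \<Longrightarrow> p * q \<in> P" for p q using P by (auto simp: positive_semiring_def)
    have **: "mconst r \<in> P" if "r \<ge> 0" for r using P that by (auto simp: positive_semiring_def)
    show "mconst (b k) * (\<Prod>v\<in>UNIV. mconst (real (N choose (k v))) * Y v ^ k v * Z v ^ (N - k v)) \<in> P"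
      by (intro * ** b k positive_semiring_prod[OF P] positive_semiring_power[OF P] YZ) auto
  qed
  finally show ?thesis .
qed

subsection \<open>Putinar's Positivstellensatz\<close>

text \<open>By Bernoulli, (1 + 2 k y) (1 - y)^(2k) \<le> (1 - y^2)^(2k) \<le> 1 on [0,1]. So
  subtracting such a term costs little where the constraint value y is nonnegative, while for y < 0
  it adds a quantity growing with k.\<close>

lemma bump_upper_bounds:
  fixes y :: real
  assumes "y \<le> 1" "k > 0"
  shows "y * (1 - y) ^ (2 * k) \<le> 1 / (2 * real k)" and "y \<ge> 0 \<Longrightarrow> y * (1 - y) ^ (2 * k) \<le> 1"
proof -
  show "y * (1 - y) ^ (2 * k) \<le> 1 / (2 * real k)"
  proof (cases "y \<ge> 0")
    case True
    have "1 + real (2 * k) * y \<le> (1 + y) ^ (2 * k)"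
      using True by (intro Bernoulli_inequality) auto
    hence "(1 + real (2 * k) * y) * (1 - y) ^ (2 * k) \<le> (1 + y) ^ (2 * k) * (1 - y) ^ (2 * k)"
      using assms by (intro mult_right_mono) auto
    also have "\<dots> = (1 - y^2) ^ (2 * k)" by (simp add: power_mult_distrib[symmetric] power2_eq_square algebra_simps)
    also have "\<dots> \<le> 1" using True assms by (intro power_le_one) (auto simp: power_le_one)
    finally have "real (2 * k) * y * (1 - y) ^ (2 * k) \<le> 1 - (1 - y) ^ (2 * k)" by (simp add: algebra_simps)
    also have "\<dots> \<le> 1" using assms by simp
    finally show ?thesis using assms by (simp add: field_simps)
  next
    case False
    hence "y * (1 - y) ^ (2 * k) \<le> 0" by (intro mult_nonpos_nonneg) auto
    thus ?thesis by (rule order_trans) simp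
  qed
  assume "y \<ge> 0"
  thus "y * (1 - y) ^ (2 * k) \<le> 1"
    using assms by (intro mult_le_one power_le_one) auto
qed

text \<open>Compactness: points \<open>a k\<close> at which exponent k fails accumulate at some
  \<open>x\<close>. The subtracted sum is O(1/k), so \<open>f\<close> is not positive at
  \<open>x\<close>, whence some \<open>g j\<close> is negative there. Near \<open>x\<close> the term
  of \<open>j\<close> tends to minus infinity while the others stay at most 1, contradicting
  boundedness of \<open>f\<close> on the box.\<close>

lemma subtract_constraints_positive_on_box:
  fixes f :: "'v::finite mpoly" and g :: "'i \<Rightarrow> 'v mpoly"
  assumes I: "finite I" and c: "c > 0"
    and pos: "\<And>a. (\<And>i. i \<in> I \<Longrightarrow> meval (g i) a \<ge> 0) \<Longrightarrow> meval f a > 0"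
    and le1: "\<And>a i. i \<in> I \<Longrightarrow> (\<And>v. \<bar>a v\<bar> \<le> c) \<Longrightarrow> meval (g i) a \<le> 1"
  shows "\<exists>k. \<forall>a. (\<forall>v. \<bar>a v\<bar> \<le> c) \<longrightarrow> meval (f - (\<Sum>i\<in>I. (1 - g i) ^ (2 * k) * g i)) a > 0"
proof (rule ccontr)
  assume "\<not> ?thesis"
  hence "\<forall>k. \<exists>a. (\<forall>v. \<bar>a v\<bar> \<le> c) \<and> meval f a \<le> (\<Sum>i\<in>I. (1 - meval (g i) a) ^ (2 * k) * meval (g i) a)"
    by (simp add: not_less)
  then obtain a where a': "\<forall>k. (\<forall>v. \<bar>a k v\<bar> \<le> c) \<and> meval f (a k) \<le> (\<Sum>i\<in>I. (1 - meval (g i) (a k)) ^ (2 * k) * meval (g i) (a k))"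
    by (rule choice[THEN exE])
  hence a: "\<bar>a k v\<bar> \<le> c" "meval f (a k) \<le> (\<Sum>i\<in>I. (1 - meval (g i) (a k)) ^ (2 * k) * meval (g i) (a k))" for k v
    by simp_all
  define A where "A k = (\<chi> v. a k v)" for k
  have Aa: "($) (A k) = a k" for k by (auto simp: A_def)
  have "\<forall>k. A k \<in> cbox (\<chi> v. -c) (\<chi> v. c)"
  proof -
    have "- c \<le> a k v \<and> a k v \<le> c" for k v using a(1)[of k v] by linarith
    thus ?thesis by (simp add: mem_box_cart A_def)
  qed
  moreover have "seq_compact (cbox (\<chi> v. -c) (\<chi> v. c) :: (real ^ 'v) set)"
    using compact_cbox compact_eq_seq_compact_metric by blast
  ultimately obtain x r where x: "x \<in> cbox (\<chi> v. -c) (\<chi> v. c)" "strict_mono r" "(A \<circ> r) \<longlonglongrightarrow> x"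
    unfolding seq_compact_def by blast
  have lim: "(\<lambda>k. meval p (a (r k))) \<longlonglongrightarrow> meval p (($) x)" for p
  proof -
    have "continuous_on UNIV (\<lambda>x :: real ^ 'v. meval p (($) x))" by (intro continuous_intros)
    hence "isCont (\<lambda>x :: real ^ 'v. meval p (($) x)) x" by (simp add: continuous_on_eq_continuous_at)
    from isCont_tendsto_compose[OF this x(3)] show ?thesis by (simp add: Aa o_def)
  qed
  \<comment> \<open>Bounds for the exponent \<open>r k\<close> of the subsequence may thus be stated
    in terms of \<open>k\<close>.\<close>
  have rk: "r k \<ge> k" for k using x(2) by (rule seq_suble)
  have f_le0: "meval f (($) x) \<le> 0"
  proof (rule LIMSEQ_le[OF lim])
    show "(\<lambda>k. real (card I) / (2 * real k)) \<longlonglongrightarrow> 0" by real_asymp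
    show "\<exists>N. \<forall>k\<ge>N. meval f (a (r k)) \<le> real (card I) / (2 * real k)"
    proof (intro exI allI impI)
      fix k :: nat assume k: "k \<ge> 1"
      have "meval f (a (r k)) \<le> (\<Sum>i\<in>I. (1 - meval (g i) (a (r k))) ^ (2 * r k) * meval (g i) (a (r k)))" by (rule a)
      also have "\<dots> \<le> (\<Sum>i\<in>I. 1 / (2 * real k))"
      proof (rule sum_mono)
        fix i assume i: "i \<in> I"
        have "meval (g i) (a (r k)) * (1 - meval (g i) (a (r k))) ^ (2 * r k) \<le> 1 / (2 * real (r k))"
          using rk[of k] k by (intro bump_upper_bounds le1 i a) auto
        also have "\<dots> \<le> 1 / (2 * real k)" using rk[of k] k by (simp add: field_simps)
        finally show "(1 - meval (g i) (a (r k))) ^ (2 * r k) * meval (g i) (a (r k)) \<le> 1 / (2 * real k)" by (simp add: mult.commute)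
      qed
      finally show "meval f (a (r k)) \<le> real (card I) / (2 * real k)" by simp
    qed
  qed
  then obtain j where j: "j \<in> I" "meval (g j) (($) x) < 0"
    using pos[of "($) x"] by force
  \<comment> \<open>Half of the violation at the limit point, so that the strict bound by -\<eta>
    persists on a tail of the sequence.\<close>
  define \<eta> where "\<eta> = - meval (g j) (($) x) / 2"
  have \<eta>: "\<eta> > 0" "meval (g j) (($) x) < - \<eta>" using j by (auto simp: \<eta>_def)
  obtain B where B: "\<And>a. \<forall>v. \<bar>a v\<bar> \<le> c \<Longrightarrow> \<bar>meval f a\<bar> \<le> B" using meval_bounded_on_box by blast
  have "eventually (\<lambda>k. meval (g j) (a (r k)) < - \<eta>) sequentially"
    by (rule order_tendstoD(2)[OF lim \<eta>(2)])
  \<comment> \<open>The sum is at most card I - k \<eta>^2 and at least -B; this threshold makes the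
    two incompatible.\<close>
  moreover have "eventually (\<lambda>k. real k > (B + card I) / \<eta>^2) sequentially" using filterlim_real_sequentially unfolding filterlim_at_top_dense by blast
  moreover have "eventually (\<lambda>k. k \<ge> 1) sequentially" by (rule eventually_ge_at_top)
  ultimately have "eventually (\<lambda>k. False) sequentially"
  proof eventually_elim
    case (elim k)
    let ?y = "\<lambda>i. meval (g i) (a (r k))"
    have "?y j * (1 - ?y j) ^ (2 * r k) \<le> - \<eta> * (1 + real (2 * r k) * \<eta>)"
    proof -
      have "1 + real (2 * r k) * \<eta> \<le> (1 + \<eta>) ^ (2 * r k)"
        using \<eta> by (intro Bernoulli_inequality) auto
      also have "\<dots> \<le> (1 - ?y j) ^ (2 * r k)" using elim \<eta> by (intro power_mono) auto
      finally have "\<eta> * (1 + real (2 * r k) * \<eta>) \<le> (- ?y j) * (1 - ?y j) ^ (2 * r k)"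
        using elim \<eta> by (intro mult_mono) auto
      thus ?thesis by simp
    qed
    also have "\<dots> \<le> - (real k * \<eta>^2)"
    proof -
      have "real k * \<eta>^2 \<le> real (2 * r k) * \<eta>^2" using rk[of k] by (intro mult_right_mono) auto
      moreover have "- \<eta> * (1 + real (2 * r k) * \<eta>) = - \<eta> - real (2 * r k) * \<eta>^2"
        by (simp add: power2_eq_square algebra_simps)
      ultimately show ?thesis using \<eta>(1) by linarith
    qed
    finally have 1: "?y j * (1 - ?y j) ^ (2 * r k) \<le> - (real k * \<eta>^2)" .
    have 2: "(1 - ?y i) ^ (2 * r k) * ?y i \<le> 1" if "i \<in> I" for i
    proof (cases "?y i \<ge> 0")
      case True
      have "?y i * (1 - ?y i) ^ (2 * r k) \<le> 1"
        using rk[of k] elim by (intro bump_upper_bounds(2) le1 that a True) auto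
      thus ?thesis by (simp add: mult.commute)
    next
      case False
      hence "?y i * (1 - ?y i) ^ (2 * r k) \<le> 0" by (intro mult_nonpos_nonneg) auto
      thus ?thesis by (simp add: mult.commute)
    qed
    have "- B \<le> meval f (a (r k))"
    proof -
      have "\<bar>meval f (a (r k))\<bar> \<le> B" using B a(1) by blast
      thus ?thesis by linarith
    qed
    also have "\<dots> \<le> (\<Sum>i\<in>I. (1 - ?y i) ^ (2 * r k) * ?y i)" by (rule a)
    also have "\<dots> = (1 - ?y j) ^ (2 * r k) * ?y j + (\<Sum>i\<in>I - {j}. (1 - ?y i) ^ (2 * r k) * ?y i)"
      by (rule sum.remove[OF I j(1)])
    also have "\<dots> \<le> - (real k * \<eta>^2) + (\<Sum>i\<in>I - {j}. 1)"
      using 1 2 by (intro add_mono sum_mono) (auto simp: mult.commute)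
    also have "\<dots> \<le> - (real k * \<eta>^2) + card I" using I card_mono[of I "I - {j}"] by (simp del: card_Diff_insert)
    finally have "real k * \<eta>^2 \<le> B + card I" by simp
    moreover have "real k * \<eta>^2 > B + card I" using elim \<eta> by (simp add: field_simps)
    ultimately show False by simp
  qed
  thus False by simp
qed

text \<open>With a single generator the only new term in a product is
  \<open>s1 * t1 * G ^ 2\<close>, and \<open>G ^ 2\<close> is a square. With two generators the
  mixed product would remain.\<close>

lemma ball_module_semiring:
  fixes G :: "'v::finite mpoly"
  shows "positive_semiring {s0 + s1 * G | s0 s1. is_sos s0 \<and> is_sos s1}"
  unfolding positive_semiring_def
proof (intro conjI allI impI ballI)
  fix c :: real assume "c \<ge> 0"
  hence "is_sos (mconst c :: 'v mpoly)" "mconst c = mconst c + 0 * G" by (auto intro: is_sos_mconst)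
  thus "mconst c \<in> {s0 + s1 * G | s0 s1. is_sos s0 \<and> is_sos s1}" using is_sos_0 by blast
next
  fix p q assume "p \<in> {s0 + s1 * G | s0 s1. is_sos s0 \<and> is_sos s1}" "q \<in> {s0 + s1 * G | s0 s1. is_sos s0 \<and> is_sos s1}"
  then obtain s0 s1 t0 t1 where *: "p = s0 + s1 * G" "q = t0 + t1 * G" "is_sos s0" "is_sos s1" "is_sos t0" "is_sos t1" by blast
  have "p + q = (s0 + t0) + (s1 + t1) * G" using * by (simp add: algebra_simps)
  thus "p + q \<in> {s0 + s1 * G | s0 s1. is_sos s0 \<and> is_sos s1}" using * is_sos_add by blast
  have "p * q = (s0 * t0 + s1 * t1 * G ^ 2) + (s0 * t1 + s1 * t0) * G" using * by (simp add: algebra_simps power2_eq_square)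
  moreover have "is_sos (s0 * t0 + s1 * t1 * G ^ 2)" "is_sos (s0 * t1 + s1 * t0)"
    using * by (auto intro!: is_sos_add is_sos_mult is_sos_square)
  ultimately show "p * q \<in> {s0 + s1 * G | s0 s1. is_sos s0 \<and> is_sos s1}" by blast
qed

text \<open>Completing the square: with s = sqrt N, 2 s (s \<plusminus> x_v) = (s \<plusminus>
  x_v)^2 + (sum of the other x_w^2) + (N - |x|^2). The parameter \<sigma> treats both signs at
  once.\<close>

lemma ball_module_linear:
  fixes v :: "'v::finite"
  assumes \<sigma>: "\<sigma> = 1 \<or> \<sigma> = - 1" and N: "N > 0"
  shows "\<exists>s0 s1. is_sos s0 \<and> is_sos s1 \<and> mconst (sqrt N) + mconst \<sigma> * mvar v = s0 + s1 * ball_poly N"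
proof (intro exI conjI)
  let ?k = "mconst (1 / (2 * sqrt N)) :: 'v mpoly"
  show "is_sos (?k * ((mconst (sqrt N) + mconst \<sigma> * mvar v) ^ 2 + (\<Sum>w\<in>UNIV - {v}. mvar w ^ 2)))"
    using N by (intro is_sos_mult is_sos_mconst is_sos_add is_sos_square is_sos_sum) auto
  show "is_sos ?k" using N by (intro is_sos_mconst) auto
  show "mconst (sqrt N) + mconst \<sigma> * mvar v = ?k * ((mconst (sqrt N) + mconst \<sigma> * mvar v) ^ 2 + (\<Sum>w\<in>UNIV - {v}. mvar w ^ 2)) + ?k * ball_poly N"
  proof (rule mpoly_eqI)
    fix a :: "'v \<Rightarrow> real"
    have s: "(\<Sum>w\<in>UNIV. (a w)\<^sup>2) = (a v)\<^sup>2 + (\<Sum>w\<in>UNIV - {v}. (a w)\<^sup>2)" by (rule sum.remove) auto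
    have "(sqrt N + \<sigma> * a v)\<^sup>2 = N + (a v)^2 + 2 * sqrt N * \<sigma> * a v"
      using \<sigma> N by (auto simp: power2_eq_square algebra_simps)
    hence "(sqrt N + \<sigma> * a v)\<^sup>2 + (\<Sum>w\<in>UNIV - {v}. (a w)\<^sup>2) + (N - (\<Sum>w\<in>UNIV. (a w)\<^sup>2)) = 2 * N + 2 * sqrt N * \<sigma> * a v"
      by (simp add: s)
    also have "\<dots> = 2 * sqrt N * (sqrt N + \<sigma> * a v)" using N by (simp add: algebra_simps)
    finally have "sqrt N + \<sigma> * a v = 1 / (2 * sqrt N) * ((sqrt N + \<sigma> * a v)\<^sup>2 + (\<Sum>w\<in>UNIV - {v}. (a w)\<^sup>2) + (N - (\<Sum>w\<in>UNIV. (a w)\<^sup>2)))"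
      using N by simp
    thus "meval (mconst (sqrt N) + mconst \<sigma> * mvar v) a = meval (?k * ((mconst (sqrt N) + mconst \<sigma> * mvar v) ^ 2 + (\<Sum>w\<in>UNIV - {v}. mvar w ^ 2)) + ?k * ball_poly N) a"
      by (simp add: ring_distribs)
  qed
qed

text \<open>The archimedean property is the membership of one ball polynomial. It puts the semiring
  of that ball inside \<open>M\<close>, and the sum subtracted from \<open>f\<close> is itself in
  \<open>M\<close> because even powers are squares.\<close>

theorem putinar:
  fixes f :: "'v::finite mpoly" and g :: "'i \<Rightarrow> 'v mpoly"
  assumes M: "quadratic_module M" and arch: "ball_poly N \<in> M" and N: "N > 0"
    and I: "finite I" and g: "\<And>i. i \<in> I \<Longrightarrow> g i \<in> M"
    and pos: "\<And>a. (\<And>i. i \<in> I \<Longrightarrow> meval (g i) a \<ge> 0) \<Longrightarrow> meval f a > 0"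
  shows "f \<in> M"
proof -
  define P where "P = {s0 + s1 * ball_poly N | s0 s1 :: 'v mpoly. is_sos s0 \<and> is_sos s1}"
  have PM: "P \<subseteq> M" using M arch unfolding P_def quadratic_module_def by blast
  have sr: "positive_semiring P" unfolding P_def by (rule ball_module_semiring)
  define c where "c = sqrt N"
  have c: "c > 0" using N by (simp add: c_def)
  have "\<forall>i. \<exists>B\<ge>0. \<forall>a :: 'v \<Rightarrow> real. (\<forall>v. \<bar>a v\<bar> \<le> c) \<longrightarrow> \<bar>meval (g i) a\<bar> \<le> B" using meval_bounded_on_box by blast
  then obtain B where B: "\<And>i. B i \<ge> 0" "\<And>i (a :: 'v \<Rightarrow> real). (\<forall>v. \<bar>a v\<bar> \<le> c) \<Longrightarrow> \<bar>meval (g i) a\<bar> \<le> B i" by metis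
  \<comment> \<open>Scaling makes the constraints at most 1 on the box without changing their signs;
    \<open>B i + 1\<close> excludes a zero denominator.\<close>
  define g' where "g' i = mconst (1 / (B i + 1)) * g i" for i
  have B1: "B i + 1 > 0" for i using B(1)[of i] by simp
  have "\<exists>k. \<forall>a. (\<forall>v. \<bar>a v\<bar> \<le> c) \<longrightarrow> meval (f - (\<Sum>i\<in>I. (1 - g' i) ^ (2 * k) * g' i)) a > 0"
  proof (rule subtract_constraints_positive_on_box[OF I c])
    fix a assume "\<And>i. i \<in> I \<Longrightarrow> meval (g' i) a \<ge> 0"
    thus "meval f a > 0"
      using B1 by (intro pos) (auto simp: g'_def zero_le_divide_iff less_imp_le not_le[symmetric])
  next
    fix a :: "'v \<Rightarrow> real" and i assume "i \<in> I" "\<And>v. \<bar>a v\<bar> \<le> c"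
    hence "meval (g i) a \<le> B i + 1" using B(2)[of a i] by auto
    thus "meval (g' i) a \<le> 1" using B1[of i] by (simp add: g'_def divide_le_eq)
  qed
  then obtain k where k: "\<And>a. (\<And>v. \<bar>a v\<bar> \<le> c) \<Longrightarrow> meval (f - (\<Sum>i\<in>I. (1 - g' i) ^ (2 * k) * g' i)) a > 0" by blast
  have "mconst c + mvar v \<in> P" "mconst c - mvar v \<in> P" for v
  proof -
    have e: "mconst c + mconst 1 * mvar v = mconst c + mvar v" "mconst c + mconst (-1) * mvar v = mconst c - mvar v"
      by (rule mpoly_eqI, simp)+
    show "mconst c + mvar v \<in> P" "mconst c - mvar v \<in> P"
      using ball_module_linear[OF _ N, of 1 v] ball_module_linear[OF _ N, of "-1" v]
      unfolding c_def[symmetric] e P_def by blast+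
  qed
  from positive_on_box_in_semiring[OF sr c this k]
  have 1: "f - (\<Sum>i\<in>I. (1 - g' i) ^ (2 * k) * g' i) \<in> M" using PM by blast
  have 2: "(\<Sum>i\<in>I. (1 - g' i) ^ (2 * k) * g' i) \<in> M"
  proof (rule quadratic_module_sum[OF M])
    fix i assume "i \<in> I"
    moreover have "is_sos (mconst (1 / (B i + 1)) :: 'v mpoly)" using B1[of i] by (intro is_sos_mconst) auto
    ultimately have "g' i \<in> M" using M g unfolding g'_def quadratic_module_def by blast
    moreover have "is_sos ((1 - g' i) ^ (2 * k))" using is_sos_square[of "(1 - g' i) ^ k"] by (simp add: power_mult[symmetric] mult.commute)
    ultimately show "(1 - g' i) ^ (2 * k) * g' i \<in> M" using M by (auto simp: quadratic_module_def)
  qed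
  have "(f - (\<Sum>i\<in>I. (1 - g' i) ^ (2 * k) * g' i)) + (\<Sum>i\<in>I. (1 - g' i) ^ (2 * k) * g' i) \<in> M"
    using M 1 2 unfolding quadratic_module_def by blast
  thus ?thesis by simp
qed

subsection \<open>Absolutely continuous functions\<close>

lemma abs_continuous_ivl_natD:
  assumes "abs_continuous_ivl a b \<phi>" "\<epsilon> > 0"
  shows "\<exists>\<delta>>0. \<forall>(N::nat) p q. (\<forall>i<N. a \<le> p i \<and> p i \<le> q i \<and> q i \<le> b) \<longrightarrow>
     (\<forall>i<N. \<forall>j<N. i \<noteq> j \<longrightarrow> {p i<..<q i} \<inter> {p j<..<q j} = {}) \<longrightarrow>
     (\<Sum>i<N. q i - p i) < \<delta> \<longrightarrow> (\<Sum>i<N. norm (\<phi> (q i) - \<phi> (p i))) < \<epsilon>"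
proof -
  from assms(1)[unfolded abs_continuous_ivl_def, rule_format, OF assms(2)]
  show ?thesis unfolding imp_conjL .
qed

text \<open>Intervals indexed by an arbitrary finite set instead of an initial segment of the
  naturals, so that the tagged intervals of a division can index themselves.\<close>

lemma abs_continuous_ivl_setD:
  assumes "abs_continuous_ivl a b \<phi>" "\<epsilon> > 0"
  shows "\<exists>\<delta>>0. \<forall>(q :: 'i set) l u. finite q \<longrightarrow> (\<forall>i\<in>q. a \<le> l i \<and> l i \<le> u i \<and> u i \<le> b) \<longrightarrow>
     (\<forall>i\<in>q. \<forall>j\<in>q. i \<noteq> j \<longrightarrow> {l i<..<u i} \<inter> {l j<..<u j} = {}) \<longrightarrow> (\<Sum>i\<in>q. u i - l i) < \<delta>
     \<longrightarrow> (\<Sum>i\<in>q. norm (\<phi> (u i) - \<phi> (l i))) < \<epsilon>"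
proof -
  obtain \<delta> where \<delta>: "\<delta> > 0" and D: "\<forall>(N::nat) p q. (\<forall>i<N. a \<le> p i \<and> p i \<le> q i \<and> q i \<le> b) \<longrightarrow>
     (\<forall>i<N. \<forall>j<N. i \<noteq> j \<longrightarrow> {p i<..<q i} \<inter> {p j<..<q j} = {}) \<longrightarrow>
     (\<Sum>i<N. q i - p i) < \<delta> \<longrightarrow> (\<Sum>i<N. norm (\<phi> (q i) - \<phi> (p i))) < \<epsilon>"
    using abs_continuous_ivl_natD[OF assms] by (elim exE conjE)
  show ?thesis
  proof (intro exI[of _ \<delta>] conjI allI impI \<delta>)
    fix q :: "'i set" and l u
    assume q: "finite q" "\<forall>i\<in>q. a \<le> l i \<and> l i \<le> u i \<and> u i \<le> b"
      "\<forall>i\<in>q. \<forall>j\<in>q. i \<noteq> j \<longrightarrow> {l i<..<u i} \<inter> {l j<..<u j} = {}" "(\<Sum>i\<in>q. u i - l i) < \<delta>"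
    obtain h where h: "bij_betw h {0..<card q} q" using ex_bij_betw_nat_finite[OF q(1)] by blast
    hence h': "bij_betw h {..<card q} q" by (simp add: atLeast0LessThan)
    have hq: "h i \<in> q" if "i < card q" for i using h' that by (auto simp: bij_betw_def)
    have inj: "h i \<noteq> h j" if "i < card q" "j < card q" "i \<noteq> j" for i j
      using h' that by (auto simp: bij_betw_def inj_on_def)
    have "(\<Sum>i<card q. norm (\<phi> (u (h i)) - \<phi> (l (h i)))) < \<epsilon>"
    proof (rule D[THEN spec, THEN spec, THEN spec, THEN mp, THEN mp, THEN mp])
      show "(\<Sum>i<card q. u (h i) - l (h i)) < \<delta>"
        using q(4) sum.reindex_bij_betw[OF h', of "\<lambda>i. u i - l i"] by simp
      show "\<forall>i<card q. a \<le> l (h i) \<and> l (h i) \<le> u (h i) \<and> u (h i) \<le> b" using q(2) hq by simp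
      show "\<forall>i<card q. \<forall>j<card q. i \<noteq> j \<longrightarrow> {l (h i)<..<u (h i)} \<inter> {l (h j)<..<u (h j)} = {}"
        using q(3) hq inj by blast
    qed
    thus "(\<Sum>i\<in>q. norm (\<phi> (u i) - \<phi> (l i))) < \<epsilon>"
      using sum.reindex_bij_betw[OF h', of "\<lambda>i. norm (\<phi> (u i) - \<phi> (l i))"] by simp
  qed
qed

text \<open>One transfer principle for all derived curves: Lipschitz functions (against a constant
  curve), inner products with a fixed vector, removal of a linear drift, and functions that agree on
  the interval.\<close>

lemma abs_continuous_ivl_dominated:
  assumes "abs_continuous_ivl a b \<phi>"
    and "\<And>s r. s \<in> {a..b} \<Longrightarrow> r \<in> {a..b} \<Longrightarrow> norm (\<psi> s - \<psi> r) \<le> K * (\<bar>s - r\<bar> + norm (\<phi> s - \<phi> r))"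
  shows "abs_continuous_ivl a b \<psi>"
  unfolding abs_continuous_ivl_def
proof (intro allI impI)
  fix \<epsilon> :: real assume \<epsilon>: "\<epsilon> > 0"
  \<comment> \<open>\<open>K\<close> may be zero or negative; \<open>k\<close> is a positive
    substitute. The time increments and the increments of \<phi> each receive half of
    \<epsilon>.\<close>
  define k where "k = \<bar>K\<bar> + 1"
  have k: "k > 0" "K \<le> k" by (auto simp: k_def)
  have e: "\<epsilon> / (2 * k) > 0" using \<epsilon> k by simp
  obtain \<delta> where \<delta>: "\<delta> > 0" and D: "\<forall>(N::nat) p q. (\<forall>i<N. a \<le> p i \<and> p i \<le> q i \<and> q i \<le> b) \<longrightarrow>
     (\<forall>i<N. \<forall>j<N. i \<noteq> j \<longrightarrow> {p i<..<q i} \<inter> {p j<..<q j} = {}) \<longrightarrow>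
     (\<Sum>i<N. q i - p i) < \<delta> \<longrightarrow> (\<Sum>i<N. norm (\<phi> (q i) - \<phi> (p i))) < \<epsilon> / (2 * k)"
    using abs_continuous_ivl_natD[OF assms(1) e] by (elim exE conjE)
  show "\<exists>\<delta>>0. \<forall>(N::nat) (p::nat \<Rightarrow> real) (q::nat \<Rightarrow> real).
        (\<forall>i<N. a \<le> p i \<and> p i \<le> q i \<and> q i \<le> b) \<and>
        (\<forall>i<N. \<forall>j<N. i \<noteq> j \<longrightarrow> {p i<..<q i} \<inter> {p j<..<q j} = {}) \<and>
        (\<Sum>i<N. q i - p i) < \<delta>
        \<longrightarrow> (\<Sum>i<N. norm (\<psi> (q i) - \<psi> (p i))) < \<epsilon>"
  proof (intro exI[of _ "min \<delta> (\<epsilon> / (2 * k))"] conjI allI impI)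
    show "0 < min \<delta> (\<epsilon> / (2 * k))" using \<delta> e by simp
    fix N :: nat and p q :: "nat \<Rightarrow> real"
    assume A: "(\<forall>i<N. a \<le> p i \<and> p i \<le> q i \<and> q i \<le> b) \<and>
        (\<forall>i<N. \<forall>j<N. i \<noteq> j \<longrightarrow> {p i<..<q i} \<inter> {p j<..<q j} = {}) \<and>
        (\<Sum>i<N. q i - p i) < min \<delta> (\<epsilon> / (2 * k))"
    hence S: "(\<Sum>i<N. norm (\<phi> (q i) - \<phi> (p i))) < \<epsilon> / (2 * k)" by (intro D[rule_format]) auto
    have "(\<Sum>i<N. norm (\<psi> (q i) - \<psi> (p i))) \<le> (\<Sum>i<N. k * ((q i - p i) + norm (\<phi> (q i) - \<phi> (p i))))"
    proof (rule sum_mono)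
      fix i assume i: "i \<in> {..<N}"
      have pq: "a \<le> p i" "p i \<le> q i" "q i \<le> b" using A i by auto
      have "norm (\<psi> (q i) - \<psi> (p i)) \<le> K * (\<bar>q i - p i\<bar> + norm (\<phi> (q i) - \<phi> (p i)))"
        using pq by (intro assms(2)) auto
      also have "\<dots> \<le> k * (\<bar>q i - p i\<bar> + norm (\<phi> (q i) - \<phi> (p i)))"
        using k by (intro mult_right_mono) auto
      finally show "norm (\<psi> (q i) - \<psi> (p i)) \<le> k * ((q i - p i) + norm (\<phi> (q i) - \<phi> (p i)))" using pq by simp
    qed
    also have "\<dots> = k * ((\<Sum>i<N. q i - p i) + (\<Sum>i<N. norm (\<phi> (q i) - \<phi> (p i))))"
      by (simp only: sum_distrib_left[symmetric] sum.distrib)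
    also have "\<dots> < k * (\<epsilon> / (2 * k) + \<epsilon> / (2 * k))"
      using A S k by (intro mult_strict_left_mono add_strict_mono) auto
    also have "\<dots> = \<epsilon>" using k by (simp add: field_simps)
    finally show "(\<Sum>i<N. norm (\<psi> (q i) - \<psi> (p i))) < \<epsilon>" .
  qed
qed

lemma abs_continuous_ivl_subset:
  assumes "abs_continuous_ivl a b \<phi>" "a \<le> a'" "b' \<le> b"
  shows "abs_continuous_ivl a' b' \<phi>"
  unfolding abs_continuous_ivl_def
proof (intro allI impI)
  fix \<epsilon> :: real assume \<epsilon>: "\<epsilon> > 0"
  obtain \<delta> where \<delta>: "\<delta> > 0" and D: "\<forall>(N::nat) p q. (\<forall>i<N. a \<le> p i \<and> p i \<le> q i \<and> q i \<le> b) \<longrightarrow>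
     (\<forall>i<N. \<forall>j<N. i \<noteq> j \<longrightarrow> {p i<..<q i} \<inter> {p j<..<q j} = {}) \<longrightarrow>
     (\<Sum>i<N. q i - p i) < \<delta> \<longrightarrow> (\<Sum>i<N. norm (\<phi> (q i) - \<phi> (p i))) < \<epsilon>"
    using abs_continuous_ivl_natD[OF assms(1) \<epsilon>] by (elim exE conjE)
  show "\<exists>\<delta>>0. \<forall>(N::nat) (p::nat \<Rightarrow> real) (q::nat \<Rightarrow> real).
        (\<forall>i<N. a' \<le> p i \<and> p i \<le> q i \<and> q i \<le> b') \<and>
        (\<forall>i<N. \<forall>j<N. i \<noteq> j \<longrightarrow> {p i<..<q i} \<inter> {p j<..<q j} = {}) \<and>
        (\<Sum>i<N. q i - p i) < \<delta>
        \<longrightarrow> (\<Sum>i<N. norm (\<phi> (q i) - \<phi> (p i))) < \<epsilon>"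
  proof (intro exI[of _ \<delta>] conjI allI impI \<delta>)
    fix N :: nat and p q :: "nat \<Rightarrow> real"
    assume A: "(\<forall>i<N. a' \<le> p i \<and> p i \<le> q i \<and> q i \<le> b') \<and>
        (\<forall>i<N. \<forall>j<N. i \<noteq> j \<longrightarrow> {p i<..<q i} \<inter> {p j<..<q j} = {}) \<and>
        (\<Sum>i<N. q i - p i) < \<delta>"
    show "(\<Sum>i<N. norm (\<phi> (q i) - \<phi> (p i))) < \<epsilon>"
      by (rule D[rule_format]) (use A assms in \<open>force+\<close>)
  qed
qed

lemma lipschitz_imp_abs_continuous_ivl:
  assumes "\<And>s r. s \<in> {a..b} \<Longrightarrow> r \<in> {a..b} \<Longrightarrow> norm (\<psi> s - \<psi> r) \<le> K * \<bar>s - r\<bar>"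
  shows "abs_continuous_ivl a b \<psi>"
proof (rule abs_continuous_ivl_dominated)
  show "abs_continuous_ivl a b (\<lambda>_. 0 :: real)"
    unfolding abs_continuous_ivl_def by (auto intro: exI[of _ 1])
  show "norm (\<psi> s - \<psi> r) \<le> K * (\<bar>s - r\<bar> + norm (0 - 0 :: real))" if "s \<in> {a..b}" "r \<in> {a..b}" for s r
    using assms[OF that] by simp
qed

lemma abs_continuous_ivl_imp_continuous_on:
  assumes "abs_continuous_ivl a b \<phi>"
  shows "continuous_on {a..b} \<phi>"
  unfolding continuous_on_iff
proof (intro ballI allI impI)
  fix x \<epsilon> :: real assume x: "x \<in> {a..b}" and \<epsilon>: "\<epsilon> > 0"
  obtain \<delta> where \<delta>: "\<delta> > 0" and D: "\<forall>(q :: unit set) l u. finite q \<longrightarrow> (\<forall>i\<in>q. a \<le> l i \<and> l i \<le> u i \<and> u i \<le> b) \<longrightarrow>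
     (\<forall>i\<in>q. \<forall>j\<in>q. i \<noteq> j \<longrightarrow> {l i<..<u i} \<inter> {l j<..<u j} = {}) \<longrightarrow> (\<Sum>i\<in>q. u i - l i) < \<delta>
     \<longrightarrow> (\<Sum>i\<in>q. norm (\<phi> (u i) - \<phi> (l i))) < \<epsilon>"
    using abs_continuous_ivl_setD[OF assms \<epsilon>, where 'i = "unit"] by (elim exE conjE)
  show "\<exists>d>0. \<forall>x'\<in>{a..b}. dist x' x < d \<longrightarrow> dist (\<phi> x') (\<phi> x) < \<epsilon>"
  proof (intro exI[of _ \<delta>] conjI ballI impI \<delta>)
    fix y assume y: "y \<in> {a..b}" "dist y x < \<delta>"
    show "dist (\<phi> y) (\<phi> x) < \<epsilon>"
    proof (cases "x \<le> y")
      case True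
      thus ?thesis using D[rule_format, of UNIV "\<lambda>_. x" "\<lambda>_. y"] x y by (auto simp: dist_norm UNIV_unit)
    next
      case False
      thus ?thesis using D[rule_format, of UNIV "\<lambda>_. y" "\<lambda>_. x"] x y by (auto simp: dist_norm UNIV_unit norm_minus_commute)
    qed
  qed
qed

lemma lmeasurable_open_superset:
  fixes S :: "'a::euclidean_space set"
  assumes S: "S \<in> lmeasurable" and e: "e > 0"
  obtains U where "open U" "S \<subseteq> U" "U \<in> lmeasurable" "measure lebesgue (U - S) < e" "measure lebesgue U < measure lebesgue S + e"
proof -
  obtain U where U: "open U" "S \<subseteq> U" "U - S \<in> lmeasurable" "emeasure lebesgue (U - S) < ennreal e"
    using sets_lebesgue_outer_open[of S e] S e by (auto dest: fmeasurableD)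
  have "ennreal (measure lebesgue (U - S)) < ennreal e"
    using U(3,4) by (metis emeasure_eq_measure2)
  hence m: "measure lebesgue (U - S) < e" by (simp add: ennreal_less_iff)
  have eq: "S \<union> (U - S) = U" using U by auto
  have lm: "U \<in> lmeasurable" using fmeasurable.Un[OF S U(3)] unfolding eq .
  have "measure lebesgue U \<le> measure lebesgue S + measure lebesgue (U - S)"
    using measure_Un_le[OF fmeasurableD[OF S] fmeasurableD[OF U(3)]] unfolding eq .
  hence "measure lebesgue U < measure lebesgue S + e" using m by linarith
  from that[OF U(1,2) lm m this] show thesis .
qed

text \<open>Cover the exceptional null set by an open set of small measure and take a fine tagged division:
  the increments over the intervals tagged in the null set are small by absolute continuity.\<close>

lemma abs_continuous_ivl_antimono:
  fixes v :: "real \<Rightarrow> real"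
  assumes ab: "a \<le> b" and ac: "abs_continuous_ivl a b v" and N: "negligible N"
    and der: "\<And>s. s \<in> {a..b} - N \<Longrightarrow> \<exists>D\<le>0. (v has_real_derivative D) (at s within {a..b})"
  shows "v b \<le> v a"
proof (rule field_le_epsilon)
  fix e :: real assume "e > 0"
  \<comment> \<open>Intervals tagged outside \<open>N\<close> contribute at most \<epsilon> (b - a)
    in total, and those tagged in \<open>N\<close> at most \<epsilon>.\<close>
  define \<epsilon> where "\<epsilon> = e / (b - a + 1)"
  have \<epsilon>: "\<epsilon> > 0" using \<open>e > 0\<close> ab by (simp add: \<epsilon>_def)
  obtain \<delta> where \<delta>: "\<delta> > 0" and D: "\<forall>(q :: (real \<times> real set) set) l u. finite q \<longrightarrow> (\<forall>i\<in>q. a \<le> l i \<and> l i \<le> u i \<and> u i \<le> b) \<longrightarrow>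
     (\<forall>i\<in>q. \<forall>j\<in>q. i \<noteq> j \<longrightarrow> {l i<..<u i} \<inter> {l j<..<u j} = {}) \<longrightarrow> (\<Sum>i\<in>q. u i - l i) < \<delta>
     \<longrightarrow> (\<Sum>i\<in>q. norm (v (u i) - v (l i))) < \<epsilon>"
    using abs_continuous_ivl_setD[OF ac \<epsilon>, where 'i = "(real \<times> real set)"] by (elim exE conjE)
  obtain U where U: "open U" "N \<subseteq> U" "U \<in> lmeasurable" "measure lebesgue U < \<delta>"
    using lmeasurable_open_superset[OF negligible_imp_measurable[OF N] \<delta>] negligible_imp_measure0[OF N] by auto
  have "\<exists>r>0. \<forall>y\<in>{a..b}. \<bar>y - s\<bar> < r \<longrightarrow> \<bar>v y - v s - D * (y - s)\<bar> \<le> \<epsilon> * \<bar>y - s\<bar>"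
    if "(v has_real_derivative D) (at s within {a..b})" for s D
    using that \<epsilon> unfolding has_field_derivative_def has_derivative_within_alt by simp
  hence "\<forall>s\<in>{a..b} - N. \<exists>r>0. \<exists>D\<le>0. \<forall>y\<in>{a..b}. \<bar>y - s\<bar> < r \<longrightarrow> \<bar>v y - v s - D * (y - s)\<bar> \<le> \<epsilon> * \<bar>y - s\<bar>"
    using der by blast
  then obtain r where r: "\<And>s. s \<in> {a..b} - N \<Longrightarrow> r s > 0"
    and r': "\<And>s. s \<in> {a..b} - N \<Longrightarrow> \<exists>D\<le>0. \<forall>y\<in>{a..b}. \<bar>y - s\<bar> < r s \<longrightarrow> \<bar>v y - v s - D * (y - s)\<bar> \<le> \<epsilon> * \<bar>y - s\<bar>"
    by metis
  \<comment> \<open>A gauge is total, so points outside [a,b] receive an arbitrary ball. Tags in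
    \<open>N\<close> force their intervals into \<open>U\<close>.\<close>
  define \<gamma> where "\<gamma> s = (if s \<in> N then U else if s \<in> {a..b} then ball s (r s) else ball s 1)" for s
  have "gauge \<gamma>" unfolding gauge_def \<gamma>_def using U r by auto
  from fine_division_exists[OF this, of a b] obtain p where p: "p tagged_division_of {a..b}" "\<gamma> fine p" by auto
  have fin: "finite p" using p(1) by blast
  have P: "\<exists>l u. K = {l..u} \<and> a \<le> l \<and> l \<le> x \<and> x \<le> u \<and> u \<le> b \<and> Inf K = l \<and> Sup K = u \<and> measure lborel K = u - l" if xK: "(x, K) \<in> p" for x K
  proof -
    obtain l u where K: "K = {l..u}" using tagged_division_ofD(4)[OF p(1) xK] by auto
    have "x \<in> K" "K \<subseteq> {a..b}" using tagged_division_ofD(2,3)[OF p(1) xK] by auto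
    thus ?thesis using K by (intro exI[of _ l] exI[of _ u]) auto
  qed
  define q where "q = {i \<in> p. fst i \<in> N}"
  have qp: "q \<subseteq> p" "finite q" using fin by (auto simp: q_def)
  define L where "L i = Inf (snd i)" for i :: "real \<times> real set"
  define S where "S i = Sup (snd i)" for i :: "real \<times> real set"
  have LS: "snd i = {L i..S i}" "a \<le> L i" "L i \<le> fst i" "fst i \<le> S i" "S i \<le> b" "measure lborel (snd i) = S i - L i" "L i \<le> S i" if "i \<in> p" for i
  proof -
    have "(fst i, snd i) \<in> p" using that by simp
    from P[OF this] show "snd i = {L i..S i}" "a \<le> L i" "L i \<le> fst i" "fst i \<le> S i" "S i \<le> b" "measure lborel (snd i) = S i - L i" "L i \<le> S i"
      unfolding L_def S_def by force+
  qed
  have disj: "{L i<..<S i} \<inter> {L j<..<S j} = {}" if "i \<in> p" "j \<in> p" "i \<noteq> j" for i j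
  proof -
    have "interior (snd i) \<inter> interior (snd j) = {}"
      using tagged_division_ofD(5)[OF p(1), of "fst i" "snd i" "fst j" "snd j"] that by simp
    moreover have "interior (snd i) = {L i<..<S i}" "interior (snd j) = {L j<..<S j}"
      using LS(1)[OF that(1)] LS(1)[OF that(2)] by (simp_all only: interior_atLeastAtMost_real)
    ultimately show ?thesis by simp
  qed
  have lenU: "(\<Sum>i\<in>q. S i - L i) < \<delta>"
  proof -
    have "(\<Sum>i\<in>q. S i - L i) = (\<Sum>i\<in>q. measure lebesgue {L i<..<S i})"
      using qp LS(7) by (intro sum.cong refl) (auto dest: subsetD)
    also have "\<dots> = measure lebesgue (\<Union>i\<in>q. {L i<..<S i})"
      by (rule measure_UNION'[symmetric]) (use fin disj in \<open>auto simp: q_def pairwise_def disjnt_def\<close>)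
    also have "\<dots> \<le> measure lebesgue U"
    proof (rule measure_mono_fmeasurable)
      show "(\<Union>i\<in>q. {L i<..<S i}) \<subseteq> U"
      proof
        fix y assume "y \<in> (\<Union>i\<in>q. {L i<..<S i})"
        then obtain i where i: "i \<in> p" "fst i \<in> N" "y \<in> snd i"
          using LS(1) by (auto simp: q_def)
        hence "snd i \<subseteq> \<gamma> (fst i)" using p(2) unfolding fine_def by (cases i) auto
        thus "y \<in> U" using i by (auto simp: \<gamma>_def)
      qed
    qed (use U fin in \<open>auto simp: q_def\<close>)
    finally show ?thesis using U by simp
  qed
  have bad: "(\<Sum>i\<in>q. norm (v (S i) - v (L i))) < \<epsilon>"
  proof (rule D[rule_format])
    show "a \<le> L i \<and> L i \<le> S i \<and> S i \<le> b" if "i \<in> q" for i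
      using LS(2,5,7)[of i] qp that by blast
    show "{L i<..<S i} \<inter> {L j<..<S j} = {}" if "i \<in> q" "j \<in> q" "i \<noteq> j" for i j
      using disj[of i j] qp that by blast
  qed (fact qp lenU)+
  have good: "v (S i) - v (L i) \<le> \<epsilon> * (S i - L i)" if "i \<in> p - q" for i
  proof -
    obtain x K where i: "i = (x, K)" by (cases i)
    have x: "(x, K) \<in> p" "x \<notin> N" using that i by (auto simp: q_def)
    have ip: "i \<in> p" using that by simp
    have l: "K = {L i..S i}" "a \<le> L i" "L i \<le> x" "x \<le> S i" "S i \<le> b" using LS(1-5)[OF ip] unfolding i by simp_all
    have xab: "x \<in> {a..b} - N" using x l by auto
    have "K \<subseteq> \<gamma> x" using p(2) x unfolding fine_def by auto
    hence "K \<subseteq> ball x (r x)" using xab by (simp add: \<gamma>_def)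
    moreover have "S i \<in> K" "L i \<in> K" using l by simp_all
    ultimately have LB: "\<bar>L i - x\<bar> < r x" "\<bar>S i - x\<bar> < r x"
      by (auto simp: dist_real_def abs_minus_commute)
    obtain D where D: "D \<le> 0" "\<And>y. y \<in> {a..b} \<Longrightarrow> \<bar>y - x\<bar> < r x \<Longrightarrow> \<bar>v y - v x - D * (y - x)\<bar> \<le> \<epsilon> * \<bar>y - x\<bar>"
      using r'[OF xab] by blast
    have "\<bar>v (S i) - v x - D * (S i - x)\<bar> \<le> \<epsilon> * (S i - x)" using D(2)[of "S i"] LB l by auto
    moreover have "\<bar>v (L i) - v x - D * (L i - x)\<bar> \<le> \<epsilon> * (x - L i)" using D(2)[of "L i"] LB l by auto
    \<comment> \<open>The tag lies between the endpoints, so a nonpositive slope can only lower the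
      right end and raise the left end.\<close>
    moreover have "D * (S i - x) \<le> 0" "D * (L i - x) \<ge> 0" using D l
      by (auto intro: mult_nonpos_nonneg mult_nonpos_nonpos)
    ultimately have "v (S i) - v (L i) \<le> \<epsilon> * (S i - x) + \<epsilon> * (x - L i)" by linarith
    thus ?thesis by (simp add: algebra_simps)
  qed
  have "v b - v a = (\<Sum>(x,K)\<in>p. v (Sup K) - v (Inf K))"
    using additive_tagged_division_1[OF ab p(1), of v] by simp
  also have "\<dots> = (\<Sum>i\<in>p. v (S i) - v (L i))" by (simp add: S_def L_def case_prod_beta)
  also have "\<dots> = (\<Sum>i\<in>p - q. v (S i) - v (L i)) + (\<Sum>i\<in>q. v (S i) - v (L i))"
    by (rule sum.subset_diff) (use fin in \<open>auto simp: q_def\<close>)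
  also have "\<dots> \<le> (\<Sum>i\<in>p - q. \<epsilon> * (S i - L i)) + (\<Sum>i\<in>q. norm (v (S i) - v (L i)))"
    by (intro add_mono sum_mono good) auto
  also have "(\<Sum>i\<in>p - q. \<epsilon> * (S i - L i)) \<le> (\<Sum>i\<in>p. \<epsilon> * (S i - L i))"
    using \<epsilon> LS(7) fin by (intro sum_mono2) auto
  also have "(\<Sum>i\<in>p. \<epsilon> * (S i - L i)) = \<epsilon> * (\<Sum>(x,K)\<in>p. measure lborel K)"
    unfolding sum_distrib_left by (intro sum.cong refl) (auto simp: LS(6) dest: LS(6))
  also have "(\<Sum>(x,K)\<in>p. measure lborel K) = b - a"
    using additive_content_tagged_division[of p a b] p(1) ab by simp
  also have "(\<Sum>i\<in>q. norm (v (S i) - v (L i))) \<le> \<epsilon>" using bad by simp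
  finally have "v b - v a \<le> \<epsilon> * (b - a + 1)" by (simp add: algebra_simps)
  also have "\<dots> = e" using ab by (simp add: \<epsilon>_def)
  finally show "v b \<le> v a + e" by simp
qed

subsection \<open>Differentiation of indefinite integrals\<close>

lemma integrable_of_bounded_measurable:
  fixes f :: "real \<Rightarrow> 'a::euclidean_space"
  assumes "f \<in> borel_measurable lebesgue" "\<And>x. norm (f x) \<le> M"
  shows "f integrable_on {u..v}"
proof (rule measurable_bounded_by_integrable_imp_integrable)
  show "f \<in> borel_measurable (lebesgue_on {u..v})" using assms(1) by (rule measurable_restrict_space1)
  show "(\<lambda>_. M) integrable_on {u..v}" by (rule integrable_const_ivl)
qed (use assms in auto)

text \<open>On a small neighbourhood \<open>U\<close> of \<open>{f < p}\<close> the function is at most \<open>p\<close> up to a set of small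
  measure; by Vitali, the points with arbitrarily small intervals of mean value above \<open>q\<close> are covered by
  disjoint such intervals inside \<open>U\<close>, whose total length must therefore be small.\<close>

lemma negligible_upper_derivate_gap:
  fixes f :: "real \<Rightarrow> real"
  assumes f: "f \<in> borel_measurable lebesgue" and M: "\<And>x. \<bar>f x\<bar> \<le> M" and pq: "p < q"
  shows "negligible {x \<in> {a<..<b}. f x < p \<and>
    (\<forall>d>0. \<exists>u v. u \<le> x \<and> x \<le> v \<and> u < v \<and> v - u < d \<and> integral {u..v} f > q * (v - u))}" (is "negligible ?E")
  unfolding negligible_outer_le
proof (intro allI impI)
  fix e :: real assume e: "e > 0"
  define S where "S = {x \<in> {a<..<b}. f x < p}"
  \<comment> \<open>Chosen so that f \<le> p + C0 everywhere: \<open>C0\<close> bounds the possible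
    excess of \<open>f\<close> above \<open>p\<close>, and that excess occurs inside
    \<open>U\<close> only on \<open>V\<close>.\<close>
  define C0 where "C0 = M + \<bar>p\<bar> + 1"
  have M0: "M \<ge> 0" using M[of 0] by linarith
  have C0: "C0 > 0" using M0 by (simp add: C0_def)
  have fm: "{x. f x < p} \<in> sets lebesgue"
    using f by (simp add: borel_measurable_iff_less)
  have S: "S \<in> lmeasurable"
  proof -
    have "S = {a<..<b} \<inter> {x. f x < p}" by (auto simp: S_def)
    thus ?thesis using fm by (metis fmeasurable_Int_fmeasurable lmeasurable_interval(2) box_real(1))
  qed
  \<comment> \<open>This size is dictated by the final estimate (q - p) |union| \<le> C0 |V|, whose
    right side must be at most e (q - p).\<close>
  have e': "e * (q - p) / C0 > 0" using e pq C0 by simp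
  obtain U0 where U0: "open U0" "S \<subseteq> U0" "U0 \<in> lmeasurable" "measure lebesgue (U0 - S) < e * (q - p) / C0"
    using lmeasurable_open_superset[OF S e'] by blast
  define U where "U = U0 \<inter> {a<..<b}"
  have U: "open U" "S \<subseteq> U" "U \<in> lmeasurable" using U0 by (auto simp: U_def S_def fmeasurable_Int_fmeasurable)
  define V where "V = U - S"
  have V: "V \<in> lmeasurable" using U S by (auto simp: V_def intro: fmeasurable.Diff)
  have mV: "measure lebesgue V \<le> e * (q - p) / C0"
  proof -
    have "measure lebesgue V \<le> measure lebesgue (U0 - S)"
      by (rule measure_mono_fmeasurable) (use V U0 S in \<open>auto simp: V_def U_def intro!: fmeasurable.Diff\<close>)
    thus ?thesis using U0 by simp
  qed
  define K where "K = {(u, v). u < v \<and> {u..v} \<subseteq> U \<and> integral {u..v} f > q * (v - u)}"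
  \<comment> \<open>Midpoint and half length, because the Vitali covering theorem is stated for
    balls.\<close>
  define ce where "ce = (\<lambda>(u :: real, v :: real). (u + v) / 2)"
  define ra where "ra = (\<lambda>(u :: real, v :: real). (v - u) / 2)"
  have cb: "cball (ce i) (ra i) = {fst i..snd i}" for i
    by (cases i) (auto simp: ce_def ra_def cball_eq_atLeastAtMost field_simps)
  have V1: "\<exists>i. i \<in> K \<and> x \<in> cball (ce i) (ra i) \<and> ra i < d" if x: "x \<in> ?E" "0 < d" for x d
  proof -
    have "x \<in> U" using x U by (auto simp: S_def)
    then obtain r where r: "r > 0" "ball x r \<subseteq> U" using U openE by blast
    have "min d r > 0" using r x by simp
    then obtain u v where uv: "u \<le> x" "x \<le> v" "u < v" "v - u < min d r" "integral {u..v} f > q * (v - u)"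
      using x by blast
    have "{u..v} \<subseteq> ball x r" using uv by (auto simp: dist_real_def)
    hence "(u, v) \<in> K" using r uv by (auto simp: K_def)
    moreover have "x \<in> cball (ce (u, v)) (ra (u, v))" unfolding cb using uv by simp
    moreover have "ra (u, v) < d" using uv by (simp add: ra_def)
    ultimately show ?thesis by blast
  qed
  have V0: "0 < ra i" if "i \<in> K" for i using that by (auto simp: K_def ra_def)
  obtain C where C: "countable C" "C \<subseteq> K"
     "pairwise (\<lambda>i j. disjnt (cball (ce i) (ra i)) (cball (ce j) (ra j))) C"
     "negligible (?E - (\<Union>i \<in> C. cball (ce i) (ra i)))"
    by (rule Vitali_covering_theorem_cballs[of K ra ?E ce, OF V0 V1]) (assumption | rule that)+
  let ?I = "\<lambda>i :: real \<times> real. {fst i..snd i}"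
  have disj: "pairwise (\<lambda>i j. disjnt (?I i) (?I j)) C" using C(3) unfolding cb .
  have bound: "measure lebesgue (\<Union>i\<in>C'. ?I i) \<le> e" if C': "C' \<subseteq> C" "finite C'" for C'
  proof -
    have disj': "pairwise (\<lambda>i j. disjnt (?I i) (?I j)) C'" using disj C' pairwise_subset by blast
    have KC: "fst i < snd i" "?I i \<subseteq> U" "integral (?I i) f > q * (snd i - fst i)" if "i \<in> C'" for i
    proof -
      have "(fst i, snd i) \<in> K" using that C' C(2) by auto
      thus "fst i < snd i" "?I i \<subseteq> U" "integral (?I i) f > q * (snd i - fst i)" unfolding K_def by auto
    qed
    \<comment> \<open>The mean over the interval exceeds \<open>q\<close> although \<open>f\<close>
      is at most \<open>p\<close> off \<open>V\<close>; so \<open>V\<close> fills at least the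
      fraction (q - p) / C0 of the interval.\<close>
    have one: "(q - p) * measure lebesgue (?I i) \<le> C0 * measure lebesgue (?I i \<inter> V)" if i: "i \<in> C'" for i
    proof -
      have lmIV: "?I i \<inter> V \<in> lmeasurable" using V by (intro fmeasurable_Int_fmeasurable) auto
      have i1: "((\<lambda>x. p + C0 * indicator (?I i \<inter> V) x) has_integral (p * (snd i - fst i) + C0 * measure lebesgue (?I i \<inter> V))) (?I i)"
      proof (intro has_integral_add has_integral_mult_right)
        show "((\<lambda>_. p) has_integral p * (snd i - fst i)) (?I i)"
          using has_integral_const_real[of p "fst i" "snd i"] KC(1)[OF i] by (simp add: mult.commute)
        have "((\<lambda>x. 1 :: real) has_integral measure lebesgue (?I i \<inter> V)) (?I i \<inter> V)"
          using lmIV by (simp add: has_integral_iff lmeasurable_iff_integrable_on lmeasure_integral)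
        hence "((\<lambda>x. if x \<in> ?I i \<inter> V then 1 else 0 :: real) has_integral measure lebesgue (?I i \<inter> V)) (?I i)"
          by (subst has_integral_restrict) auto
        thus "(indicator (?I i \<inter> V) has_integral measure lebesgue (?I i \<inter> V)) (?I i)"
          by (simp add: indicator_def[abs_def] of_bool_def)
      qed
      have i2: "(f has_integral integral (?I i) f) (?I i)"
        using integrable_of_bounded_measurable[OF f, of M "fst i" "snd i"] M by (simp add: integrable_integral)
      have "integral (?I i) f \<le> p * (snd i - fst i) + C0 * measure lebesgue (?I i \<inter> V)"
      proof (rule has_integral_le[OF i2 i1])
        fix x assume x: "x \<in> ?I i"
        show "f x \<le> p + C0 * indicator (?I i \<inter> V) x"
        proof (cases "x \<in> V")
          case True
          thus ?thesis using x M[of x] by (auto simp: C0_def)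
        next
          case False
          hence "x \<in> S" using x KC(2)[OF i] by (auto simp: V_def)
          thus ?thesis using False by (simp add: S_def)
        qed
      qed
      hence "q * (snd i - fst i) \<le> p * (snd i - fst i) + C0 * measure lebesgue (?I i \<inter> V)" using KC(3)[OF i] by linarith
      thus ?thesis using KC(1)[OF i] by (simp add: algebra_simps)
    qed
    have "(q - p) * measure lebesgue (\<Union>i\<in>C'. ?I i) = (\<Sum>i\<in>C'. (q - p) * measure lebesgue (?I i))"
      unfolding sum_distrib_left[symmetric]
      by (subst measure_UNION'[OF C'(2) _ disj']) auto
    also have "\<dots> \<le> (\<Sum>i\<in>C'. C0 * measure lebesgue (?I i \<inter> V))" by (intro sum_mono one)
    also have "\<dots> = C0 * measure lebesgue (\<Union>i\<in>C'. ?I i \<inter> V)"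
      unfolding sum_distrib_left[symmetric]
    proof (subst measure_UNION'[OF C'(2)])
      show "?I i \<inter> V \<in> lmeasurable" for i using V by (intro fmeasurable_Int_fmeasurable) auto
      show "pairwise (\<lambda>i j. disjnt (?I i \<inter> V) (?I j \<inter> V)) C'"
        using disj' by (rule pairwise_mono) (auto simp: disjnt_def)
    qed simp
    also have "\<dots> \<le> C0 * measure lebesgue V"
      using C0 V C'(2) by (intro mult_left_mono measure_mono_fmeasurable) (auto intro!: sets.finite_UN fmeasurableD)
    also have "\<dots> \<le> e * (q - p)" using mV C0 by (simp add: field_simps)
    finally have "(q - p) * measure lebesgue (\<Union>i\<in>C'. ?I i) \<le> (q - p) * e" by (simp add: mult.commute)
    thus ?thesis using pq by simp
  qed
  have lmI: "?I i \<in> lmeasurable" for i by simp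
  let ?T = "(\<Union>i\<in>C. ?I i) \<union> (?E - (\<Union>i\<in>C. ?I i))"
  have neg: "negligible (?E - (\<Union>i\<in>C. ?I i))" using C(4) unfolding cb .
  have UC: "(\<Union>i\<in>C. ?I i) \<in> lmeasurable" "measure lebesgue (\<Union>i\<in>C. ?I i) \<le> e"
    using fmeasurable_UN_bound[OF C(1) lmI bound] measure_UN_bound[OF C(1) lmI bound] by blast+
  show "\<exists>T. ?E \<subseteq> T \<and> T \<in> lmeasurable \<and> measure lebesgue T \<le> e"
  proof (intro exI[of _ ?T] conjI)
    show "?E \<subseteq> ?T" by blast
    show "?T \<in> lmeasurable" using UC(1) negligible_imp_measurable[OF neg] by (rule fmeasurable.Un)
    have "measure lebesgue ?T \<le> measure lebesgue (\<Union>i\<in>C. ?I i) + measure lebesgue (?E - (\<Union>i\<in>C. ?I i))"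
      by (rule measure_Un_le[OF fmeasurableD[OF UC(1)] fmeasurableD[OF negligible_imp_measurable[OF neg]]])
    thus "measure lebesgue ?T \<le> e" using UC(2) negligible_imp_measure0[OF neg] by linarith
  qed
qed

text \<open>If the estimate fails at x for some \<epsilon>, then rationals f x < p < q < f x +
  \<epsilon> put x into the null set of the gap (p,q). Only countably many rational gaps exist, so
  the exceptional set is a null set that serves all \<epsilon> at once.\<close>

lemma upper_derivate_integral_le_ae:
  fixes f :: "real \<Rightarrow> real"
  assumes f: "f \<in> borel_measurable lebesgue" and M: "\<And>x. \<bar>f x\<bar> \<le> M"
  shows "\<exists>N. negligible N \<and> (\<forall>x\<in>{a<..<b} - N. \<forall>\<epsilon>>0. \<exists>d>0. \<forall>u v. u \<le> x \<and> x \<le> v \<and> u < v \<and> v - u < d \<longrightarrow>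
     integral {u..v} f \<le> (f x + \<epsilon>) * (v - u))"
proof -
  define E where "E p q = {x \<in> {a<..<b}. f x < p \<and>
    (\<forall>d>0. \<exists>u v. u \<le> x \<and> x \<le> v \<and> u < v \<and> v - u < d \<and> integral {u..v} f > q * (v - u))}" for p q
  define N where "N = (\<Union>(p, q)\<in>{(p, q). p \<in> \<rat> \<and> q \<in> \<rat> \<and> p < q}. E p q)"
  have "countable {(p :: real, q). p \<in> \<rat> \<and> q \<in> \<rat> \<and> p < q}"
    by (rule countable_subset[of _ "\<rat> \<times> \<rat>"]) (auto intro: countable_rat)
  hence "negligible N"
    unfolding N_def using negligible_upper_derivate_gap[OF f M]
    by (intro negligible_countable_Union countable_image) (auto simp: E_def)
  moreover have "\<exists>d>0. \<forall>u v. u \<le> x \<and> x \<le> v \<and> u < v \<and> v - u < d \<longrightarrow> integral {u..v} f \<le> (f x + \<epsilon>) * (v - u)"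
    if x: "x \<in> {a<..<b} - N" and \<epsilon>: "\<epsilon> > 0" for x \<epsilon>
  proof -
    obtain p where p: "p \<in> \<rat>" "f x < p" "p < f x + \<epsilon> / 2" using Rats_dense_in_real[of "f x" "f x + \<epsilon> / 2"] \<epsilon> by auto
    obtain q where q: "q \<in> \<rat>" "f x + \<epsilon> / 2 < q" "q < f x + \<epsilon>" using Rats_dense_in_real[of "f x + \<epsilon> / 2" "f x + \<epsilon>"] \<epsilon> by auto
    have "x \<notin> E p q" using x p q unfolding N_def by fastforce
    then obtain d where d0: "d > 0" and d1: "\<not> (\<exists>u v. u \<le> x \<and> x \<le> v \<and> u < v \<and> v - u < d \<and> integral {u..v} f > q * (v - u))"
      using x p unfolding E_def by blast
    have d: "integral {u..v} f \<le> q * (v - u)" if "u \<le> x" "x \<le> v" "u < v" "v - u < d" for u v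
      using d1 that not_less by blast
    show ?thesis
    proof (intro exI[of _ d] conjI allI impI d0)
      fix u v assume uv: "u \<le> x \<and> x \<le> v \<and> u < v \<and> v - u < d"
      hence "integral {u..v} f \<le> q * (v - u)" using d by blast
      also have "\<dots> \<le> (f x + \<epsilon>) * (v - u)" using q uv by (intro mult_right_mono) auto
      finally show "integral {u..v} f \<le> (f x + \<epsilon>) * (v - u)" .
    qed
  qed
  ultimately show ?thesis by blast
qed

text \<open>The upper estimate for \<open>f\<close> and the upper estimate for \<open>- f\<close>
  enclose the means over short intervals containing x.\<close>

lemma lebesgue_differentiation_real:
  fixes f :: "real \<Rightarrow> real"
  assumes f: "f \<in> borel_measurable lebesgue" and M: "\<And>x. \<bar>f x\<bar> \<le> M"
  shows "\<exists>N. negligible N \<and> (\<forall>x\<in>{a<..<b} - N. ((\<lambda>s. integral {a..s} f) has_real_derivative f x) (at x))"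
proof -
  obtain N1 where N1: "negligible N1" "\<forall>x\<in>{a<..<b} - N1. \<forall>\<epsilon>>0. \<exists>d>0. \<forall>u v. u \<le> x \<and> x \<le> v \<and> u < v \<and> v - u < d \<longrightarrow>
     integral {u..v} f \<le> (f x + \<epsilon>) * (v - u)"
    using upper_derivate_integral_le_ae[OF f M, where a = a and b = b] by (elim exE conjE)
  have "(\<lambda>x. - f x) \<in> borel_measurable lebesgue" "\<And>x. \<bar>- f x\<bar> \<le> M" using f M by auto
  from upper_derivate_integral_le_ae[OF this, where a = a and b = b] obtain N2 where N2: "negligible N2" "\<forall>x\<in>{a<..<b} - N2. \<forall>\<epsilon>>0. \<exists>d>0. \<forall>u v. u \<le> x \<and> x \<le> v \<and> u < v \<and> v - u < d \<longrightarrow>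
     integral {u..v} (\<lambda>x. - f x) \<le> (- f x + \<epsilon>) * (v - u)"
    by (elim exE conjE)
  have nM: "norm (f x) \<le> M" for x using M by simp
  have int: "f integrable_on {u..v}" for u v by (rule integrable_of_bounded_measurable[OF f nM])
  have "((\<lambda>s. integral {a..s} f) has_real_derivative f x) (at x)" if x: "x \<in> {a<..<b} - (N1 \<union> N2)" for x
    unfolding has_field_derivative_def has_derivative_within_alt
  proof (intro conjI allI impI bounded_linear_mult_right)
    fix \<epsilon> :: real assume \<epsilon>: "\<epsilon> > 0"
    have "x \<in> {a<..<b} - N1" "x \<in> {a<..<b} - N2" using x by auto
    from N1(2)[rule_format, OF this(1) \<epsilon>] N2(2)[rule_format, OF this(2) \<epsilon>]
    obtain d1 d2 where d1: "d1 > 0" "\<forall>u v. u \<le> x \<and> x \<le> v \<and> u < v \<and> v - u < d1 \<longrightarrow> integral {u..v} f \<le> (f x + \<epsilon>) * (v - u)"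
      and d2: "d2 > 0" "\<forall>u v. u \<le> x \<and> x \<le> v \<and> u < v \<and> v - u < d2 \<longrightarrow> integral {u..v} (\<lambda>x. - f x) \<le> (- f x + \<epsilon>) * (v - u)"
      by (elim exE conjE)
    define d where "d = min (min d1 d2) (x - a)"
    have close: "\<bar>integral {u..v} f - f x * (v - u)\<bar> \<le> \<epsilon> * (v - u)" if "u \<le> x" "x \<le> v" "u < v" "v - u < d" for u v
      using d1(2)[rule_format, of u v] d2(2)[rule_format, of u v] that by (auto simp: d_def abs_le_iff algebra_simps)
    show "\<exists>d>0. \<forall>y\<in>UNIV. norm (y - x) < d \<longrightarrow> norm (integral {a..y} f - integral {a..x} f - f x * (y - x)) \<le> \<epsilon> * norm (y - x)"
    proof (intro exI[of _ d] conjI ballI impI)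
      show "d > 0" using d1 d2 x by (simp add: d_def)
      fix y assume y: "norm (y - x) < d"
      hence ay: "a \<le> y" using x by (auto simp: d_def)
      consider "y = x" | "y < x" | "x < y" by linarith
      thus "norm (integral {a..y} f - integral {a..x} f - f x * (y - x)) \<le> \<epsilon> * norm (y - x)"
      proof cases
        case 2
        have "integral {a..y} f + integral {y..x} f = integral {a..x} f"
          using ay 2 int by (intro Henstock_Kurzweil_Integration.integral_combine) auto
        hence "integral {a..y} f - integral {a..x} f - f x * (y - x) = - (integral {y..x} f - f x * (x - y))"
          by (simp add: algebra_simps)
        thus ?thesis using close[of y x] 2 y by simp
      next
        case 3
        have "integral {a..x} f + integral {x..y} f = integral {a..y} f"
          using x 3 int by (intro Henstock_Kurzweil_Integration.integral_combine) auto
        hence "integral {a..y} f - integral {a..x} f - f x * (y - x) = integral {x..y} f - f x * (y - x)"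
          by (simp add: algebra_simps)
        thus ?thesis using close[of x y] 3 y by simp
      qed simp
    qed
  qed
  thus ?thesis using negligible_Un[OF N1(1) N2(1)] by blast
qed

lemma lebesgue_differentiation:
  fixes f :: "real \<Rightarrow> 'a::euclidean_space"
  assumes f: "f \<in> borel_measurable lebesgue" and M: "\<And>x. norm (f x) \<le> M"
  shows "\<exists>N. negligible N \<and> (\<forall>x\<in>{a<..<b} - N. ((\<lambda>s. integral {a..s} f) has_vector_derivative f x) (at x))"
proof -
  have "\<forall>i\<in>Basis. \<exists>N. negligible N \<and> (\<forall>x\<in>{a<..<b} - N. ((\<lambda>s. integral {a..s} (\<lambda>x. f x \<bullet> i)) has_real_derivative f x \<bullet> i) (at x))"
  proof
    fix i :: 'a assume i: "i \<in> Basis"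
    show "\<exists>N. negligible N \<and> (\<forall>x\<in>{a<..<b} - N. ((\<lambda>s. integral {a..s} (\<lambda>x. f x \<bullet> i)) has_real_derivative f x \<bullet> i) (at x))"
    proof (rule lebesgue_differentiation_real)
      show "(\<lambda>x. f x \<bullet> i) \<in> borel_measurable lebesgue" using f by measurable
      show "\<bar>f x \<bullet> i\<bar> \<le> M" for x using Basis_le_norm[OF i, of "f x"] M[of x] by linarith
    qed
  qed
  then obtain N where N: "\<And>i. i \<in> Basis \<Longrightarrow> negligible (N i)"
    "\<And>i x. i \<in> Basis \<Longrightarrow> x \<in> {a<..<b} - N i \<Longrightarrow> ((\<lambda>s. integral {a..s} (\<lambda>x. f x \<bullet> i)) has_real_derivative f x \<bullet> i) (at x)"
    by metis
  have "((\<lambda>s. integral {a..s} f) has_vector_derivative f x) (at x)" if x: "x \<in> {a<..<b} - (\<Union>i\<in>Basis. N i)" for x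
    unfolding has_vector_derivative_def
    apply (subst has_derivative_componentwise_within)
  proof
    fix i :: 'a assume i: "i \<in> Basis"
    have "(\<lambda>s. integral {a..s} f \<bullet> i) = (\<lambda>s. integral {a..s} (\<lambda>x. f x \<bullet> i))"
      using integrable_of_bounded_measurable[OF f M] by (intro ext integral_component_eq[symmetric])
    thus "((\<lambda>s. integral {a..s} f \<bullet> i) has_derivative (\<lambda>h. (h *\<^sub>R f x) \<bullet> i)) (at x)"
      using N(2)[OF i, of x] x i by (simp add: has_field_derivative_def mult.commute[of _ "f x \<bullet> i"])
  qed
  thus ?thesis using N(1) by (intro exI[of _ "\<Union>i\<in>Basis. N i"] conjI negligible_Union) auto
qed

subsection \<open>Differential inequalities almost everywhere\<close>

lemma AE_lebesgue_on_iff_negligible: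
  assumes "S \<in> sets lebesgue"
  shows "(AE s in lebesgue_on S. P s) \<longleftrightarrow> (\<exists>N. negligible N \<and> (\<forall>s\<in>S - N. P s))"
proof
  assume "AE s in lebesgue_on S. P s"
  hence "AE s in lebesgue. s \<in> S \<longrightarrow> P s" using assms by (simp add: AE_restrict_space_iff)
  then obtain N where "N \<in> null_sets lebesgue" "{s \<in> space lebesgue. \<not> (s \<in> S \<longrightarrow> P s)} \<subseteq> N"
    unfolding eventually_ae_filter by blast
  thus "\<exists>N. negligible N \<and> (\<forall>s\<in>S - N. P s)"
    by (intro exI[of _ N]) (auto simp: negligible_iff_null_sets)
next
  assume "\<exists>N. negligible N \<and> (\<forall>s\<in>S - N. P s)"
  then obtain N where N: "negligible N" "\<forall>s\<in>S - N. P s" by blast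
  have "AE s in lebesgue. s \<in> S \<longrightarrow> P s"
    by (rule AE_I'[of N]) (use N in \<open>auto simp: negligible_iff_null_sets\<close>)
  thus "AE s in lebesgue_on S. P s" using assms by (simp add: AE_restrict_space_iff)
qed

text \<open>Mean value inequality by testing against the increment itself: for w = \<phi> b - \<phi>
  a the scalar function w . \<phi>(s) - |w| M s is nonincreasing, which gives |w|^2 \<le> |w| M (b -
  a).\<close>

lemma abs_continuous_ivl_norm_bound:
  fixes \<phi> :: "real \<Rightarrow> 'a::euclidean_space"
  assumes ab: "a \<le> b" and ac: "abs_continuous_ivl a b \<phi>" and N: "negligible N"
    and der: "\<And>s. s \<in> {a..b} - N \<Longrightarrow> \<exists>v. norm v \<le> M \<and> (\<phi> has_vector_derivative v) (at s within {a..b})"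
  shows "norm (\<phi> b - \<phi> a) \<le> M * (b - a)"
proof -
  define w where "w = \<phi> b - \<phi> a"
  define g where "g s = w \<bullet> \<phi> s - norm w * M * s" for s
  have "g b \<le> g a"
  proof (rule abs_continuous_ivl_antimono[OF ab _ N])
    show "abs_continuous_ivl a b g"
    proof (rule abs_continuous_ivl_dominated[OF ac])
      fix s r :: real
      have "g s - g r = w \<bullet> (\<phi> s - \<phi> r) - norm w * M * (s - r)" by (simp add: g_def algebra_simps inner_diff_right)
      also have "norm \<dots> \<le> norm w * norm (\<phi> s - \<phi> r) + norm w * \<bar>M\<bar> * \<bar>s - r\<bar>"
        by (intro order_trans[OF norm_triangle_ineq4] add_mono) (auto simp: abs_mult Cauchy_Schwarz_ineq2)
      also have "\<dots> \<le> (norm w * (\<bar>M\<bar> + 1)) * (\<bar>s - r\<bar> + norm (\<phi> s - \<phi> r))"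
        by (simp add: algebra_simps)
      finally show "norm (g s - g r) \<le> (norm w * (\<bar>M\<bar> + 1)) * (\<bar>s - r\<bar> + norm (\<phi> s - \<phi> r))" .
    qed
    fix s assume "s \<in> {a..b} - N"
    from der[OF this] obtain v where v: "norm v \<le> M" "(\<phi> has_vector_derivative v) (at s within {a..b})" by blast
    have "((\<lambda>s. w \<bullet> \<phi> s) has_real_derivative w \<bullet> v) (at s within {a..b})"
      unfolding has_real_derivative_iff_has_vector_derivative
      by (rule bounded_linear.has_vector_derivative[OF bounded_linear_inner_right v(2)])
    hence "(g has_real_derivative (w \<bullet> v - norm w * M)) (at s within {a..b})"
      unfolding g_def by (auto intro!: derivative_eq_intros)
    moreover have "w \<bullet> v \<le> norm w * M"
      using norm_cauchy_schwarz[of w v] v(1) mult_left_mono[OF v(1), of "norm w"] by simp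
    ultimately show "\<exists>D\<le>0. (g has_real_derivative D) (at s within {a..b})" by (intro exI[of _ "w \<bullet> v - norm w * M"]) simp
  qed
  hence "w \<bullet> w \<le> norm w * (M * (b - a))"
    by (simp add: g_def w_def inner_diff_right algebra_simps)
  hence "norm w * norm w \<le> norm w * (M * (b - a))" by (simp add: power2_norm_eq_inner[symmetric] power2_eq_square)
  \<comment> \<open>For w = 0 the estimate cannot be divided by |w|. A nondegenerate interval is not
    negligible, so \<open>der\<close> applies at some point and forces M to be nonnegative.\<close>
  moreover have "0 \<le> M * (b - a)" if "w = 0"
  proof (cases "a = b")
    case False
    hence "\<not> {a..b} \<subseteq> N" using N ab negligible_subset[of N "{a..b}"] by (auto simp: negligible_iff_measure)
    then obtain s where "s \<in> {a..b} - N" by blast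
    from der[OF this] obtain v :: 'a where "norm v \<le> M" by blast
    hence "0 \<le> M" using norm_ge_zero[of v] by linarith
    thus ?thesis using ab by simp
  qed simp
  ultimately show ?thesis unfolding w_def[symmetric]
    by (cases "w = 0") (auto simp: mult_le_cancel_left_pos)
qed

lemma exp_lipschitz_below:
  fixes x y B :: real
  assumes "x \<le> B" "y \<le> B"
  shows "\<bar>exp x - exp y\<bar> \<le> exp B * \<bar>x - y\<bar>"
proof -
  have *: "exp u - exp v \<le> exp B * (u - v)" if "v \<le> u" "u \<le> B" for u v :: real
  proof -
    have "exp u - exp v = exp u * (1 - exp (v - u))" by (simp add: algebra_simps exp_add[symmetric])
    also have "\<dots> \<le> exp u * (u - v)"
    proof (rule mult_left_mono)
      show "1 - exp (v - u) \<le> u - v" using exp_ge_add_one_self[of "v - u"] by linarith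
    qed simp
    also have "\<dots> \<le> exp B * (u - v)" using that by (intro mult_right_mono) auto
    finally show ?thesis .
  qed
  show ?thesis using *[of x y] *[of y x] assms by (cases "x \<le> y") auto
qed

text \<open>Gronwall's inequality: \<open>exp (- 2 c s) \<parallel>\<delta> s\<parallel>\<^sup>2\<close> is nonincreasing.\<close>

lemma gronwall_ae:
  fixes \<delta> :: "real \<Rightarrow> 'a::euclidean_space"
  assumes ab: "a \<le> b" and N: "negligible N"
    and lip: "\<And>s r. s \<in> {a..b} \<Longrightarrow> r \<in> {a..b} \<Longrightarrow> norm (\<delta> s - \<delta> r) \<le> K * \<bar>s - r\<bar>"
    and der: "\<And>s. s \<in> {a..b} - N \<Longrightarrow> \<exists>v. norm v \<le> c * norm (\<delta> s) \<and> (\<delta> has_vector_derivative v) (at s within {a..b})"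
  shows "norm (\<delta> b) \<le> exp (c * (b - a)) * norm (\<delta> a)"
proof -
  \<comment> \<open>The squared norm is differentiable also at zeros of \<delta>, unlike the
    norm.\<close>
  define g where "g s = exp (- 2 * c * s) * (\<delta> s \<bullet> \<delta> s)" for s
  have lip': "norm (\<delta> s - \<delta> r) \<le> \<bar>K\<bar> * \<bar>s - r\<bar>" if "s \<in> {a..b}" "r \<in> {a..b}" for s r
  proof -
    have "K * \<bar>s - r\<bar> \<le> \<bar>K\<bar> * \<bar>s - r\<bar>" by (intro mult_right_mono) auto
    thus ?thesis using lip[OF that] by linarith
  qed
  define B where "B = norm (\<delta> a) + \<bar>K\<bar> * (b - a)"
  have B: "norm (\<delta> s) \<le> B" if "s \<in> {a..b}" for s
  proof -
    have "norm (\<delta> s) \<le> norm (\<delta> a) + norm (\<delta> s - \<delta> a)" by (rule norm_triangle_sub)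
    also have "norm (\<delta> s - \<delta> a) \<le> \<bar>K\<bar> * \<bar>s - a\<bar>" using that ab by (intro lip') auto
    also have "\<dots> \<le> \<bar>K\<bar> * (b - a)" using that by (intro mult_left_mono) auto
    finally show ?thesis by (simp add: B_def)
  qed
  have B0: "B \<ge> 0" using ab by (simp add: B_def)
  define E where "E = exp (2 * \<bar>c\<bar> * (\<bar>a\<bar> + \<bar>b\<bar>))"
  have arg: "- 2 * c * s \<le> 2 * \<bar>c\<bar> * (\<bar>a\<bar> + \<bar>b\<bar>)" if "s \<in> {a..b}" for s
  proof -
    have "- 2 * c * s \<le> \<bar>2 * c\<bar> * \<bar>s\<bar>" using abs_ge_minus_self[of "2 * c * s"] by (simp add: abs_mult)
    also have "\<dots> \<le> \<bar>2 * c\<bar> * (\<bar>a\<bar> + \<bar>b\<bar>)" using that by (intro mult_left_mono) auto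
    finally show ?thesis by (simp add: abs_mult)
  qed
  have "g b \<le> g a"
  proof (rule abs_continuous_ivl_antimono[OF ab _ N])
    show "abs_continuous_ivl a b g"
    proof (rule lipschitz_imp_abs_continuous_ivl)
      fix s r :: real assume s: "s \<in> {a..b}" and r: "r \<in> {a..b}"
      have 1: "\<bar>\<delta> s \<bullet> \<delta> s - \<delta> r \<bullet> \<delta> r\<bar> \<le> 2 * B * \<bar>K\<bar> * \<bar>s - r\<bar>"
      proof -
        have "\<delta> s \<bullet> \<delta> s - \<delta> r \<bullet> \<delta> r = (\<delta> s - \<delta> r) \<bullet> (\<delta> s + \<delta> r)" by (simp add: algebra_simps inner_commute)
        also have "\<bar>\<dots>\<bar> \<le> norm (\<delta> s - \<delta> r) * norm (\<delta> s + \<delta> r)" by (rule Cauchy_Schwarz_ineq2)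
        also have "\<dots> \<le> (\<bar>K\<bar> * \<bar>s - r\<bar>) * (B + B)"
          using lip'[OF s r] B[OF s] B[OF r]
          by (intro mult_mono order_trans[OF norm_triangle_ineq add_mono]) auto
        finally show ?thesis by (simp add: algebra_simps)
      qed
      have 2: "\<bar>exp (- 2 * c * s) - exp (- 2 * c * r)\<bar> \<le> E * (2 * \<bar>c\<bar>) * \<bar>s - r\<bar>"
      proof -
        have "\<bar>exp (- 2 * c * s) - exp (- 2 * c * r)\<bar> \<le> E * \<bar>- 2 * c * s - (- 2 * c * r)\<bar>"
          unfolding E_def by (rule exp_lipschitz_below[OF arg[OF s] arg[OF r]])
        also have "- 2 * c * s - (- 2 * c * r) = (- 2 * c) * (s - r)" by (simp add: algebra_simps)
        finally show ?thesis by (simp add: abs_mult)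
      qed
      have 3: "exp (- 2 * c * s) \<le> E" unfolding E_def using arg[OF s] by simp
      have 4: "\<bar>\<delta> r \<bullet> \<delta> r\<bar> \<le> B\<^sup>2" using power_mono[OF B[OF r], of 2] by (simp add: power2_norm_eq_inner)
      have "g s - g r = exp (- 2 * c * s) * (\<delta> s \<bullet> \<delta> s - \<delta> r \<bullet> \<delta> r) + (exp (- 2 * c * s) - exp (- 2 * c * r)) * (\<delta> r \<bullet> \<delta> r)"
        by (simp add: g_def algebra_simps)
      also have "norm \<dots> \<le> E * (2 * B * \<bar>K\<bar> * \<bar>s - r\<bar>) + (E * (2 * \<bar>c\<bar>) * \<bar>s - r\<bar>) * B\<^sup>2"
        unfolding real_norm_def using 1 2 3 4 B0
        by (intro order_trans[OF abs_triangle_ineq] add_mono) (auto simp: abs_mult E_def intro!: mult_mono)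
      also have "\<dots> = (E * (2 * B * \<bar>K\<bar> + 2 * \<bar>c\<bar> * B\<^sup>2)) * \<bar>s - r\<bar>" by (simp add: algebra_simps)
      finally show "norm (g s - g r) \<le> (E * (2 * B * \<bar>K\<bar> + 2 * \<bar>c\<bar> * B\<^sup>2)) * \<bar>s - r\<bar>" .
    qed
    fix s assume "s \<in> {a..b} - N"
    from der[OF this] obtain v where v: "norm v \<le> c * norm (\<delta> s)" "(\<delta> has_vector_derivative v) (at s within {a..b})" by blast
    have "((\<lambda>s. \<delta> s \<bullet> \<delta> s) has_vector_derivative (\<delta> s \<bullet> v + v \<bullet> \<delta> s)) (at s within {a..b})"
      by (rule bounded_bilinear.has_vector_derivative[OF bounded_bilinear_inner v(2) v(2)])
    hence "((\<lambda>s. \<delta> s \<bullet> \<delta> s) has_real_derivative (2 * (\<delta> s \<bullet> v))) (at s within {a..b})"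
      unfolding has_real_derivative_iff_has_vector_derivative by (simp add: inner_commute)
    hence "(g has_real_derivative (exp (- 2 * c * s) * (2 * (\<delta> s \<bullet> v)) + (- 2 * c) * exp (- 2 * c * s) * (\<delta> s \<bullet> \<delta> s))) (at s within {a..b})"
      unfolding g_def by (auto intro!: derivative_eq_intros)
    moreover have "\<delta> s \<bullet> v \<le> c * (\<delta> s \<bullet> \<delta> s)"
    proof -
      have "\<delta> s \<bullet> v \<le> norm (\<delta> s) * norm v" by (rule norm_cauchy_schwarz)
      also have "\<dots> \<le> norm (\<delta> s) * (c * norm (\<delta> s))" using v(1) by (intro mult_left_mono) auto
      also have "\<dots> = c * (\<delta> s \<bullet> \<delta> s)" by (simp add: power2_norm_eq_inner[symmetric] power2_eq_square)
      finally show ?thesis .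
    qed
    hence "exp (- 2 * c * s) * (2 * (\<delta> s \<bullet> v)) \<le> exp (- 2 * c * s) * (2 * (c * (\<delta> s \<bullet> \<delta> s)))"
      by (intro mult_left_mono) auto
    hence "exp (- 2 * c * s) * (2 * (\<delta> s \<bullet> v)) + (- 2 * c) * exp (- 2 * c * s) * (\<delta> s \<bullet> \<delta> s) \<le> 0"
      by (simp add: algebra_simps)
    ultimately show "\<exists>D\<le>0. (g has_real_derivative D) (at s within {a..b})" by blast
  qed
  hence "exp (2 * c * b) * g b \<le> exp (2 * c * b) * g a" by (intro mult_left_mono) auto
  hence "(norm (\<delta> b))\<^sup>2 \<le> exp (2 * c * b - 2 * c * a) * (norm (\<delta> a))\<^sup>2"
    by (simp add: g_def mult.assoc[symmetric] exp_add[symmetric] power2_norm_eq_inner)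
  also have "\<dots> = (exp (c * (b - a)) * norm (\<delta> a))\<^sup>2"
    by (simp add: power_mult_distrib exp_double[symmetric] algebra_simps)
  finally show ?thesis by (rule power2_le_imp_le) simp
qed

subsection \<open>Trajectories of a Lipschitz control system\<close>

locale control_system =
  fixes F :: "real ^ 'n::finite \<Rightarrow> real ^ 'm::finite \<Rightarrow> real ^ 'n" and D :: "(real ^ 'm) set" and L :: real
  assumes compact_D: "compact D" and D_ne: "D \<noteq> {}"
    and cont_F: "continuous_on (UNIV \<times> D) (\<lambda>(x, d). F x d)"
    and lip_F: "\<And>d. d \<in> D \<Longrightarrow> L-lipschitz_on UNIV (\<lambda>x. F x d)"
begin

lemma L_nonneg: "L \<ge> 0"
  using D_ne lip_F lipschitz_on_nonneg by blast

lemma F_lipschitz: "d \<in> D \<Longrightarrow> norm (F x d - F y d) \<le> L * norm (x - y)"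
  using lipschitz_onD[OF lip_F, of d x y] by (simp add: dist_norm)

lemma F_growth: "\<exists>C\<ge>0. \<forall>d\<in>D. \<forall>x. norm (F x d) \<le> C + L * norm x"
proof -
  have "continuous_on D ((\<lambda>(x, d). F x d) \<circ> (\<lambda>d. (0, d)))"
    by (rule continuous_on_compose) (auto intro!: continuous_intros continuous_on_subset[OF cont_F])
  hence "bounded ((\<lambda>d. F 0 d) ` D)"
    using compact_continuous_image compact_D compact_imp_bounded by (fastforce simp: o_def)
  then obtain C where C: "\<And>d. d \<in> D \<Longrightarrow> norm (F 0 d) \<le> C" by (auto simp: bounded_iff)
  have "C \<ge> 0" using D_ne C norm_ge_zero order_trans by blast
  moreover have "norm (F x d) \<le> C + L * norm x" if "d \<in> D" for x d
    using norm_triangle_sub[of "F x d" "F 0 d"] F_lipschitz[OF that, of x 0] C[OF that] by simp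
  ultimately show ?thesis by blast
qed

text \<open>\<open>F\<close> is continuous only over the values in \<open>D\<close>, so the pair
  (\<phi>, e) is regarded as a map into the restricted Borel space.\<close>

lemma F_measurable:
  assumes "\<phi> \<in> borel_measurable lebesgue" "e \<in> borel_measurable lebesgue" "\<And>s. e s \<in> D"
  shows "(\<lambda>s. F (\<phi> s) (e s)) \<in> borel_measurable lebesgue"
proof -
  have "(\<lambda>(x, d). F x d) \<in> borel_measurable (restrict_space borel (UNIV \<times> D))"
    by (rule borel_measurable_continuous_on_restrict[OF cont_F])
  moreover have "(\<lambda>s. (\<phi> s, e s)) \<in> lebesgue \<rightarrow>\<^sub>M restrict_space borel (UNIV \<times> D)"
    by (rule measurable_restrict_space2) (use assms in \<open>auto intro: borel_measurable_Pair\<close>)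
  ultimately have "(\<lambda>s. (\<lambda>(x, d). F x d) (\<phi> s, e s)) \<in> borel_measurable lebesgue"
    by (rule measurable_compose[rotated])
  thus ?thesis by simp
qed

text \<open>A control is measurable on its own interval only. Extending it by a fixed value of
  \<open>D\<close> makes it a function on the whole line, where measurability and integrals over
  subintervals need no relativisation.\<close>

lemma extend_control:
  assumes "d \<in> admissible D t T"
  obtains e where "e \<in> borel_measurable lebesgue" "\<And>s. e s \<in> D" "\<And>s. s \<in> {t..T} \<Longrightarrow> e s = d s"
proof -
  obtain d0 where d0: "d0 \<in> D" using D_ne by blast
  have d: "d \<in> borel_measurable (lebesgue_on {t..T})" "\<And>s. s \<in> {t..T} \<Longrightarrow> d s \<in> D"
    using assms by (auto simp: admissible_def)
  \<comment> \<open>The value 0 need not lie in \<open>D\<close>; this first extension only secures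
    measurability.\<close>
  define d1 where "d1 s = (if s \<in> {t..T} then d s else 0)" for s
  have d1: "d1 \<in> borel_measurable lebesgue"
    unfolding d1_def using d(1) by (intro borel_measurable_if_I) auto
  have "(\<lambda>s. if s \<in> {t..T} then d1 s else d0) \<in> borel_measurable lebesgue"
    by (rule measurable_If[OF d1]) auto
  thus thesis by (rule that) (use d d0 in \<open>auto simp: d1_def\<close>)
qed

text \<open>Picard iteration in an exponentially weighted (Bielecki) norm: the fixed point \<psi> is
  exp(-k (s - t)) times the solution. The weight makes the map a contraction with factor L / k on
  the whole interval at once, so no pieces have to be glued. Measurability and the bound of the
  right-hand side are recorded for the later differentiation of the integral.\<close>

lemma integral_equation_solvable:
  fixes t T :: real and e :: "real \<Rightarrow> real ^ 'm" and x :: "real ^ 'n"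
  assumes tT: "t \<le> T" and e: "e \<in> borel_measurable lebesgue" "\<And>s. e s \<in> D"
  obtains \<phi> M where "(\<lambda>s. F (\<phi> s) (e s)) \<in> borel_measurable lebesgue" "\<And>s. norm (F (\<phi> s) (e s)) \<le> M"
    "\<And>s. s \<in> {t..T} \<Longrightarrow> \<phi> s = x + integral {t..s} (\<lambda>\<tau>. F (\<phi> \<tau>) (e \<tau>))"
proof -
  \<comment> \<open>Clamping time lets the complete space of bounded continuous functions on the
    line stand in for the functions on [t,T].\<close>
  define cl where "cl s = max t (min T s)" for s :: real
  have cl_id: "cl s = s" if "s \<in> {t..T}" for s using that by (auto simp: cl_def)
  have cl_cont: "continuous_on UNIV cl" unfolding cl_def by (intro continuous_intros)
  have cl_mem: "cl s \<in> {t..T}" for s using tT by (auto simp: cl_def)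
  \<comment> \<open>Any weight above L gives L / k < 1; this one is positive also for L = 0.\<close>
  define k where "k = L + 1"
  have k: "k > 0" using L_nonneg by (simp add: k_def)
  define P where "P \<psi> s = exp (k * (cl s - t)) *\<^sub>R apply_bcontfun \<psi> (cl s)" for \<psi> :: "real \<Rightarrow>\<^sub>C (real ^ 'n)" and s
  define H where "H \<psi> s = F (P \<psi> s) (e s)" for \<psi> s
  obtain C where C: "C \<ge> 0" "\<And>d x. d \<in> D \<Longrightarrow> norm (F x d) \<le> C + L * norm x" using F_growth by blast
  define M where "M \<psi> = C + L * (exp (k * (T - t)) * norm \<psi>)" for \<psi> :: "real \<Rightarrow>\<^sub>C (real ^ 'n)"
  have P_meas: "P \<psi> \<in> borel_measurable lebesgue" for \<psi>
  proof -
    have "continuous_on UNIV (P \<psi>)" unfolding P_def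
      by (intro continuous_intros cl_cont continuous_on_compose2[OF continuous_on_apply_bcontfun cl_cont]) auto
    hence "P \<psi> \<in> borel_measurable borel" by (rule borel_measurable_continuous_onI)
    thus ?thesis by (simp add: measurable_completion measurable_lborel1)
  qed
  have H_meas: "H \<psi> \<in> borel_measurable lebesgue" for \<psi>
    unfolding H_def using F_measurable[OF P_meas e] .
  have H_bound: "norm (H \<psi> s) \<le> M \<psi>" for \<psi> s
  proof -
    have "norm (P \<psi> s) \<le> exp (k * (T - t)) * norm \<psi>"
      unfolding P_def norm_scaleR using cl_mem[of s] k
      by (intro mult_mono) (auto intro!: norm_bounded mult_left_mono)
    hence "L * norm (P \<psi> s) \<le> L * (exp (k * (T - t)) * norm \<psi>)" using L_nonneg by (rule mult_left_mono)
    thus ?thesis unfolding H_def M_def using C(2)[OF e(2)[of s], of "P \<psi> s"] by linarith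
  qed
  have H_int: "H \<psi> integrable_on {u..v}" for \<psi> u v
    by (rule integrable_of_bounded_measurable[OF H_meas H_bound])
  define \<Phi> where "\<Phi> \<psi> s = exp (- (k * (cl s - t))) *\<^sub>R (x + integral {t..cl s} (H \<psi>))" for \<psi> s
  have \<Phi>: "\<Phi> \<psi> \<in> bcontfun" for \<psi>
  proof -
    have "continuous_on {t..T} (\<lambda>s. integral {t..s} (H \<psi>))" by (rule indefinite_integral_continuous_1[OF H_int])
    moreover have "range cl \<subseteq> {t..T}" using cl_mem by blast
    ultimately have c: "continuous_on UNIV (\<lambda>s. integral {t..cl s} (H \<psi>))"
      by (rule continuous_on_compose2[OF _ cl_cont])
    show ?thesis
    proof (rule bcontfun_normI)
      show "continuous_on UNIV (\<Phi> \<psi>)" unfolding \<Phi>_def by (intro continuous_intros cl_cont c)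
      fix s
      have "norm (integral {t..cl s} (H \<psi>)) \<le> integral {t..cl s} (\<lambda>_. M \<psi>)"
        by (intro integral_norm_bound_integral H_int integrable_const_ivl H_bound)
      also have "\<dots> = M \<psi> * (cl s - t)" using cl_mem[of s] by simp
      also have "\<dots> \<le> M \<psi> * (T - t)"
        using cl_mem[of s] order_trans[OF norm_ge_zero H_bound] by (intro mult_left_mono) auto
      finally have "norm (x + integral {t..cl s} (H \<psi>)) \<le> norm x + M \<psi> * (T - t)"
        by (intro order_trans[OF norm_triangle_ineq]) simp
      moreover have "exp (- (k * (cl s - t))) \<le> 1" using k cl_mem[of s] by simp
      ultimately have "exp (- (k * (cl s - t))) * norm (x + integral {t..cl s} (H \<psi>)) \<le> 1 * (norm x + M \<psi> * (T - t))"
        by (intro mult_mono) auto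
      thus "norm (\<Phi> \<psi> s) \<le> norm x + M \<psi> * (T - t)" by (simp add: \<Phi>_def)
    qed
  qed
  define \<Psi> where "\<Psi> \<psi> = Bcontfun (\<Phi> \<psi>)" for \<psi>
  have app: "apply_bcontfun (\<Psi> \<psi>) = \<Phi> \<psi>" for \<psi> unfolding \<Psi>_def by (rule Bcontfun_inverse[OF \<Phi>])
  have "dist (\<Psi> \<psi>) (\<Psi> \<psi>') \<le> (L / k) * dist \<psi> \<psi>'" for \<psi> \<psi>'
  proof (rule dist_bound)
    fix s
    define c where "c = cl s"
    have c: "t \<le> c" "c \<le> T" using cl_mem[of s] by (auto simp: c_def)
    let ?\<delta> = "dist \<psi> \<psi>'"
    have "((\<lambda>\<tau>. exp (k * (\<tau> - t))) has_integral (exp (k * (c - t)) / k - exp (k * (t - t)) / k)) {t..c}"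
      using k by (intro fundamental_theorem_of_calculus c)
        (auto intro!: derivative_eq_intros simp flip: has_real_derivative_iff_has_vector_derivative)
    from has_integral_mult_right[OF this, of "L * ?\<delta>"]
    have int: "((\<lambda>\<tau>. L * ?\<delta> * exp (k * (\<tau> - t))) has_integral (L * ?\<delta> * ((exp (k * (c - t)) - 1) / k))) {t..c}"
      by (simp add: diff_divide_distrib)
    have "norm (integral {t..c} (\<lambda>\<tau>. H \<psi> \<tau> - H \<psi>' \<tau>)) \<le> L * ?\<delta> * ((exp (k * (c - t)) - 1) / k)"
    proof (rule integral_norm_bound_integral[THEN order_trans])
      show "(\<lambda>\<tau>. H \<psi> \<tau> - H \<psi>' \<tau>) integrable_on {t..c}" by (intro integrable_diff H_int)
      show "(\<lambda>\<tau>. L * ?\<delta> * exp (k * (\<tau> - t))) integrable_on {t..c}" using int by blast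
      show "integral {t..c} (\<lambda>\<tau>. L * ?\<delta> * exp (k * (\<tau> - t))) \<le> L * ?\<delta> * ((exp (k * (c - t)) - 1) / k)"
        using integral_unique[OF int] by simp
      fix \<tau> assume \<tau>: "\<tau> \<in> {t..c}"
      hence cl\<tau>: "cl \<tau> = \<tau>" using c by (intro cl_id) auto
      have "norm (H \<psi> \<tau> - H \<psi>' \<tau>) \<le> L * norm (P \<psi> \<tau> - P \<psi>' \<tau>)" unfolding H_def by (rule F_lipschitz[OF e(2)])
      also have "P \<psi> \<tau> - P \<psi>' \<tau> = exp (k * (\<tau> - t)) *\<^sub>R (apply_bcontfun \<psi> \<tau> - apply_bcontfun \<psi>' \<tau>)"
        unfolding P_def cl\<tau> by (simp add: algebra_simps)
      also have "L * norm \<dots> \<le> L * (exp (k * (\<tau> - t)) * ?\<delta>)"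
        using L_nonneg dist_bounded[of \<psi> \<tau> \<psi>'] by (intro mult_left_mono) (auto simp: dist_norm)
      finally show "norm (H \<psi> \<tau> - H \<psi>' \<tau>) \<le> L * ?\<delta> * exp (k * (\<tau> - t))" by (simp add: mult_ac)
    qed
    also have "\<dots> \<le> L * ?\<delta> * (exp (k * (c - t)) / k)"
      using L_nonneg k by (intro mult_left_mono divide_right_mono) auto
    finally have 1: "norm (integral {t..c} (\<lambda>\<tau>. H \<psi> \<tau> - H \<psi>' \<tau>)) \<le> L * ?\<delta> * (exp (k * (c - t)) / k)" .
    have "\<Phi> \<psi> s - \<Phi> \<psi>' s = exp (- (k * (c - t))) *\<^sub>R integral {t..c} (\<lambda>\<tau>. H \<psi> \<tau> - H \<psi>' \<tau>)"
      unfolding \<Phi>_def c_def[symmetric] by (simp add: Henstock_Kurzweil_Integration.integral_diff[OF H_int H_int] algebra_simps)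
    hence "dist (\<Phi> \<psi> s) (\<Phi> \<psi>' s) = exp (- (k * (c - t))) * norm (integral {t..c} (\<lambda>\<tau>. H \<psi> \<tau> - H \<psi>' \<tau>))"
      by (simp add: dist_norm)
    also have "\<dots> \<le> exp (- (k * (c - t))) * (L * ?\<delta> * (exp (k * (c - t)) / k))"
      using 1 by (intro mult_left_mono) auto
    also have "\<dots> = (exp (- (k * (c - t))) * exp (k * (c - t))) * ((L / k) * ?\<delta>)" by simp
    also have "exp (- (k * (c - t))) * exp (k * (c - t)) = 1" unfolding exp_add[symmetric] by simp
    also have "1 * ((L / k) * ?\<delta>) = (L / k) * ?\<delta>" by simp
    finally show "dist (apply_bcontfun (\<Psi> \<psi>) s) (apply_bcontfun (\<Psi> \<psi>') s) \<le> (L / k) * ?\<delta>" unfolding app .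
  qed
  moreover have "0 \<le> L / k" "L / k < 1" using L_nonneg by (auto simp: k_def)
  ultimately have "\<exists>!\<psi>. \<Psi> \<psi> = \<psi>" by (intro banach_fix_type[of "L / k"]) auto
  then obtain \<psi> where \<psi>: "\<Psi> \<psi> = \<psi>" by blast
  show thesis
  proof (rule that[of "P \<psi>" "M \<psi>"])
    show "(\<lambda>s. F (P \<psi> s) (e s)) \<in> borel_measurable lebesgue" using H_meas[of \<psi>] unfolding H_def .
    show "norm (F (P \<psi> s) (e s)) \<le> M \<psi>" for s using H_bound[of \<psi> s] unfolding H_def .
    fix s assume s: "s \<in> {t..T}"
    have "P \<psi> s = exp (k * (s - t)) *\<^sub>R \<Phi> \<psi> s" unfolding P_def cl_id[OF s] using app[of \<psi>] \<psi> by simp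
    also have "\<dots> = x + integral {t..s} (H \<psi>)" unfolding \<Phi>_def cl_id[OF s] by (simp add: exp_add[symmetric])
    finally show "P \<psi> s = x + integral {t..s} (\<lambda>\<tau>. F (P \<psi> \<tau>) (e \<tau>))" unfolding H_def .
  qed
qed

text \<open>The null set \<open>Z\<close> permits changing the control at a single switching time,
  as concatenation of controls requires.\<close>

lemma is_solution_cong:
  assumes "\<And>s. s \<in> {t..T} \<Longrightarrow> \<phi> s = \<psi> s" "negligible Z" "\<And>s. s \<in> {t..T} - Z \<Longrightarrow> d s = e s" "t \<le> T" "is_solution F d t T x \<phi>"
  shows "is_solution F e t T x \<psi>"
proof -
  have sol: "abs_continuous_ivl t T \<phi>" "\<phi> t = x" and
    ae: "AE s in lebesgue_on {t..T}. (\<phi> has_vector_derivative F (\<phi> s) (d s)) (at s within {t..T})"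
    using assms(5) by (auto simp: is_solution_def)
  from ae obtain N where N: "negligible N" "\<forall>s\<in>{t..T} - N. (\<phi> has_vector_derivative F (\<phi> s) (d s)) (at s within {t..T})"
    by (subst (asm) AE_lebesgue_on_iff_negligible) auto
  have "(\<psi> has_vector_derivative F (\<psi> s) (e s)) (at s within {t..T})" if s: "s \<in> {t..T} - (N \<union> Z)" for s
  proof (rule has_vector_derivative_transform)
    have eq: "\<phi> s = \<psi> s" "d s = e s" using assms(1)[of s] assms(3)[of s] s by auto
    have "(\<phi> has_vector_derivative F (\<phi> s) (d s)) (at s within {t..T})" using N(2) s by blast
    thus "(\<phi> has_vector_derivative F (\<psi> s) (e s)) (at s within {t..T})" unfolding eq .
  qed (use s assms(1) in auto)
  hence "AE s in lebesgue_on {t..T}. (\<psi> has_vector_derivative F (\<psi> s) (e s)) (at s within {t..T})"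
    using negligible_Un[OF N(1) assms(2)] by (subst AE_lebesgue_on_iff_negligible) (simp, blast)
  moreover have "abs_continuous_ivl t T \<psi>"
    by (rule abs_continuous_ivl_dominated[OF sol(1), of _ 1]) (use assms(1) in auto)
  ultimately show ?thesis using sol(2) assms(1)[of t] assms(4) by (auto simp: is_solution_def)
qed

lemma is_solution_exists:
  assumes tT: "t \<le> T" and d: "d \<in> admissible D t T"
  shows "\<exists>\<phi>. is_solution F d t T x \<phi>"
proof -
  obtain e where e: "e \<in> borel_measurable lebesgue" "\<And>s. e s \<in> D" "\<And>s. s \<in> {t..T} \<Longrightarrow> e s = d s"
    using extend_control[OF d] by blast
  obtain \<phi> M where \<phi>: "(\<lambda>s. F (\<phi> s) (e s)) \<in> borel_measurable lebesgue" "\<And>s. norm (F (\<phi> s) (e s)) \<le> M"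
    "\<And>s. s \<in> {t..T} \<Longrightarrow> \<phi> s = x + integral {t..s} (\<lambda>\<tau>. F (\<phi> \<tau>) (e \<tau>))"
    using integral_equation_solvable[OF tT e(1,2)] by blast
  let ?f = "\<lambda>\<tau>. F (\<phi> \<tau>) (e \<tau>)"
  have M0: "M \<ge> 0" using \<phi>(2)[of 0] norm_ge_zero order_trans by blast
  have int: "?f integrable_on {u..v}" for u v by (rule integrable_of_bounded_measurable[OF \<phi>(1,2)])
  have *: "norm (\<phi> s - \<phi> r) \<le> M * \<bar>s - r\<bar>" if "r \<in> {t..T}" "s \<in> {t..T}" "r \<le> s" for s r
  proof -
    have "integral {t..r} ?f + integral {r..s} ?f = integral {t..s} ?f"
      using that int by (intro Henstock_Kurzweil_Integration.integral_combine) auto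
    hence "\<phi> s - \<phi> r = integral {r..s} ?f" using \<phi>(3) that by (simp add: algebra_simps)
    also have "norm \<dots> \<le> integral {r..s} (\<lambda>_. M)" by (intro integral_norm_bound_integral int \<phi>(2) integrable_const_ivl)
    also have "\<dots> = M * \<bar>s - r\<bar>" using that by simp
    finally show ?thesis .
  qed
  have ac: "abs_continuous_ivl t T \<phi>"
  proof (rule lipschitz_imp_abs_continuous_ivl)
    show "norm (\<phi> s - \<phi> r) \<le> M * \<bar>s - r\<bar>" if "s \<in> {t..T}" "r \<in> {t..T}" for s r
      using *[of r s] *[of s r] that by (cases "r \<le> s") (auto simp: norm_minus_commute abs_minus_commute)
  qed
  obtain N where N: "negligible N" "\<forall>s\<in>{t<..<T} - N. ((\<lambda>s. integral {t..s} ?f) has_vector_derivative ?f s) (at s)"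
    using lebesgue_differentiation[OF \<phi>(1,2), where a = t and b = T] by (elim exE conjE)
  \<comment> \<open>Differentiation of the integral is available in the open interval, so the two
    endpoints join the null set.\<close>
  have "(\<phi> has_vector_derivative F (\<phi> s) (e s)) (at s within {t..T})" if s: "s \<in> {t..T} - (N \<union> {t, T})" for s
  proof (rule has_vector_derivative_transform)
    have "s \<in> {t<..<T} - N" using s by auto
    from has_vector_derivative_at_within[OF N(2)[rule_format, OF this]]
    show "((\<lambda>s. x + integral {t..s} ?f) has_vector_derivative F (\<phi> s) (e s)) (at s within {t..T})"
      by (auto intro!: derivative_eq_intros)
  qed (use s \<phi>(3) in auto)
  moreover have "negligible (N \<union> {t, T})" using N(1) negligible_finite[of "{t, T}"] by (intro negligible_Un) auto
  ultimately have "AE s in lebesgue_on {t..T}. (\<phi> has_vector_derivative F (\<phi> s) (e s)) (at s within {t..T})"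
    by (subst AE_lebesgue_on_iff_negligible) (simp, blast)
  hence "is_solution F e t T x \<phi>" using ac \<phi>(3)[of t] tT by (auto simp: is_solution_def)
  from is_solution_cong[OF _ negligible_empty _ tT this] e(3) show ?thesis by blast
qed

lemma is_solution_restrict:
  assumes "is_solution F d t T x \<phi>" "t \<le> s" "s \<le> T'" "T' \<le> T"
  shows "is_solution F d s T' (\<phi> s) \<phi>"
proof -
  have ac: "abs_continuous_ivl t T \<phi>" and
    ae: "AE s in lebesgue_on {t..T}. (\<phi> has_vector_derivative F (\<phi> s) (d s)) (at s within {t..T})"
    using assms(1) by (auto simp: is_solution_def)
  from ae obtain N where N: "negligible N" "\<forall>s\<in>{t..T} - N. (\<phi> has_vector_derivative F (\<phi> s) (d s)) (at s within {t..T})"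
    by (subst (asm) AE_lebesgue_on_iff_negligible) auto
  have "(\<phi> has_vector_derivative F (\<phi> r) (d r)) (at r within {s..T'})" if r: "r \<in> {s..T'} - N" for r
    using N(2) r assms(2-) by (intro has_vector_derivative_within_subset[where S = "{t..T}" and T = "{s..T'}"]) auto
  hence "AE r in lebesgue_on {s..T'}. (\<phi> has_vector_derivative F (\<phi> r) (d r)) (at r within {s..T'})"
    using N(1) by (subst AE_lebesgue_on_iff_negligible) auto
  thus ?thesis using abs_continuous_ivl_subset[OF ac assms(2,4)] by (auto simp: is_solution_def)
qed

lemma is_solution_ae:
  assumes "is_solution F d t T x \<phi>"
  obtains N where "negligible N" "\<And>s. s \<in> {t..T} - N \<Longrightarrow> (\<phi> has_vector_derivative F (\<phi> s) (d s)) (at s within {t..T})"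
proof -
  have "AE s in lebesgue_on {t..T}. (\<phi> has_vector_derivative F (\<phi> s) (d s)) (at s within {t..T})"
    using assms by (auto simp: is_solution_def)
  thus thesis using that by (subst (asm) AE_lebesgue_on_iff_negligible) auto
qed

lemma is_solution_speed_bound:
  assumes sol: "is_solution F d t T x \<phi>" and M: "\<And>s. s \<in> {t..T} \<Longrightarrow> norm (F (\<phi> s) (d s)) \<le> M"
    and sr: "s \<in> {t..T}" "r \<in> {t..T}"
  shows "norm (\<phi> s - \<phi> r) \<le> M * \<bar>s - r\<bar>"
proof -
  have *: "norm (\<phi> v - \<phi> u) \<le> M * (v - u)" if "t \<le> u" "u \<le> v" "v \<le> T" for u v
  proof -
    have sol': "is_solution F d u v (\<phi> u) \<phi>" by (rule is_solution_restrict[OF sol]) (use that in auto)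
    obtain N where N: "negligible N" "\<And>s. s \<in> {u..v} - N \<Longrightarrow> (\<phi> has_vector_derivative F (\<phi> s) (d s)) (at s within {u..v})"
      using is_solution_ae[OF sol'] by blast
    show ?thesis
    proof (rule abs_continuous_ivl_norm_bound[OF that(2) _ N(1)])
      show "abs_continuous_ivl u v \<phi>" using sol' by (simp add: is_solution_def)
      show "\<exists>w. norm w \<le> M \<and> (\<phi> has_vector_derivative w) (at s within {u..v})" if "s \<in> {u..v} - N" for s
        using N(2)[OF that] M[of s] that \<open>t \<le> u\<close> \<open>v \<le> T\<close> by (intro exI[of _ "F (\<phi> s) (d s)"]) auto
    qed
  qed
  show ?thesis using *[of r s] *[of s r] sr by (cases "r \<le> s") (auto simp: norm_minus_commute)
qed

text \<open>Solutions are given as absolutely continuous only, while \<open>gronwall_ae\<close> asks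
  for a Lipschitz curve. A solution is bounded on its compact interval, hence so is its speed; the
  constant depends on the solution.\<close>

lemma is_solution_lipschitz:
  assumes sol: "is_solution F d t T x \<phi>" and d: "\<And>s. s \<in> {t..T} \<Longrightarrow> d s \<in> D"
  obtains K where "\<And>s r. s \<in> {t..T} \<Longrightarrow> r \<in> {t..T} \<Longrightarrow> norm (\<phi> s - \<phi> r) \<le> K * \<bar>s - r\<bar>"
proof -
  have "continuous_on {t..T} \<phi>" using sol by (auto simp: is_solution_def intro: abs_continuous_ivl_imp_continuous_on)
  hence "bounded (\<phi> ` {t..T})" by (intro compact_imp_bounded compact_continuous_image) auto
  then obtain B where "\<forall>y\<in>\<phi> ` {t..T}. norm y \<le> B" unfolding bounded_iff by blast
  hence B: "norm (\<phi> s) \<le> B" if "s \<in> {t..T}" for s using that by blast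
  obtain C where C: "C \<ge> 0" "\<And>d x. d \<in> D \<Longrightarrow> norm (F x d) \<le> C + L * norm x" using F_growth by blast
  have "norm (F (\<phi> s) (d s)) \<le> C + L * B" if "s \<in> {t..T}" for s
    using C(2)[OF d[OF that], of "\<phi> s"] mult_left_mono[OF B[OF that] L_nonneg] by linarith
  thus thesis by (intro that is_solution_speed_bound[OF sol])
qed

text \<open>Gronwall for the difference of two solutions under the same control. The case x = y is
  uniqueness.\<close>

lemma is_solution_dependence:
  assumes sol: "is_solution F d t T x \<phi>" "is_solution F d t T y \<psi>" and d: "\<And>s. s \<in> {t..T} \<Longrightarrow> d s \<in> D"
    and s: "s \<in> {t..T}"
  shows "norm (\<phi> s - \<psi> s) \<le> exp (L * (s - t)) * norm (x - y)"
proof -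
  have r1: "is_solution F d t s (\<phi> t) \<phi>" by (rule is_solution_restrict[OF sol(1)]) (use s in auto)
  have r2: "is_solution F d t s (\<psi> t) \<psi>" by (rule is_solution_restrict[OF sol(2)]) (use s in auto)
  have ds: "\<And>r. r \<in> {t..s} \<Longrightarrow> d r \<in> D" using d s by auto
  obtain K1 where K1: "\<And>r q. r \<in> {t..s} \<Longrightarrow> q \<in> {t..s} \<Longrightarrow> norm (\<phi> r - \<phi> q) \<le> K1 * \<bar>r - q\<bar>"
    using is_solution_lipschitz[OF r1 ds] by blast
  obtain K2 where K2: "\<And>r q. r \<in> {t..s} \<Longrightarrow> q \<in> {t..s} \<Longrightarrow> norm (\<psi> r - \<psi> q) \<le> K2 * \<bar>r - q\<bar>"
    using is_solution_lipschitz[OF r2 ds] by blast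
  obtain N1 where N1: "negligible N1" "\<And>r. r \<in> {t..s} - N1 \<Longrightarrow> (\<phi> has_vector_derivative F (\<phi> r) (d r)) (at r within {t..s})"
    using is_solution_ae[OF r1] by blast
  obtain N2 where N2: "negligible N2" "\<And>r. r \<in> {t..s} - N2 \<Longrightarrow> (\<psi> has_vector_derivative F (\<psi> r) (d r)) (at r within {t..s})"
    using is_solution_ae[OF r2] by blast
  have "norm (\<phi> s - \<psi> s) \<le> exp (L * (s - t)) * norm (\<phi> t - \<psi> t)"
  proof (rule gronwall_ae[OF _ negligible_Un[OF N1(1) N2(1)]])
    show "t \<le> s" using s by simp
    show "norm ((\<phi> r - \<psi> r) - (\<phi> q - \<psi> q)) \<le> (K1 + K2) * \<bar>r - q\<bar>" if "r \<in> {t..s}" "q \<in> {t..s}" for r q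
    proof -
      have "(\<phi> r - \<psi> r) - (\<phi> q - \<psi> q) = (\<phi> r - \<phi> q) - (\<psi> r - \<psi> q)" by simp
      also have "norm \<dots> \<le> K1 * \<bar>r - q\<bar> + K2 * \<bar>r - q\<bar>"
        by (intro order_trans[OF norm_triangle_ineq4] add_mono K1 K2 that)
      finally show ?thesis by (simp add: algebra_simps)
    qed
    fix r assume r: "r \<in> {t..s} - (N1 \<union> N2)"
    have "((\<lambda>r. \<phi> r - \<psi> r) has_vector_derivative (F (\<phi> r) (d r) - F (\<psi> r) (d r))) (at r within {t..s})"
      using N1(2)[of r] N2(2)[of r] r by (intro has_vector_derivative_diff) auto
    moreover have "norm (F (\<phi> r) (d r) - F (\<psi> r) (d r)) \<le> L * norm (\<phi> r - \<psi> r)"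
      using ds[of r] r by (intro F_lipschitz) auto
    ultimately show "\<exists>v. norm v \<le> L * norm (\<phi> r - \<psi> r) \<and> ((\<lambda>r. \<phi> r - \<psi> r) has_vector_derivative v) (at r within {t..s})"
      by blast
  qed
  thus ?thesis using sol by (simp add: is_solution_def)
qed

text \<open>Gronwall's inequality for the curve \<open>(\<phi>, 1)\<close>, whose speed is at most \<open>C + L \<parallel>\<phi>\<parallel> \<le> (C + L) \<parallel>(\<phi>, 1)\<parallel>\<close>.\<close>

lemma is_solution_bound:
  assumes "r \<ge> 0" "h \<ge> 0"
  obtains B where "\<And>d t T x \<phi> s. is_solution F d t T x \<phi> \<Longrightarrow> (\<And>s. s \<in> {t..T} \<Longrightarrow> d s \<in> D) \<Longrightarrow> T - t \<le> h \<Longrightarrow> norm x \<le> r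
    \<Longrightarrow> s \<in> {t..T} \<Longrightarrow> norm (\<phi> s) \<le> B"
proof -
  obtain C where C: "C \<ge> 0" "\<And>d x. d \<in> D \<Longrightarrow> norm (F x d) \<le> C + L * norm x" using F_growth by blast
  show thesis
  proof (rule that)
    fix d t T x \<phi> s
    assume sol: "is_solution F d t T x \<phi>" and d: "\<And>s. s \<in> {t..T} \<Longrightarrow> d s \<in> D" and h: "T - t \<le> h" and x: "norm x \<le> r"
      and s: "s \<in> {t..T}"
    have r1: "is_solution F d t s (\<phi> t) \<phi>" by (rule is_solution_restrict[OF sol]) (use s in auto)
    have ds: "\<And>r. r \<in> {t..s} \<Longrightarrow> d r \<in> D" using d s by auto
    obtain K where K: "\<And>r q. r \<in> {t..s} \<Longrightarrow> q \<in> {t..s} \<Longrightarrow> norm (\<phi> r - \<phi> q) \<le> K * \<bar>r - q\<bar>"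
      using is_solution_lipschitz[OF r1 ds] by blast
    obtain N where N: "negligible N" "\<And>r. r \<in> {t..s} - N \<Longrightarrow> (\<phi> has_vector_derivative F (\<phi> r) (d r)) (at r within {t..s})"
      using is_solution_ae[OF r1] by blast
    have "norm (\<phi> s, 1 :: real) \<le> exp ((C + L) * (s - t)) * norm (\<phi> t, 1 :: real)"
    proof (rule gronwall_ae[OF _ N(1)])
      show "t \<le> s" using s by simp
      show "norm ((\<phi> r, 1 :: real) - (\<phi> q, 1)) \<le> K * \<bar>r - q\<bar>" if "r \<in> {t..s}" "q \<in> {t..s}" for r q
        using K[OF that] by (simp add: norm_Pair)
      fix r assume r: "r \<in> {t..s} - N"
      have "((\<lambda>r. (\<phi> r, 1 :: real)) has_vector_derivative (F (\<phi> r) (d r), 0)) (at r within {t..s})"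
        using N(2)[OF r] by (intro has_vector_derivative_Pair) auto
      moreover have "norm (F (\<phi> r) (d r), 0 :: real) \<le> (C + L) * norm (\<phi> r, 1 :: real)"
      proof -
        have "norm (F (\<phi> r) (d r), 0 :: real) \<le> C * 1 + L * norm (\<phi> r)"
          using C(2)[of "d r" "\<phi> r"] ds[of r] r by (simp add: norm_Pair)
        also have "\<dots> \<le> C * norm (\<phi> r, 1 :: real) + L * norm (\<phi> r, 1 :: real)"
          using C(1) L_nonneg norm_snd_le[where x = "\<phi> r" and y = "1 :: real"] norm_fst_le[where x = "\<phi> r" and y = "1 :: real"]
          by (intro add_mono mult_left_mono) auto
        finally show ?thesis by (simp add: algebra_simps)
      qed
      ultimately show "\<exists>v. norm v \<le> (C + L) * norm (\<phi> r, 1 :: real) \<and> ((\<lambda>r. (\<phi> r, 1 :: real)) has_vector_derivative v) (at r within {t..s})"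
        by blast
    qed
    also have "\<dots> \<le> exp ((C + L) * h) * (r + 1)"
    proof (intro mult_mono)
      show "exp ((C + L) * (s - t)) \<le> exp ((C + L) * h)"
        using s h C(1) L_nonneg by (auto intro!: mult_left_mono)
      have "norm (\<phi> t, 1 :: real) \<le> norm (\<phi> t) + norm (1 :: real)" by (rule norm_Pair_le)
      thus "norm (\<phi> t, 1 :: real) \<le> r + 1" using x sol by (simp add: is_solution_def)
    qed (use assms in auto)
    finally have "norm (\<phi> s, 1 :: real) \<le> exp ((C + L) * h) * (r + 1)" .
    thus "norm (\<phi> s) \<le> exp ((C + L) * h) * (r + 1)" using norm_fst_le[where x = "\<phi> s" and y = "1 :: real"] by linarith
  qed
qed

text \<open>Resolves the definite description: the restriction of any solution to [t,T] is the
  unique extensional one.\<close>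

lemma trajectory_unique:
  assumes tT: "t \<le> T" and d: "d \<in> admissible D t T" and sol: "is_solution F d t T x \<phi>" and s: "s \<in> {t..T}"
  shows "trajectory F d t T x s = \<phi> s"
proof -
  have dD: "\<And>s. s \<in> {t..T} \<Longrightarrow> d s \<in> D" using d by (simp add: admissible_def)
  let ?\<phi> = "restrict \<phi> {t..T}"
  have "trajectory F d t T x = ?\<phi>"
    unfolding trajectory_def
  proof (rule the_equality)
    have "is_solution F d t T x ?\<phi>" by (rule is_solution_cong[OF _ negligible_empty _ tT sol]) auto
    thus "?\<phi> \<in> extensional {t..T} \<and> is_solution F d t T x ?\<phi>" by simp
    fix \<psi> assume \<psi>: "\<psi> \<in> extensional {t..T} \<and> is_solution F d t T x \<psi>"
    show "\<psi> = ?\<phi>"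
    proof (rule extensionalityI)
      fix r assume r: "r \<in> {t..T}"
      show "\<psi> r = ?\<phi> r" using is_solution_dependence[OF conjunct2[OF \<psi>] sol dD r] r by simp
    qed (use \<psi> in auto)
  qed
  thus ?thesis using s by simp
qed

lemma trajectory_is_solution:
  assumes tT: "t \<le> T" and d: "d \<in> admissible D t T"
  shows "is_solution F d t T x (trajectory F d t T x)"
proof -
  obtain \<phi> where \<phi>: "is_solution F d t T x \<phi>" using is_solution_exists[OF assms] by blast
  show ?thesis by (rule is_solution_cong[OF _ negligible_empty _ tT \<phi>]) (auto simp: trajectory_unique[OF tT d \<phi>])
qed

end

subsection \<open>The value function\<close>

lemma meval_vec_lipschitz:
  fixes p :: "'v::finite mpoly"
  shows "\<exists>K\<ge>0. \<forall>x y :: real ^ 'v. norm x \<le> r \<longrightarrow> norm y \<le> r \<longrightarrow> \<bar>meval p (($) x) - meval p (($) y)\<bar> \<le> K * norm (x - y)"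
proof -
  obtain K where K: "K \<ge> 0" "\<forall>a b. (\<forall>v. \<bar>a v\<bar> \<le> r) \<longrightarrow> (\<forall>v. \<bar>b v\<bar> \<le> r) \<longrightarrow>
           \<bar>meval p a - meval p b\<bar> \<le> K * (\<Sum>v\<in>UNIV. \<bar>a v - b v\<bar>)"
    using meval_lipschitz_on_box[of r p] by (elim exE conjE)
  have "\<bar>meval p (($) x) - meval p (($) y)\<bar> \<le> (K * CARD('v)) * norm (x - y)"
    if "norm x \<le> r" "norm y \<le> r" for x y :: "real ^ 'v"
  proof -
    have "\<bar>x $ v\<bar> \<le> r" "\<bar>y $ v\<bar> \<le> r" for v
      using component_le_norm_cart[of x v] component_le_norm_cart[of y v] that by linarith+
    hence "\<bar>meval p (($) x) - meval p (($) y)\<bar> \<le> K * (\<Sum>v\<in>UNIV. \<bar>x $ v - y $ v\<bar>)"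
      using K(2) by simp
    also have "(\<Sum>v\<in>UNIV. \<bar>x $ v - y $ v\<bar>) \<le> (\<Sum>v\<in>(UNIV :: 'v set). norm (x - y))"
    proof (rule sum_mono)
      show "\<bar>x $ v - y $ v\<bar> \<le> norm (x - y)" for v
        using component_le_norm_cart[of "x - y" v] by simp
    qed
    finally show ?thesis using K(1) by (simp add: mult_left_mono mult.assoc)
  qed
  thus ?thesis using K(1) by (intro exI[of _ "K * CARD('v)"]) auto
qed

lemma eval_xt_lipschitz:
  fixes p :: "('n::finite + unit) mpoly"
  shows "\<exists>K\<ge>0. \<forall>x y :: real ^ 'n. \<forall>t s. norm x \<le> r \<longrightarrow> norm y \<le> r \<longrightarrow> \<bar>t\<bar> \<le> r \<longrightarrow> \<bar>s\<bar> \<le> r \<longrightarrow>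
    \<bar>eval_xt p x t - eval_xt p y s\<bar> \<le> K * (norm (x - y) + \<bar>t - s\<bar>)"
proof -
  obtain K where K: "K \<ge> 0" "\<forall>a b. (\<forall>v. \<bar>a v\<bar> \<le> r) \<longrightarrow> (\<forall>v. \<bar>b v\<bar> \<le> r) \<longrightarrow>
           \<bar>meval p a - meval p b\<bar> \<le> K * (\<Sum>v\<in>UNIV. \<bar>a v - b v\<bar>)"
    using meval_lipschitz_on_box[of r p] by (elim exE conjE)
  let ?a = "\<lambda>(x :: real ^ 'n) t. case_sum (\<lambda>i. x $ i) (\<lambda>_ :: unit. t)"
  have "\<bar>eval_xt p x t - eval_xt p y s\<bar> \<le> (K * CARD('n + unit)) * (norm (x - y) + \<bar>t - s\<bar>)"
    if h: "norm x \<le> r" "norm y \<le> r" "\<bar>t\<bar> \<le> r" "\<bar>s\<bar> \<le> r" for x y :: "real ^ 'n" and t s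
  proof -
    have "\<bar>?a x t v\<bar> \<le> r" "\<bar>?a y s v\<bar> \<le> r" for v
      using component_le_norm_cart[of x] component_le_norm_cart[of y] h
      by (cases v; auto intro: order_trans)+
    hence "\<bar>eval_xt p x t - eval_xt p y s\<bar> \<le> K * (\<Sum>v\<in>UNIV. \<bar>?a x t v - ?a y s v\<bar>)"
      unfolding eval_xt_def using K(2) by simp
    also have "(\<Sum>v\<in>UNIV. \<bar>?a x t v - ?a y s v\<bar>) \<le> (\<Sum>v\<in>(UNIV :: ('n + unit) set). norm (x - y) + \<bar>t - s\<bar>)"
    proof (rule sum_mono)
      show "\<bar>?a x t v - ?a y s v\<bar> \<le> norm (x - y) + \<bar>t - s\<bar>" for v
        using component_le_norm_cart[of "x - y"] by (cases v) (auto intro: add_increasing2)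
    qed
    finally show ?thesis using K(1) by (simp add: mult_left_mono mult.assoc)
  qed
  thus ?thesis using K(1) by (intro exI[of _ "K * CARD('n + unit)"]) auto
qed

lemma finite_family_lipschitz_const:
  fixes Q :: "nat \<Rightarrow> real \<Rightarrow> bool"
  assumes "\<And>i. \<exists>K\<ge>0. Q i K" "\<And>i K K'. Q i K \<Longrightarrow> K \<le> K' \<Longrightarrow> Q i K'"
  shows "\<exists>K\<ge>0. \<forall>i\<in>{1..n}. Q i K"
proof -
  obtain k where k: "\<And>i. k i \<ge> 0" "\<And>i. Q i (k i)" using assms(1) by metis
  have "k i \<le> (\<Sum>i\<in>{1..n}. k i)" if "i \<in> {1..n}" for i
    using that k by (intro member_le_sum) auto
  thus ?thesis using k assms(2) by (intro exI[of _ "\<Sum>i\<in>{1..n}. k i"]) (blast intro: sum_nonneg)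
qed

locale reach_problem = control_system F D L
  for F :: "real ^ 'n::finite \<Rightarrow> real ^ 'm::finite \<Rightarrow> real ^ 'n" and D :: "(real ^ 'm) set" and L :: real +
  fixes g :: "nat \<Rightarrow> ('n + unit) mpoly" and nX :: nat and l :: "nat \<Rightarrow> 'n mpoly" and nTR :: nat and T :: real
  assumes nX: "nX \<ge> 1" and nTR: "nTR \<ge> 1" and T_pos: "T > 0"
begin

abbreviation u :: "real ^ 'n \<Rightarrow> real \<Rightarrow> real" where
  "u \<equiv> value_function F D nX g nTR l T"

lemma admissible_const: "d \<in> D \<Longrightarrow> (\<lambda>_. d) \<in> admissible D t T"
  by (simp add: admissible_def)

text \<open>Continuity bounds the inner suprema, so an upper bound on the cost unfolds into
  pointwise inequalities.\<close>

lemma cost_le_iff: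
  assumes "t \<le> T" "continuous_on {t..T} \<phi>"
  shows "cost nX g nTR l t T \<phi> \<le> c \<longleftrightarrow> (\<forall>j\<in>{1..nTR}. meval (l j) (($) (\<phi> T)) \<le> c) \<and> (\<forall>i\<in>{1..nX}. \<forall>s\<in>{t..T}. eval_xt (g i) (\<phi> s) s \<le> c)"
proof -
  have c: "continuous_on {t..T} (\<lambda>s. eval_xt (g i) (\<phi> s) s)" for i
    unfolding eval_xt_def
  proof (rule continuous_on_meval)
    show "continuous_on {t..T} (\<lambda>s. case_sum (\<lambda>i. \<phi> s $ i) (\<lambda>_. s) v)" for v
      by (cases v) (auto intro!: continuous_intros assms)
  qed
  have b: "bdd_above ((\<lambda>s. eval_xt (g i) (\<phi> s) s) ` {t..T})" for i
    by (intro bounded_imp_bdd_above compact_imp_bounded compact_continuous_image c) simp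
  have "(SUP s\<in>{t..T}. eval_xt (g i) (\<phi> s) s) \<le> c \<longleftrightarrow> (\<forall>s\<in>{t..T}. eval_xt (g i) (\<phi> s) s \<le> c)" for i
    using assms by (intro cSUP_le_iff b) auto
  thus ?thesis unfolding cost_def using nX nTR by (auto simp: Max_le_iff)
qed

lemma trajectory_bound:
  assumes "r \<ge> 0"
  obtains B where "\<And>d t x \<phi> s. is_solution F d t T x \<phi> \<Longrightarrow> (\<And>s. s \<in> {t..T} \<Longrightarrow> d s \<in> D) \<Longrightarrow> 0 \<le> t \<Longrightarrow> norm x \<le> r
    \<Longrightarrow> s \<in> {t..T} \<Longrightarrow> norm (\<phi> s) \<le> B"
proof -
  obtain B where B: "\<And>d t T' x \<phi> s. is_solution F d t T' x \<phi> \<Longrightarrow> (\<And>s. s \<in> {t..T'} \<Longrightarrow> d s \<in> D) \<Longrightarrow> T' - t \<le> T \<Longrightarrow> norm x \<le> r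
    \<Longrightarrow> s \<in> {t..T'} \<Longrightarrow> norm (\<phi> s) \<le> B"
    using is_solution_bound[OF assms, of T] T_pos by (metis less_imp_le)
  show thesis
  proof (rule that)
    fix d t x \<phi> s
    assume *: "is_solution F d t T x \<phi>" "\<And>s. s \<in> {t..T} \<Longrightarrow> d s \<in> D" "0 \<le> t" "norm x \<le> r" "s \<in> {t..T}"
    show "norm (\<phi> s) \<le> B" by (rule B[OF *(1,2) _ *(4,5)]) (use *(3) in auto)
  qed
qed

lemma constraint_lipschitz:
  obtains K where "K \<ge> 0"
    "\<And>i x y t s. i \<in> {1..nX} \<Longrightarrow> norm x \<le> r \<Longrightarrow> norm y \<le> r \<Longrightarrow> t \<in> {0..T} \<Longrightarrow> s \<in> {0..T} \<Longrightarrow>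
      \<bar>eval_xt (g i) x t - eval_xt (g i) y s\<bar> \<le> K * (norm (x - y) + \<bar>t - s\<bar>)"
    "\<And>j x y. j \<in> {1..nTR} \<Longrightarrow> norm x \<le> r \<Longrightarrow> norm y \<le> r \<Longrightarrow> \<bar>meval (l j) (($) x) - meval (l j) (($) y)\<bar> \<le> K * norm (x - y)"
proof -
  define r' where "r' = max r T"
  have "\<exists>K\<ge>0. \<forall>i\<in>{1..nX}. \<forall>x y :: real ^ 'n. \<forall>t s. norm x \<le> r' \<longrightarrow> norm y \<le> r' \<longrightarrow> \<bar>t\<bar> \<le> r' \<longrightarrow> \<bar>s\<bar> \<le> r' \<longrightarrow>
    \<bar>eval_xt (g i) x t - eval_xt (g i) y s\<bar> \<le> K * (norm (x - y) + \<bar>t - s\<bar>)"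
    by (rule finite_family_lipschitz_const[OF eval_xt_lipschitz])
       (meson order_trans mult_right_mono add_nonneg_nonneg norm_ge_zero abs_ge_zero)
  then obtain K1 where K1: "K1 \<ge> 0" "\<forall>i\<in>{1..nX}. \<forall>x y :: real ^ 'n. \<forall>t s. norm x \<le> r' \<longrightarrow> norm y \<le> r' \<longrightarrow> \<bar>t\<bar> \<le> r' \<longrightarrow> \<bar>s\<bar> \<le> r' \<longrightarrow>
    \<bar>eval_xt (g i) x t - eval_xt (g i) y s\<bar> \<le> K1 * (norm (x - y) + \<bar>t - s\<bar>)" by (elim exE conjE)
  have "\<exists>K\<ge>0. \<forall>j\<in>{1..nTR}. \<forall>x y :: real ^ 'n. norm x \<le> r \<longrightarrow> norm y \<le> r \<longrightarrow> \<bar>meval (l j) (($) x) - meval (l j) (($) y)\<bar> \<le> K * norm (x - y)"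
    by (rule finite_family_lipschitz_const[OF meval_vec_lipschitz]) (meson order_trans mult_right_mono norm_ge_zero)
  then obtain K2 where K2: "K2 \<ge> 0" "\<forall>j\<in>{1..nTR}. \<forall>x y :: real ^ 'n. norm x \<le> r \<longrightarrow> norm y \<le> r \<longrightarrow> \<bar>meval (l j) (($) x) - meval (l j) (($) y)\<bar> \<le> K2 * norm (x - y)"
    by (elim exE conjE)
  show thesis
  proof (rule that[of "K1 + K2"])
    show "K1 + K2 \<ge> 0" using K1 K2 by simp
    fix i and x y :: "real ^ 'n" and t s
    assume "i \<in> {1..nX}" "norm x \<le> r" "norm y \<le> r" "t \<in> {0..T}" "s \<in> {0..T}"
    hence "\<bar>eval_xt (g i) x t - eval_xt (g i) y s\<bar> \<le> K1 * (norm (x - y) + \<bar>t - s\<bar>)"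
      using K1(2) by (auto simp: r'_def)
    also have "\<dots> \<le> (K1 + K2) * (norm (x - y) + \<bar>t - s\<bar>)" using K2 by (intro mult_right_mono) auto
    finally show "\<bar>eval_xt (g i) x t - eval_xt (g i) y s\<bar> \<le> (K1 + K2) * (norm (x - y) + \<bar>t - s\<bar>)" .
  next
    fix j and x y :: "real ^ 'n"
    assume "j \<in> {1..nTR}" "norm x \<le> r" "norm y \<le> r"
    hence "\<bar>meval (l j) (($) x) - meval (l j) (($) y)\<bar> \<le> K2 * norm (x - y)" using K2(2) by auto
    also have "\<dots> \<le> (K1 + K2) * norm (x - y)" using K1 by (intro mult_right_mono) auto
    finally show "\<bar>meval (l j) (($) x) - meval (l j) (($) y)\<bar> \<le> (K1 + K2) * norm (x - y)" .
  qed
qed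

text \<open>The way \<open>u\<close> is used from here on: upper bounds are statements about every
  solution, with neither \<open>trajectory\<close> nor suprema. The substance is that the costs are
  bounded over all controls, without which the supremum would be meaningless.\<close>

lemma value_le_iff:
  assumes t: "t \<in> {0..T}"
  shows "u x t \<le> c \<longleftrightarrow> (\<forall>d\<in>admissible D t T. \<forall>\<phi>. is_solution F d t T x \<phi> \<longrightarrow>
    (\<forall>j\<in>{1..nTR}. meval (l j) (($) (\<phi> T)) \<le> c) \<and> (\<forall>i\<in>{1..nX}. \<forall>s\<in>{t..T}. eval_xt (g i) (\<phi> s) s \<le> c))" (is "_ \<longleftrightarrow> ?rhs")
proof -
  have tT: "t \<le> T" using t by simp
  let ?tr = "\<lambda>d. trajectory F d t T x"
  have cont: "continuous_on {t..T} (?tr d)" if "d \<in> admissible D t T" for d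
    using trajectory_is_solution[OF tT that] by (auto simp: is_solution_def intro: abs_continuous_ivl_imp_continuous_on)
  have ne: "admissible D t T \<noteq> {}" using D_ne admissible_const by blast
  have bdd: "bdd_above ((\<lambda>d. cost nX g nTR l t T (?tr d)) ` admissible D t T)"
  proof -
    obtain B where B: "\<And>d t x' \<phi> s. is_solution F d t T x' \<phi> \<Longrightarrow> (\<And>s. s \<in> {t..T} \<Longrightarrow> d s \<in> D) \<Longrightarrow> 0 \<le> t \<Longrightarrow> norm x' \<le> norm x
      \<Longrightarrow> s \<in> {t..T} \<Longrightarrow> norm (\<phi> s) \<le> B"
      using trajectory_bound[of "norm x"] by (metis norm_ge_zero)
    obtain K where K: "K \<ge> 0"
      "\<And>i x y t s. i \<in> {1..nX} \<Longrightarrow> norm x \<le> B \<Longrightarrow> norm y \<le> B \<Longrightarrow> t \<in> {0..T} \<Longrightarrow> s \<in> {0..T} \<Longrightarrow>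
        \<bar>eval_xt (g i) x t - eval_xt (g i) y s\<bar> \<le> K * (norm (x - y) + \<bar>t - s\<bar>)"
      "\<And>j x y. j \<in> {1..nTR} \<Longrightarrow> norm x \<le> B \<Longrightarrow> norm y \<le> B \<Longrightarrow> \<bar>meval (l j) (($) x) - meval (l j) (($) y)\<bar> \<le> K * norm (x - y)"
      using constraint_lipschitz[of B] by metis
    \<comment> \<open>The constraint values at the origin plus their largest change over the ball of
      radius \<open>B\<close> and the time interval.\<close>
    define A where "A = (\<Sum>i\<in>{1..nX}. \<bar>eval_xt (g i) 0 0\<bar>) + (\<Sum>j\<in>{1..nTR}. \<bar>meval (l j) (($) 0)\<bar>) + K * (B + T)"
    have "cost nX g nTR l t T (?tr d) \<le> A" if d: "d \<in> admissible D t T" for d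
    proof -
      have nb: "norm (?tr d s) \<le> B" if "s \<in> {t..T}" for s
        by (rule B[OF trajectory_is_solution[OF tT d]]) (use d t that in \<open>auto simp: admissible_def\<close>)
      have B0: "norm (0 :: real ^ 'n) \<le> B" using nb[of t] tT norm_ge_zero[of "?tr d t"] by (simp del: norm_ge_zero)
      have gi: "\<bar>eval_xt (g i) 0 0\<bar> \<le> (\<Sum>i\<in>{1..nX}. \<bar>eval_xt (g i) 0 0\<bar>)" if "i \<in> {1..nX}" for i
        using that by (intro member_le_sum) auto
      have lj: "\<bar>meval (l j) (($) 0)\<bar> \<le> (\<Sum>j\<in>{1..nTR}. \<bar>meval (l j) (($) 0)\<bar>)" if "j \<in> {1..nTR}" for j
        using that by (intro member_le_sum) auto
      have s1: "(\<Sum>i\<in>{1..nX}. \<bar>eval_xt (g i) 0 0\<bar>) \<ge> 0" "(\<Sum>j\<in>{1..nTR}. \<bar>meval (l j) (($) 0)\<bar>) \<ge> 0" by (auto intro: sum_nonneg)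
      have "meval (l j) (($) (?tr d T)) \<le> A" if j: "j \<in> {1..nTR}" for j
      proof -
        have "\<bar>meval (l j) (($) (?tr d T)) - meval (l j) (($) 0)\<bar> \<le> K * norm (?tr d T - 0)"
          using nb[of T] tT B0 by (intro K(3) j) auto
        also have "\<dots> \<le> K * (B + T)" using nb[of T] tT K(1) T_pos by (intro mult_left_mono) auto
        finally show ?thesis using lj[OF j] s1 unfolding A_def by linarith
      qed
      moreover have "eval_xt (g i) (?tr d s) s \<le> A" if i: "i \<in> {1..nX}" and s: "s \<in> {t..T}" for i s
      proof -
        have "\<bar>eval_xt (g i) (?tr d s) s - eval_xt (g i) 0 0\<bar> \<le> K * (norm (?tr d s - 0) + \<bar>s - 0\<bar>)"
          using nb[OF s] t s B0 by (intro K(2) i) auto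
        also have "\<dots> \<le> K * (B + T)" using nb[OF s] s t K(1) T_pos by (intro mult_left_mono) auto
        finally show ?thesis using gi[OF i] s1 unfolding A_def by linarith
      qed
      ultimately show ?thesis unfolding cost_le_iff[OF tT cont[OF d]] by blast
    qed
    thus ?thesis by (rule bdd_aboveI2)
  qed
  have "u x t \<le> c \<longleftrightarrow> (\<forall>d\<in>admissible D t T. cost nX g nTR l t T (?tr d) \<le> c)"
    unfolding value_function_def by (rule cSUP_le_iff[OF ne bdd])
  also have "\<dots> \<longleftrightarrow> ?rhs"
  proof (intro ball_cong refl)
    fix d assume d: "d \<in> admissible D t T"
    let ?Q = "\<lambda>\<phi> :: real \<Rightarrow> real ^ 'n. (\<forall>j\<in>{1..nTR}. meval (l j) (($) (\<phi> T)) \<le> c) \<and> (\<forall>i\<in>{1..nX}. \<forall>s\<in>{t..T}. eval_xt (g i) (\<phi> s) s \<le> c)"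
    have "?Q \<phi> \<longleftrightarrow> ?Q (?tr d)" if "is_solution F d t T x \<phi>" for \<phi>
      using trajectory_unique[OF tT d that] tT by auto
    thus "cost nX g nTR l t T (?tr d) \<le> c \<longleftrightarrow> (\<forall>\<phi>. is_solution F d t T x \<phi> \<longrightarrow> ?Q \<phi>)"
      unfolding cost_le_iff[OF tT cont[OF d]] using trajectory_is_solution[OF tT d] by blast
  qed
  finally show ?thesis .
qed

lemma value_ge:
  assumes t: "t \<in> {0..T}" and d: "d \<in> admissible D t T" and sol: "is_solution F d t T x \<phi>"
  shows "j \<in> {1..nTR} \<Longrightarrow> meval (l j) (($) (\<phi> T)) \<le> u x t"
    and "i \<in> {1..nX} \<Longrightarrow> s \<in> {t..T} \<Longrightarrow> eval_xt (g i) (\<phi> s) s \<le> u x t"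
  using value_le_iff[OF t, of x "u x t"] d sol by blast+

text \<open>Every trajectory starts at x, so the constraint at the initial time already enters the
  cost. This is the source of the second family of certificates.\<close>

lemma value_ge_state_constraint:
  assumes "t \<in> {0..T}" "i \<in> {1..nX}"
  shows "eval_xt (g i) x t \<le> u x t"
proof -
  obtain d0 where d0: "d0 \<in> D" using D_ne by blast
  have tT: "t \<le> T" using assms by simp
  obtain \<phi> where \<phi>: "is_solution F (\<lambda>_. d0) t T x \<phi>" using is_solution_exists[OF tT admissible_const[OF d0]] by blast
  show ?thesis using value_ge(2)[OF assms(1) admissible_const[OF d0] \<phi> assms(2), of t] \<phi> tT by (simp add: is_solution_def)
qed

lemma value_ge_target_constraint:
  assumes "j \<in> {1..nTR}"
  shows "meval (l j) (($) x) \<le> u x T"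
proof -
  obtain d0 where d0: "d0 \<in> D" using D_ne by blast
  obtain \<phi> where \<phi>: "is_solution F (\<lambda>_. d0) T T x \<phi>" using is_solution_exists[OF order_refl admissible_const[OF d0]] by blast
  show ?thesis using value_ge(1)[OF _ admissible_const[OF d0] \<phi> assms] \<phi> T_pos by (simp add: is_solution_def)
qed

text \<open>Half of the dynamic programming principle: follow the constant control up to time \<open>s\<close>, then an
  arbitrary one.\<close>

lemma value_decreases_along_constant_control:
  assumes t: "0 \<le> t" "t \<le> s" "s \<le> T" and d0: "d0 \<in> D" and sol: "is_solution F (\<lambda>_. d0) t T x \<phi>"
  shows "u (\<phi> s) s \<le> u x t"
proof -
  have s0: "s \<in> {0..T}" using t by simp
  show ?thesis
    unfolding value_le_iff[OF s0, of "\<phi> s"]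
  proof (intro ballI allI impI)
    fix d \<psi> assume d: "d \<in> admissible D s T" and \<psi>: "is_solution F d s T (\<phi> s) \<psi>"
    obtain e where e: "e \<in> borel_measurable lebesgue" "\<And>s. e s \<in> D" "\<And>r. r \<in> {s..T} \<Longrightarrow> e r = d r"
      using extend_control[OF d] by blast
    \<comment> \<open>The switching time \<open>s\<close> itself receives \<open>d0\<close>. On
      [s,T] this agrees with \<open>d\<close> only off {s}, which is the null set used
      below.\<close>
    define d' where "d' r = (if r \<in> {..s} then d0 else e r)" for r
    have "d' \<in> borel_measurable lebesgue" unfolding d'_def
      by (rule measurable_If) (use e in auto)
    moreover have "d' r \<in> D" for r using e(2)[of r] d0 by (simp add: d'_def)
    ultimately have d': "d' \<in> admissible D t T"
      by (simp add: admissible_def measurable_restrict_space1)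
    obtain \<theta> where \<theta>: "is_solution F d' t T x \<theta>" using is_solution_exists[OF _ d'] t by force
    have "is_solution F (\<lambda>_. d0) t s x \<theta>"
    proof (rule is_solution_cong[OF _ negligible_empty _ t(2)])
      have "is_solution F d' t s (\<theta> t) \<theta>" by (rule is_solution_restrict[OF \<theta>]) (use t in auto)
      thus "is_solution F d' t s x \<theta>" using \<theta> by (simp add: is_solution_def)
    qed (auto simp: d'_def)
    moreover have "is_solution F (\<lambda>_. d0) t s x \<phi>"
      using is_solution_restrict[OF sol order_refl t(2,3)] sol by (simp add: is_solution_def)
    ultimately have "norm (\<theta> s - \<phi> s) \<le> exp (L * (s - t)) * norm (x - x)"
      by (rule is_solution_dependence) (use d0 t in auto)
    hence \<theta>s: "\<theta> s = \<phi> s" by simp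
    have "is_solution F d s T (\<theta> s) \<theta>"
    proof (rule is_solution_cong[OF _ _ _ t(3) is_solution_restrict[OF \<theta> t(2,3) order_refl]])
      show "negligible {s}" by simp
      show "d' r = d r" if "r \<in> {s..T} - {s}" for r using that e(3)[of r] by (auto simp: d'_def)
    qed simp
    hence "norm (\<theta> r - \<psi> r) \<le> exp (L * (r - s)) * norm (\<phi> s - \<phi> s)" if "r \<in> {s..T}" for r
      unfolding \<theta>s using \<psi> by (rule is_solution_dependence) (use d that in \<open>auto simp: admissible_def\<close>)
    hence eq: "\<theta> r = \<psi> r" if "r \<in> {s..T}" for r using that by simp
    have t0: "t \<in> {0..T}" using t by simp
    show "(\<forall>j\<in>{1..nTR}. meval (l j) (($) (\<psi> T)) \<le> u x t) \<and> (\<forall>i\<in>{1..nX}. \<forall>r\<in>{s..T}. eval_xt (g i) (\<psi> r) r \<le> u x t)"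
    proof (intro conjI ballI)
      fix j assume "j \<in> {1..nTR}"
      from value_ge(1)[OF t0 d' \<theta> this] show "meval (l j) (($) (\<psi> T)) \<le> u x t" using eq[of T] t by simp
    next
      fix i r assume i: "i \<in> {1..nX}" and r: "r \<in> {s..T}"
      show "eval_xt (g i) (\<psi> r) r \<le> u x t" using value_ge(2)[OF t0 d' \<theta> i, of r] eq[OF r] r t by simp
    qed
  qed
qed

text \<open>The same control is run from both points; the trajectories separate by at most the
  factor exp(L T), and \<open>K\<close> is a Lipschitz constant of the constraints on the ball
  containing both.\<close>

lemma value_lipschitz_state:
  assumes "r \<ge> 0"
  obtains K where "K \<ge> 0" "\<And>x y t. norm x \<le> r \<Longrightarrow> norm y \<le> r \<Longrightarrow> t \<in> {0..T} \<Longrightarrow> u x t \<le> u y t + K * norm (x - y)"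
proof -
  obtain B where B: "\<And>d t x \<phi> s. is_solution F d t T x \<phi> \<Longrightarrow> (\<And>s. s \<in> {t..T} \<Longrightarrow> d s \<in> D) \<Longrightarrow> 0 \<le> t \<Longrightarrow> norm x \<le> r
    \<Longrightarrow> s \<in> {t..T} \<Longrightarrow> norm (\<phi> s) \<le> B"
    using trajectory_bound[OF assms] by metis
  obtain K where K: "K \<ge> 0"
    "\<And>i x y t s. i \<in> {1..nX} \<Longrightarrow> norm x \<le> B \<Longrightarrow> norm y \<le> B \<Longrightarrow> t \<in> {0..T} \<Longrightarrow> s \<in> {0..T} \<Longrightarrow>
      \<bar>eval_xt (g i) x t - eval_xt (g i) y s\<bar> \<le> K * (norm (x - y) + \<bar>t - s\<bar>)"
    "\<And>j x y. j \<in> {1..nTR} \<Longrightarrow> norm x \<le> B \<Longrightarrow> norm y \<le> B \<Longrightarrow> \<bar>meval (l j) (($) x) - meval (l j) (($) y)\<bar> \<le> K * norm (x - y)"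
    using constraint_lipschitz[of B] by metis
  show thesis
  proof (rule that[of "K * exp (L * T)"])
    show "K * exp (L * T) \<ge> 0" using K by simp
    fix x y :: "real ^ 'n" and t assume x: "norm x \<le> r" and y: "norm y \<le> r" and t: "t \<in> {0..T}"
    have tT: "t \<le> T" "0 \<le> t" using t by auto
    show "u x t \<le> u y t + K * exp (L * T) * norm (x - y)"
      unfolding value_le_iff[OF t, of x]
    proof (intro ballI allI impI)
      fix d \<phi> assume d: "d \<in> admissible D t T" and \<phi>: "is_solution F d t T x \<phi>"
      obtain \<psi> where \<psi>: "is_solution F d t T y \<psi>" using is_solution_exists[OF tT(1) d] by blast
      have dD: "\<And>s. s \<in> {t..T} \<Longrightarrow> d s \<in> D" using d by (simp add: admissible_def)
      have close: "K * norm (\<phi> s - \<psi> s) \<le> K * exp (L * T) * norm (x - y)" if s: "s \<in> {t..T}" for s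
      proof -
        have "norm (\<phi> s - \<psi> s) \<le> exp (L * (s - t)) * norm (x - y)" by (rule is_solution_dependence[OF \<phi> \<psi> dD s])
        also have "\<dots> \<le> exp (L * T) * norm (x - y)"
          using s tT L_nonneg by (intro mult_right_mono) (auto intro!: mult_left_mono)
        finally show ?thesis using K(1) by (simp add: mult_left_mono mult.assoc)
      qed
      show "(\<forall>j\<in>{1..nTR}. meval (l j) (($) (\<phi> T)) \<le> u y t + K * exp (L * T) * norm (x - y)) \<and>
        (\<forall>i\<in>{1..nX}. \<forall>s\<in>{t..T}. eval_xt (g i) (\<phi> s) s \<le> u y t + K * exp (L * T) * norm (x - y))"
      proof (intro conjI ballI)
        fix j assume j: "j \<in> {1..nTR}"
        have "\<bar>meval (l j) (($) (\<phi> T)) - meval (l j) (($) (\<psi> T))\<bar> \<le> K * norm (\<phi> T - \<psi> T)"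
          using B[OF \<phi> dD tT(2) x, of T] B[OF \<psi> dD tT(2) y, of T] tT by (intro K(3) j) auto
        thus "meval (l j) (($) (\<phi> T)) \<le> u y t + K * exp (L * T) * norm (x - y)"
          using value_ge(1)[OF t d \<psi> j] close[of T] tT by auto
      next
        fix i s assume i: "i \<in> {1..nX}" and s: "s \<in> {t..T}"
        have "\<bar>eval_xt (g i) (\<phi> s) s - eval_xt (g i) (\<psi> s) s\<bar> \<le> K * (norm (\<phi> s - \<psi> s) + \<bar>s - s\<bar>)"
          using B[OF \<phi> dD tT(2) x s] B[OF \<psi> dD tT(2) y s] s tT by (intro K(2) i) auto
        thus "eval_xt (g i) (\<phi> s) s \<le> u y t + K * exp (L * T) * norm (x - y)"
          using value_ge(2)[OF t d \<psi> i s] close[OF s] by auto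
      qed
    qed
  qed
qed

text \<open>Uniform over all controls and starting times: a radius \<open>B\<close> that
  trajectories from the ball of radius \<open>r\<close> never leave, and a speed bound
  \<open>M\<close> on that larger ball.\<close>

lemma local_bounds:
  assumes "r \<ge> 0"
  shows "\<exists>B M. M \<ge> 0 \<and> B \<ge> r \<and> (\<forall>d t x \<phi> s. is_solution F d t T x \<phi> \<longrightarrow> (\<forall>s\<in>{t..T}. d s \<in> D) \<longrightarrow> 0 \<le> t \<longrightarrow> norm x \<le> r
    \<longrightarrow> s \<in> {t..T} \<longrightarrow> norm (\<phi> s) \<le> B) \<and> (\<forall>x d. norm x \<le> B \<longrightarrow> d \<in> D \<longrightarrow> norm (F x d) \<le> M) \<and>
   (\<forall>d t x \<phi> s q. is_solution F d t T x \<phi> \<longrightarrow> (\<forall>s\<in>{t..T}. d s \<in> D) \<longrightarrow> 0 \<le> t \<longrightarrow> norm x \<le> r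
    \<longrightarrow> s \<in> {t..T} \<longrightarrow> q \<in> {t..T} \<longrightarrow> norm (\<phi> s - \<phi> q) \<le> M * \<bar>s - q\<bar>)"
proof -
  obtain B' where B': "\<And>d t x \<phi> s. is_solution F d t T x \<phi> \<Longrightarrow> (\<And>s. s \<in> {t..T} \<Longrightarrow> d s \<in> D) \<Longrightarrow> 0 \<le> t \<Longrightarrow> norm x \<le> r
    \<Longrightarrow> s \<in> {t..T} \<Longrightarrow> norm (\<phi> s) \<le> B'"
    using trajectory_bound[OF assms] by metis
  define B where "B = max B' r"
  have B: "norm (\<phi> s) \<le> B" if "is_solution F d t T x \<phi>" "\<forall>s\<in>{t..T}. d s \<in> D" "0 \<le> t" "norm x \<le> r" "s \<in> {t..T}" for d t x \<phi> s
    using B'[OF that(1) bspec[OF that(2)] that(3-5)] by (simp add: B_def)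
  obtain C where C: "C \<ge> 0" "\<And>d x. d \<in> D \<Longrightarrow> norm (F x d) \<le> C + L * norm x" using F_growth by blast
  define M where "M = C + L * B"
  have M: "norm (F x d) \<le> M" if "norm x \<le> B" "d \<in> D" for x d
    using C(2)[OF that(2), of x] mult_left_mono[OF that(1) L_nonneg] by (simp add: M_def)
  have M0: "M \<ge> 0" using C(1) L_nonneg assms by (simp add: M_def B_def)
  have speed: "norm (\<phi> s - \<phi> q) \<le> M * \<bar>s - q\<bar>" if "is_solution F d t T x \<phi>" "\<forall>s\<in>{t..T}. d s \<in> D" "0 \<le> t" "norm x \<le> r"
    "s \<in> {t..T}" "q \<in> {t..T}" for d t x \<phi> s q
    by (rule is_solution_speed_bound[OF that(1) M[OF B[OF that(1-4)] bspec[OF that(2)]] that(5,6)])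
  have Br: "B \<ge> r" by (simp add: B_def)
  show ?thesis
    by (intro exI[of _ B] exI[of _ M] conjI allI impI) (fact M0 Br | rule B M speed; assumption)+
qed

text \<open>Regularity in time comes from the speed bound. Following a constant control from t to s
  bounds u(x,s) by u(x,t). Conversely, the part after s of a trajectory is controlled by the value
  at time s, and on [t,s] each constraint stays close to its value at (x,s), which is at most
  u(x,s).\<close>

theorem value_lipschitz:
  assumes "r \<ge> 0"
  shows "\<exists>K\<ge>0. \<forall>x y t s. norm x \<le> r \<longrightarrow> norm y \<le> r \<longrightarrow> t \<in> {0..T} \<longrightarrow> s \<in> {0..T} \<longrightarrow>
    \<bar>u x t - u y s\<bar> \<le> K * (norm (x - y) + \<bar>t - s\<bar>)"
proof -
  obtain B M where M0: "M \<ge> 0" and Br: "B \<ge> r"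
    and B': "\<forall>d t x \<phi> s. is_solution F d t T x \<phi> \<longrightarrow> (\<forall>s\<in>{t..T}. d s \<in> D) \<longrightarrow> 0 \<le> t \<longrightarrow> norm x \<le> r
    \<longrightarrow> s \<in> {t..T} \<longrightarrow> norm (\<phi> s) \<le> B"
    and M': "\<forall>x d. norm x \<le> B \<longrightarrow> d \<in> D \<longrightarrow> norm (F x d) \<le> M"
    and speed': "\<forall>d t x \<phi> s q. is_solution F d t T x \<phi> \<longrightarrow> (\<forall>s\<in>{t..T}. d s \<in> D) \<longrightarrow> 0 \<le> t \<longrightarrow> norm x \<le> r
    \<longrightarrow> s \<in> {t..T} \<longrightarrow> q \<in> {t..T} \<longrightarrow> norm (\<phi> s - \<phi> q) \<le> M * \<bar>s - q\<bar>"
    using local_bounds[OF assms] by (elim exE conjE)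
  note B = B'[rule_format] and M = M'[rule_format] and speed = speed'[rule_format]
  have B0: "B \<ge> 0" using Br assms by simp
  obtain K1 where K1: "K1 \<ge> 0" "\<And>x y t. norm x \<le> B \<Longrightarrow> norm y \<le> B \<Longrightarrow> t \<in> {0..T} \<Longrightarrow> u x t \<le> u y t + K1 * norm (x - y)"
    using value_lipschitz_state[OF B0] by metis
  obtain K2 where K2: "K2 \<ge> 0"
    "\<And>i x y t s. i \<in> {1..nX} \<Longrightarrow> norm x \<le> B \<Longrightarrow> norm y \<le> B \<Longrightarrow> t \<in> {0..T} \<Longrightarrow> s \<in> {0..T} \<Longrightarrow>
      \<bar>eval_xt (g i) x t - eval_xt (g i) y s\<bar> \<le> K2 * (norm (x - y) + \<bar>t - s\<bar>)"
    using constraint_lipschitz[of B] by metis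
  \<comment> \<open>Dominates K1 M (drift of the state in the value), K2 (M + 1) (change of a
    constraint in space and time) and K1 (difference of states).\<close>
  define K where "K = (K1 + K2) * (M + 1)"
  have KK: "K1 * M \<le> K" "K2 * (M + 1) \<le> K" "K1 \<le> K" "K \<ge> 0" using K1(1) K2(1) M0 by (auto simp: K_def algebra_simps)
  have time: "\<bar>u x t - u x s\<bar> \<le> K * (s - t)" if x: "norm x \<le> r" and ts: "0 \<le> t" "t \<le> s" "s \<le> T" for x t s
  proof -
    have t0: "t \<in> {0..T}" "s \<in> {0..T}" using ts by auto
    have xB: "norm x \<le> B" using x Br by simp
    obtain d0 where d0: "d0 \<in> D" using D_ne by blast
    have drift: "K1 * norm (\<phi> s - x) \<le> K * (s - t)" if \<phi>: "is_solution F d t T x \<phi>" "\<And>s. s \<in> {t..T} \<Longrightarrow> d s \<in> D" for d \<phi>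
    proof -
      have "norm (\<phi> s - \<phi> t) \<le> M * \<bar>s - t\<bar>" by (rule speed[OF \<phi> ts(1) x]) (use ts in auto)
      hence "K1 * norm (\<phi> s - x) \<le> K1 * (M * (s - t))" using K1(1) ts \<phi>(1) by (intro mult_left_mono) (auto simp: is_solution_def)
      also have "\<dots> \<le> K * (s - t)" using mult_right_mono[OF KK(1), of "s - t"] ts by (simp add: mult.assoc)
      finally show ?thesis .
    qed
    have tT: "t \<le> T" using ts by simp
    obtain \<phi>0 where \<phi>0: "is_solution F (\<lambda>_. d0) t T x \<phi>0" using is_solution_exists[OF tT admissible_const[OF d0]] by blast
    have "u x s \<le> u (\<phi>0 s) s + K1 * norm (x - \<phi>0 s)"
      by (rule K1(2)[OF xB B[OF \<phi>0 d0 ts(1) x] t0(2)]) (use ts in auto)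
    also have "u (\<phi>0 s) s \<le> u x t" by (rule value_decreases_along_constant_control[OF ts d0 \<phi>0])
    also have "K1 * norm (x - \<phi>0 s) \<le> K * (s - t)" using drift[OF \<phi>0 d0] by (simp add: norm_minus_commute)
    finally have 1: "u x s \<le> u x t + K * (s - t)" by simp
    have 2: "u x t \<le> u x s + K * (s - t)"
      unfolding value_le_iff[OF t0(1), of x]
    proof (intro ballI allI impI)
      fix d \<phi> assume d: "d \<in> admissible D t T" and \<phi>: "is_solution F d t T x \<phi>"
      have dD: "\<And>s. s \<in> {t..T} \<Longrightarrow> d s \<in> D" using d by (simp add: admissible_def)
      have ds: "d \<in> admissible D s T"
        using d ts unfolding admissible_def by (auto intro: measurable_restrict_mono)
      have \<phi>s: "is_solution F d s T (\<phi> s) \<phi>" by (rule is_solution_restrict[OF \<phi>]) (use ts in auto)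
      have sB: "norm (\<phi> q) \<le> B" if "q \<in> {t..T}" for q by (rule B[OF \<phi> dD ts(1) x that])
      have us: "u (\<phi> s) s \<le> u x s + K * (s - t)"
        using K1(2)[OF sB[of s] xB t0(2)] ts drift[OF \<phi> dD] by auto
      show "(\<forall>j\<in>{1..nTR}. meval (l j) (($) (\<phi> T)) \<le> u x s + K * (s - t)) \<and>
        (\<forall>i\<in>{1..nX}. \<forall>q\<in>{t..T}. eval_xt (g i) (\<phi> q) q \<le> u x s + K * (s - t))"
      proof (intro conjI ballI)
        fix j assume j: "j \<in> {1..nTR}"
        show "meval (l j) (($) (\<phi> T)) \<le> u x s + K * (s - t)" using value_ge(1)[OF t0(2) ds \<phi>s j] us by linarith
      next
        fix i q assume i: "i \<in> {1..nX}" and q: "q \<in> {t..T}"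
        show "eval_xt (g i) (\<phi> q) q \<le> u x s + K * (s - t)"
        proof (cases "s \<le> q")
          case True
          thus ?thesis using value_ge(2)[OF t0(2) ds \<phi>s i, of q] us q by auto
        next
          case False
          have "norm (\<phi> q - \<phi> t) \<le> M * \<bar>q - t\<bar>" by (rule speed[OF \<phi> dD ts(1) x q]) (use ts in auto)
          also have "\<dots> \<le> M * (s - t)" using False q M0 by (intro mult_left_mono) auto
          finally have n1: "norm (\<phi> q - x) \<le> M * (s - t)" using \<phi> by (simp add: is_solution_def)
          have "\<bar>eval_xt (g i) (\<phi> q) q - eval_xt (g i) x s\<bar> \<le> K2 * (norm (\<phi> q - x) + \<bar>q - s\<bar>)"
            using q ts xB t0 by (intro K2(2) i sB) auto
          also have "\<dots> \<le> K2 * (M * (s - t) + (s - t))" using n1 False q K2(1) by (intro mult_left_mono add_mono) auto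
          also have "\<dots> = (K2 * (M + 1)) * (s - t)" by (simp add: algebra_simps)
          also have "\<dots> \<le> K * (s - t)" using KK(2) ts by (intro mult_right_mono) auto
          finally show ?thesis using value_ge_state_constraint[OF t0(2) i, of x] by linarith
        qed
      qed
    qed
    show ?thesis using 1 2 by linarith
  qed
  have "\<bar>u x t - u y s\<bar> \<le> K * (norm (x - y) + \<bar>t - s\<bar>)"
    if "norm x \<le> r" "norm y \<le> r" "t \<in> {0..T}" "s \<in> {0..T}" for x y t s
  proof -
    have "\<bar>u x t - u x s\<bar> \<le> K * \<bar>t - s\<bar>" using time[of x t s] time[of x s t] that by (cases "t \<le> s") (auto simp: abs_minus_commute)
    moreover have "\<bar>u x s - u y s\<bar> \<le> K1 * norm (x - y)"
      using K1(2)[of x y s] K1(2)[of y x s] that Br by (auto simp: norm_minus_commute abs_le_iff)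
    moreover have "K1 * norm (x - y) \<le> K * norm (x - y)" using KK(3) by (intro mult_right_mono) auto
    ultimately show ?thesis by (simp add: algebra_simps)
  qed
  thus ?thesis using KK(4) by blast
qed

text \<open>An Euler step misses the trajectory of the constant control by at most L M h^2, and
  \<open>u\<close> does not increase along that trajectory. This is the Hamilton-Jacobi inequality
  in a form that needs no derivative of \<open>u\<close>.\<close>

theorem value_directional_decrease:
  assumes "r \<ge> 0"
  shows "\<exists>C\<ge>0. \<forall>x d t h. norm x \<le> r \<longrightarrow> d \<in> D \<longrightarrow> 0 \<le> t \<longrightarrow> 0 \<le> h \<longrightarrow> t + h \<le> T \<longrightarrow>
    u (x + h *\<^sub>R F x d) (t + h) \<le> u x t + C * h\<^sup>2"
proof -
  obtain B M where M0: "M \<ge> 0" and Br: "B \<ge> r"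
    and B': "\<forall>d t x \<phi> s. is_solution F d t T x \<phi> \<longrightarrow> (\<forall>s\<in>{t..T}. d s \<in> D) \<longrightarrow> 0 \<le> t \<longrightarrow> norm x \<le> r
    \<longrightarrow> s \<in> {t..T} \<longrightarrow> norm (\<phi> s) \<le> B"
    and M': "\<forall>x d. norm x \<le> B \<longrightarrow> d \<in> D \<longrightarrow> norm (F x d) \<le> M"
    and speed': "\<forall>d t x \<phi> s q. is_solution F d t T x \<phi> \<longrightarrow> (\<forall>s\<in>{t..T}. d s \<in> D) \<longrightarrow> 0 \<le> t \<longrightarrow> norm x \<le> r
    \<longrightarrow> s \<in> {t..T} \<longrightarrow> q \<in> {t..T} \<longrightarrow> norm (\<phi> s - \<phi> q) \<le> M * \<bar>s - q\<bar>"
    using local_bounds[OF assms] by (elim exE conjE)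
  note B = B'[rule_format] and M = M'[rule_format] and speed = speed'[rule_format]
  \<comment> \<open>Large enough for the Euler points x + h F(x,d) as well as for the
    trajectories.\<close>
  define B2 where "B2 = B + T * M"
  have B2: "B2 \<ge> 0" "B \<le> B2" using Br assms M0 T_pos by (auto simp: B2_def)
  obtain K1 where K1: "K1 \<ge> 0" "\<And>x y t. norm x \<le> B2 \<Longrightarrow> norm y \<le> B2 \<Longrightarrow> t \<in> {0..T} \<Longrightarrow> u x t \<le> u y t + K1 * norm (x - y)"
    using value_lipschitz_state[OF B2(1)] by metis
  have "u (x + h *\<^sub>R F x d) (t + h) \<le> u x t + (K1 * (L * M)) * h\<^sup>2"
    if x: "norm x \<le> r" and d: "d \<in> D" and t: "0 \<le> t" "0 \<le> h" "t + h \<le> T" for x d t h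
  proof -
    have tT: "t \<le> T" "t \<le> t + h" using t by auto
    obtain \<phi> where \<phi>: "is_solution F (\<lambda>_. d) t T x \<phi>" using is_solution_exists[OF tT(1) admissible_const[OF d]] by blast
    have \<phi>t: "\<phi> t = x" using \<phi> by (simp add: is_solution_def)
    define \<delta> where "\<delta> s = \<phi> s - s *\<^sub>R F x d" for s
    have r1: "is_solution F (\<lambda>_. d) t (t + h) (\<phi> t) \<phi>" by (rule is_solution_restrict[OF \<phi> order_refl tT(2) t(3)])
    obtain N where N: "negligible N" "\<And>s. s \<in> {t..t + h} - N \<Longrightarrow> (\<phi> has_vector_derivative F (\<phi> s) d) (at s within {t..t + h})"
      using is_solution_ae[OF r1] by blast
    have "norm (\<delta> (t + h) - \<delta> t) \<le> (L * M * h) * ((t + h) - t)"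
    proof (rule abs_continuous_ivl_norm_bound[OF tT(2) _ N(1)])
      show "abs_continuous_ivl t (t + h) \<delta>"
      proof (rule abs_continuous_ivl_dominated)
        show "abs_continuous_ivl t (t + h) \<phi>" using r1 by (simp add: is_solution_def)
        fix s q :: real
        have "\<delta> s - \<delta> q = (\<phi> s - \<phi> q) - (s - q) *\<^sub>R F x d" by (simp add: \<delta>_def algebra_simps)
        also have "norm \<dots> \<le> norm (\<phi> s - \<phi> q) + \<bar>s - q\<bar> * norm (F x d)" by (rule order_trans[OF norm_triangle_ineq4]) simp
        also have "\<dots> \<le> (norm (F x d) + 1) * (\<bar>s - q\<bar> + norm (\<phi> s - \<phi> q))" by (simp add: algebra_simps)
        finally show "norm (\<delta> s - \<delta> q) \<le> (norm (F x d) + 1) * (\<bar>s - q\<bar> + norm (\<phi> s - \<phi> q))" .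
      qed
      fix s assume s: "s \<in> {t..t + h} - N"
      have "(\<delta> has_vector_derivative (F (\<phi> s) d - F x d)) (at s within {t..t + h})"
        unfolding \<delta>_def using N(2)[OF s] by (auto intro!: derivative_eq_intros)
      moreover have "norm (F (\<phi> s) d - F x d) \<le> L * M * h"
      proof -
        have "norm (F (\<phi> s) d - F x d) \<le> L * norm (\<phi> s - \<phi> t)" unfolding \<phi>t by (rule F_lipschitz[OF d])
        also have "norm (\<phi> s - \<phi> t) \<le> M * \<bar>s - t\<bar>" by (rule speed[OF \<phi> d t(1) x]) (use s t in auto)
        also have "\<dots> \<le> M * h" using s M0 by (intro mult_left_mono) auto
        finally show ?thesis using L_nonneg by (simp add: mult_left_mono mult.assoc)
      qed
      ultimately show "\<exists>v. norm v \<le> L * M * h \<and> (\<delta> has_vector_derivative v) (at s within {t..t + h})" by blast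
    qed
    moreover have "\<delta> (t + h) - \<delta> t = \<phi> (t + h) - (x + h *\<^sub>R F x d)" by (simp add: \<delta>_def \<phi>t algebra_simps)
    ultimately have close: "norm ((x + h *\<^sub>R F x d) - \<phi> (t + h)) \<le> L * M * h\<^sup>2"
      by (simp add: norm_minus_commute power2_eq_square mult.assoc)
    have n1: "norm (\<phi> (t + h)) \<le> B2" using B[OF \<phi> d t(1) x, of "t + h"] t B2 by auto
    have n2: "norm (x + h *\<^sub>R F x d) \<le> B2"
    proof -
      have "norm (x + h *\<^sub>R F x d) \<le> norm x + h * norm (F x d)" using t by (intro order_trans[OF norm_triangle_ineq]) simp
      also have "\<dots> \<le> B + T * M" using x Br t M[of x d] d M0 by (intro add_mono mult_mono) auto
      finally show ?thesis by (simp add: B2_def)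
    qed
    have "u (x + h *\<^sub>R F x d) (t + h) \<le> u (\<phi> (t + h)) (t + h) + K1 * norm ((x + h *\<^sub>R F x d) - \<phi> (t + h))"
      by (rule K1(2)[OF n2 n1]) (use t in auto)
    also have "u (\<phi> (t + h)) (t + h) \<le> u x t" by (rule value_decreases_along_constant_control[OF t(1) tT(2) t(3) d \<phi>])
    also have "K1 * norm ((x + h *\<^sub>R F x d) - \<phi> (t + h)) \<le> K1 * (L * M * h\<^sup>2)" using close K1(1) by (rule mult_left_mono)
    finally show ?thesis by (simp add: mult_ac)
  qed
  moreover have "K1 * (L * M) \<ge> 0" using K1(1) L_nonneg M0 by simp
  ultimately show ?thesis by blast
qed

end

subsection \<open>Polynomial mollification with the Landau kernel\<close>

lemma integrable_continuous_compact_support: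
  fixes f :: "'a::euclidean_space \<Rightarrow> real"
  assumes "continuous_on UNIV f" "\<And>x. norm x > r \<Longrightarrow> f x = 0"
  shows "integrable lborel f"
proof -
  have "integrable lborel (\<lambda>x. indicator (cball 0 r) x *\<^sub>R f x)"
    by (rule borel_integrable_compact) (auto intro: continuous_on_subset[OF assms(1)])
  moreover have "(\<lambda>x. indicator (cball 0 r) x *\<^sub>R f x) = f"
    using assms(2) by (auto simp: fun_eq_iff indicator_def)
  ultimately show ?thesis by simp
qed

lemma lborel_integral_reflect_translate:
  fixes f :: "'a::euclidean_space \<Rightarrow> real"
  assumes "f \<in> borel_measurable borel"
  shows "(LINT x|lborel. f x) = (LINT x|lborel. f (z - x))"
proof -
  have "(lborel :: 'a measure) = density (distr lborel borel (\<lambda>x. z + (- 1) *\<^sub>R x)) (\<lambda>_. \<bar>- 1 :: real\<bar> ^ DIM('a))"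
    by (rule lborel_affine) simp
  hence "(lborel :: 'a measure) = distr lborel borel (\<lambda>x. z - x)" by (simp add: density_1)
  hence "(LINT x|lborel. f x) = (LINT x|distr lborel borel (\<lambda>x. z - x). f x)" by simp
  also have "\<dots> = (LINT x|lborel. f (z - x))"
    using assms by (intro integral_distr) auto
  finally show ?thesis .
qed

lemma power2_norm_vec: "(norm (x :: real ^ 'v::finite))\<^sup>2 = (\<Sum>i\<in>UNIV. (x $ i)\<^sup>2)"
  by (simp add: norm_vec_def L2_set_def sum_nonneg)

text \<open>Expanding |z - y|^2 by coordinates reduces exponent N + 1 to exponent N with the weights
  W, W y_i and W y_i^2, all continuous with the same support bound. Hence the induction is over all
  W.\<close>

lemma landau_integral_polynomial:
  fixes W :: "real ^ 'v::finite \<Rightarrow> real"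
  assumes "continuous_on UNIV W" "\<And>x. norm x > r \<Longrightarrow> W x = 0"
  shows "\<exists>p. \<forall>z :: real ^ 'v. (LINT y|lborel. W y * (1 - (norm (z - y))\<^sup>2 * c) ^ N) = meval p (($) z)"
  using assms
proof (induction N arbitrary: W)
  case 0
  show ?case by (rule exI[of _ "mconst (LINT y|lborel. W y)"]) simp
next
  case (Suc N)
  have cy: "continuous_on UNIV (\<lambda>y :: real ^ 'v. y $ i)" for i by (intro continuous_intros)
  obtain p where p: "\<And>z :: real ^ 'v. (LINT y|lborel. W y * (1 - (norm (z - y))\<^sup>2 * c) ^ N) = meval p (($) z)"
    using Suc.IH[OF Suc.prems] by blast
  have "\<forall>i. \<exists>p. \<forall>z :: real ^ 'v. (LINT y|lborel. (W y * y $ i) * (1 - (norm (z - y))\<^sup>2 * c) ^ N) = meval p (($) z)"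
    by (intro allI Suc.IH continuous_intros Suc.prems(1)) (simp add: Suc.prems(2))
  then obtain q1 where q1: "\<And>i (z :: real ^ 'v). (LINT y|lborel. (W y * y $ i) * (1 - (norm (z - y))\<^sup>2 * c) ^ N) = meval (q1 i) (($) z)"
    by metis
  have "\<forall>i. \<exists>p. \<forall>z :: real ^ 'v. (LINT y|lborel. (W y * (y $ i)\<^sup>2) * (1 - (norm (z - y))\<^sup>2 * c) ^ N) = meval p (($) z)"
    by (intro allI Suc.IH continuous_intros Suc.prems(1)) (simp add: Suc.prems(2))
  then obtain q2 where q2: "\<And>i (z :: real ^ 'v). (LINT y|lborel. (W y * (y $ i)\<^sup>2) * (1 - (norm (z - y))\<^sup>2 * c) ^ N) = meval (q2 i) (($) z)"
    by metis
  have int: "integrable lborel (\<lambda>y. V y * (1 - (norm (z - y))\<^sup>2 * c) ^ N)"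
    if "continuous_on UNIV V" "\<And>y. norm y > r \<Longrightarrow> V y = 0" for V and z :: "real ^ 'v"
    by (rule integrable_continuous_compact_support[of _ r]) (auto intro!: continuous_intros that simp: that(2))
  have i0: "integrable lborel (\<lambda>y. W y * (1 - (norm (z - y))\<^sup>2 * c) ^ N)" for z by (rule int[OF Suc.prems])
  have i1: "integrable lborel (\<lambda>y. (W y * y $ i) * (1 - (norm (z - y))\<^sup>2 * c) ^ N)" for i z
    by (rule int) (auto intro!: continuous_intros Suc.prems(1) simp: Suc.prems(2))
  have i2: "integrable lborel (\<lambda>y. (W y * (y $ i)\<^sup>2) * (1 - (norm (z - y))\<^sup>2 * c) ^ N)" for i z
    by (rule int) (auto intro!: continuous_intros Suc.prems(1) simp: Suc.prems(2))
  show ?case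
  proof (intro exI allI)
    fix z :: "real ^ 'v"
    let ?k = "\<lambda>y. (1 - (norm (z - y))\<^sup>2 * c) ^ N"
    have "W y * (1 - (norm (z - y))\<^sup>2 * c) ^ Suc N = W y * ?k y -
        c * (\<Sum>i\<in>UNIV. (z $ i)\<^sup>2 * (W y * ?k y) - 2 * z $ i * ((W y * y $ i) * ?k y) + (W y * (y $ i)\<^sup>2) * ?k y)" for y
    proof -
      have "(norm (z - y))\<^sup>2 = (\<Sum>i\<in>UNIV. (z $ i)\<^sup>2 - 2 * z $ i * y $ i + (y $ i)\<^sup>2)"
        unfolding power2_norm_vec by (intro sum.cong refl) (simp add: power2_eq_square algebra_simps)
      hence "W y * kk * (norm (z - y))\<^sup>2 = (\<Sum>i\<in>UNIV. (z $ i)\<^sup>2 * (W y * kk) - 2 * z $ i * ((W y * y $ i) * kk) + (W y * (y $ i)\<^sup>2) * kk)" for kk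
        by (simp add: sum_distrib_left algebra_simps)
      hence "W y * ?k y * (norm (z - y))\<^sup>2 = (\<Sum>i\<in>UNIV. (z $ i)\<^sup>2 * (W y * ?k y) - 2 * z $ i * ((W y * y $ i) * ?k y) + (W y * (y $ i)\<^sup>2) * ?k y)" .
      moreover have "W y * (1 - (norm (z - y))\<^sup>2 * c) ^ Suc N = W y * ?k y - c * (W y * ?k y * (norm (z - y))\<^sup>2)"
        by (simp add: algebra_simps)
      ultimately show ?thesis by simp
    qed
    hence "(LINT y|lborel. W y * (1 - (norm (z - y))\<^sup>2 * c) ^ Suc N) = (LINT y|lborel. W y * ?k y -
        c * (\<Sum>i\<in>UNIV. (z $ i)\<^sup>2 * (W y * ?k y) - 2 * z $ i * ((W y * y $ i) * ?k y) + (W y * (y $ i)\<^sup>2) * ?k y))"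
      by (simp only:)
    also have "\<dots> = meval p (($) z) - c * (\<Sum>i\<in>UNIV. (z $ i)\<^sup>2 * meval p (($) z) - 2 * z $ i * meval (q1 i) (($) z) + meval (q2 i) (($) z))"
      unfolding p[symmetric] q1[symmetric] q2[symmetric]
      by (simp add: i0 i1 i2)
    also have "\<dots> = meval (p - mconst c * (\<Sum>i\<in>UNIV. mvar i ^ 2 * p - mconst 2 * mvar i * q1 i + q2 i)) (($) z)"
      by simp
    finally show "(LINT y|lborel. W y * (1 - (norm (z - y))\<^sup>2 * c) ^ Suc N) = meval (p - mconst c * (\<Sum>i\<in>UNIV. mvar i ^ 2 * p - mconst 2 * mvar i * q1 i + q2 i)) (($) z)" .
  qed
qed

text \<open>The exponent is \<open>Suc N\<close> because a zeroth power would be 1 outside the ball.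
  The kernel is not normalised; its mass is divided out later.\<close>

definition landau_kernel :: "real \<Rightarrow> nat \<Rightarrow> 'a::euclidean_space \<Rightarrow> real" where
  "landau_kernel \<rho> N y = (max 0 (1 - (norm y)\<^sup>2 * (1 / \<rho>\<^sup>2))) ^ Suc N"

lemma landau_kernel_continuous [continuous_intros]: "continuous_on S (landau_kernel \<rho> N)"
  unfolding landau_kernel_def[abs_def] by (intro continuous_intros)

lemma landau_kernel_nonneg: "landau_kernel \<rho> N y \<ge> 0"
  by (simp add: landau_kernel_def)

lemma landau_kernel_outside:
  assumes "\<rho> > 0" "norm y > \<rho>"
  shows "landau_kernel \<rho> N y = 0"
proof -
  have "\<rho>\<^sup>2 \<le> (norm y)\<^sup>2" using assms by (intro power_mono) auto
  thus ?thesis using assms by (simp add: landau_kernel_def max_def)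
qed

text \<open>Beyond radius e the kernel is at most a^(N+1), within radius e / 2 at least b^(N+1), and
  a < b. So the share of the mass beyond e decays like (a / b)^(N+1).\<close>

lemma landau_kernel_first_moment:
  assumes \<rho>: "\<rho> > 0" and \<epsilon>: "\<epsilon> > 0"
  shows "\<exists>N. 0 < (LINT y|lborel. landau_kernel \<rho> N (y :: 'a::euclidean_space)) \<and>
    (LINT y|lborel. norm y * landau_kernel \<rho> N (y :: 'a)) \<le> \<epsilon> * (LINT y|lborel. landau_kernel \<rho> N (y :: 'a))"
proof -
  \<comment> \<open>The mass within e and the tail contribute e each, so 2 e \<le> \<epsilon> is
    wanted; e < \<rho> makes \<open>a\<close> positive.\<close>
  define e where "e = min (\<epsilon> / 2) (\<rho> / 2)"
  have e: "e > 0" "e < \<rho>" "e \<le> \<epsilon> / 2" using \<rho> \<epsilon> by (auto simp: e_def)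
  define a where "a = 1 - e\<^sup>2 * (1 / \<rho>\<^sup>2)"
  define b where "b = 1 - (e / 2)\<^sup>2 * (1 / \<rho>\<^sup>2)"
  have "e\<^sup>2 < \<rho>\<^sup>2" using e by (intro power_strict_mono) auto
  hence a: "a > 0" using \<rho> by (simp add: a_def)
  have "(e / 2)\<^sup>2 < e\<^sup>2" using e by (intro power_strict_mono) auto
  hence ab: "a < b" unfolding a_def b_def using \<rho> by (intro diff_strict_left_mono mult_strict_right_mono) auto
  define V1 where "V1 = measure lborel (cball (0 :: 'a) \<rho>)"
  define V2 where "V2 = measure lborel (ball (0 :: 'a) (e / 2))"
  have V: "V1 \<ge> 0" "V2 > 0" using content_ball_pos[of "e / 2" "0 :: 'a"] e by (auto simp: V1_def V2_def)
  have i1: "integrable lborel (\<lambda>y :: 'a. landau_kernel \<rho> N y)" for N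
    by (rule integrable_continuous_compact_support[of _ \<rho>]) (auto intro!: continuous_intros landau_kernel_outside \<rho>)
  have i2: "integrable lborel (\<lambda>y :: 'a. norm y * landau_kernel \<rho> N y)" for N
    by (rule integrable_continuous_compact_support[of _ \<rho>]) (auto intro!: continuous_intros simp: landau_kernel_outside[OF \<rho>])
  have fin: "emeasure lborel (cball (0 :: 'a) \<rho>) < \<infinity>" "emeasure lborel (ball (0 :: 'a) (e / 2)) < \<infinity>"
    by (rule emeasure_lborel_cball_finite emeasure_lborel_ball_finite)+
  have lower: "b ^ Suc N * V2 \<le> (LINT y|lborel. landau_kernel \<rho> N (y :: 'a))" for N
  proof -
    have "(LINT y|lborel. b ^ Suc N * indicator (ball (0 :: 'a) (e / 2)) y) \<le> (LINT y|lborel. landau_kernel \<rho> N (y :: 'a))"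
    proof (rule integral_mono)
      show "integrable lborel (\<lambda>y. b ^ Suc N * indicator (ball (0 :: 'a) (e / 2)) y)"
        using fin by (intro Bochner_Integration.integrable_mult_right) (simp add: integrable_indicator_iff)
      fix y :: 'a
      show "b ^ Suc N * indicator (ball 0 (e / 2)) y \<le> landau_kernel \<rho> N y"
      proof (cases "norm y < e / 2")
        case True
        have "(norm y)\<^sup>2 \<le> (e / 2)\<^sup>2" using True by (intro power_mono) auto
        hence "b \<le> 1 - (norm y)\<^sup>2 * (1 / \<rho>\<^sup>2)" unfolding b_def by (intro diff_left_mono mult_right_mono) auto
        hence "b ^ Suc N \<le> landau_kernel \<rho> N y" unfolding landau_kernel_def using a ab by (intro power_mono) auto
        thus ?thesis using True by simp
      qed (auto simp: landau_kernel_nonneg)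
    qed (rule i1)
    thus ?thesis using fin by (simp add: V2_def)
  qed
  have upper: "(LINT y|lborel. norm y * landau_kernel \<rho> N (y :: 'a)) \<le> e * (LINT y|lborel. landau_kernel \<rho> N (y :: 'a)) + \<rho> * a ^ Suc N * V1" for N
  proof -
    have ii: "integrable lborel (\<lambda>y. \<rho> * a ^ Suc N * indicator (cball (0 :: 'a) \<rho>) y)"
      using fin by (intro Bochner_Integration.integrable_mult_right) (simp add: integrable_indicator_iff)
    have "(LINT y|lborel. norm y * landau_kernel \<rho> N (y :: 'a)) \<le> (LINT y|lborel. e * landau_kernel \<rho> N y + \<rho> * a ^ Suc N * indicator (cball (0 :: 'a) \<rho>) y)"
    proof (rule integral_mono)
      show "integrable lborel (\<lambda>y :: 'a. e * landau_kernel \<rho> N y + \<rho> * a ^ Suc N * indicator (cball 0 \<rho>) y)"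
        by (intro Bochner_Integration.integrable_add Bochner_Integration.integrable_mult_right i1 ii)
      fix y :: 'a
      show "norm y * landau_kernel \<rho> N y \<le> e * landau_kernel \<rho> N y + \<rho> * a ^ Suc N * indicator (cball 0 \<rho>) y"
      proof (cases "norm y \<le> e")
        case True
        hence "norm y * landau_kernel \<rho> N y \<le> e * landau_kernel \<rho> N y" by (intro mult_right_mono landau_kernel_nonneg)
        moreover have "0 \<le> \<rho> * a ^ Suc N * indicator (cball 0 \<rho>) y" using \<rho> a by auto
        ultimately show ?thesis by linarith
      next
        case False
        show ?thesis
        proof (cases "norm y \<le> \<rho>")
          case True
          have "e\<^sup>2 \<le> (norm y)\<^sup>2" using False e by (intro power_mono) auto
          hence "1 - (norm y)\<^sup>2 * (1 / \<rho>\<^sup>2) \<le> a" unfolding a_def by (intro diff_left_mono mult_right_mono) auto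
          hence "landau_kernel \<rho> N y \<le> a ^ Suc N" unfolding landau_kernel_def using a by (intro power_mono) auto
          hence "norm y * landau_kernel \<rho> N y \<le> \<rho> * a ^ Suc N" using True \<rho> landau_kernel_nonneg by (intro mult_mono) auto
          moreover have "0 \<le> e * landau_kernel \<rho> N y" using e landau_kernel_nonneg by (intro mult_nonneg_nonneg) auto
          ultimately show ?thesis using True by simp
        qed (simp add: landau_kernel_outside[OF \<rho>])
      qed
    qed (rule i2)
    also have "\<dots> = e * (LINT y|lborel. landau_kernel \<rho> N (y :: 'a)) + \<rho> * a ^ Suc N * V1"
      using i1 ii fin by (subst Bochner_Integration.integral_add) (auto simp: V1_def)
    finally show ?thesis .
  qed
  have "(\<lambda>N. (a / b) ^ Suc N * (\<rho> * V1)) \<longlonglongrightarrow> 0 * (\<rho> * V1)"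
    using a ab by (intro tendsto_mult tendsto_const LIMSEQ_Suc LIMSEQ_power_zero) auto
  hence "eventually (\<lambda>N. (a / b) ^ Suc N * (\<rho> * V1) < e * V2) sequentially"
    using e V by (intro order_tendstoD(2)) auto
  then obtain N where N: "(a / b) ^ Suc N * (\<rho> * V1) < e * V2" using eventually_happens' sequentially_bot by blast
  have b0: "b \<noteq> 0" using a ab by simp
  have bN: "b ^ Suc N > 0" using a ab by simp
  have "\<rho> * a ^ Suc N * V1 = b ^ Suc N * ((a / b) ^ Suc N * (\<rho> * V1))" using b0 by (simp add: power_divide)
  also have "\<dots> \<le> b ^ Suc N * (e * V2)" using N bN by (intro mult_left_mono) auto
  also have "\<dots> = e * (b ^ Suc N * V2)" by simp
  also have "\<dots> \<le> e * (LINT y|lborel. landau_kernel \<rho> N (y :: 'a))" using lower[of N] e by (intro mult_left_mono) auto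
  finally have mom: "(LINT y|lborel. norm y * landau_kernel \<rho> N (y :: 'a)) \<le> (2 * e) * (LINT y|lborel. landau_kernel \<rho> N (y :: 'a))"
    using upper[of N] by linarith
  have pos: "0 < (LINT y|lborel. landau_kernel \<rho> N (y :: 'a))"
    using lower[of N] bN V by (auto intro: less_le_trans[OF mult_pos_pos])
  have "(2 * e) * (LINT y|lborel. landau_kernel \<rho> N (y :: 'a)) \<le> \<epsilon> * (LINT y|lborel. landau_kernel \<rho> N (y :: 'a))"
    using e pos by (intro mult_right_mono) auto
  from order_trans[OF mom this] show ?thesis using pos by blast
qed

text \<open>One-sided difference quotients of the mollification average those of \<open>W\<close>; this transfers directional
  decrease from \<open>W\<close> to the polynomial although \<open>W\<close> need not be differentiable.\<close>

theorem polynomial_mollification: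
  fixes W :: "real ^ 'v::finite \<Rightarrow> real"
  assumes lip: "\<And>x y. \<bar>W x - W y\<bar> \<le> K * norm (x - y)" and supp': "\<forall>x. norm x > r \<longrightarrow> W x = 0"
    and r: "r > 0" and K: "K \<ge> 0" and \<epsilon>: "\<epsilon> > 0"
  shows "\<exists>p. (\<forall>z. norm z \<le> r \<longrightarrow> \<bar>meval p (($) z) - W z\<bar> \<le> K * \<epsilon>) \<and>
    (\<forall>z v A C h0. norm z < r \<longrightarrow> A \<ge> 0 \<longrightarrow> h0 > 0 \<longrightarrow>
      (\<forall>y h. 0 < h \<longrightarrow> h < h0 \<longrightarrow> W (z - y + h *\<^sub>R v) - W (z - y) \<le> A * norm y * h + C * h\<^sup>2) \<longrightarrow>
      (\<Sum>i\<in>UNIV. v $ i * meval (mpartial i p) (($) z)) \<le> A * \<epsilon>)"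
proof -
  note supp = supp'[rule_format]
  \<comment> \<open>For |z| \<le> r and y in the support of \<open>W\<close> one has |z - y| \<le> 2
    r, so the truncation in the kernel is never active and the convolution is a polynomial in
    z.\<close>
  define \<rho> where "\<rho> = 2 * r"
  have \<rho>: "\<rho> > 0" using r by (simp add: \<rho>_def)
  obtain N where N: "0 < (LINT y|lborel. landau_kernel \<rho> N (y :: real ^ 'v))"
    "(LINT y|lborel. norm y * landau_kernel \<rho> N (y :: real ^ 'v)) \<le> \<epsilon> * (LINT y|lborel. landau_kernel \<rho> N (y :: real ^ 'v))"
    using landau_kernel_first_moment[OF \<rho> \<epsilon>, where 'a = "real ^ 'v"] by blast
  define m where "m = (LINT y|lborel. landau_kernel \<rho> N (y :: real ^ 'v))"
  define k where "k y = landau_kernel \<rho> N y / m" for y :: "real ^ 'v"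
  have m: "m > 0" using N by (simp add: m_def)
  have k0: "k y \<ge> 0" for y using m by (simp add: k_def landau_kernel_nonneg)
  have kc: "continuous_on S k" for S unfolding k_def[abs_def] using m by (intro continuous_intros) auto
  have kout: "norm y > \<rho> \<Longrightarrow> k y = 0" for y by (simp add: k_def landau_kernel_outside[OF \<rho>])
  have ki: "integrable lborel k" by (rule integrable_continuous_compact_support[OF kc kout])
  have k1: "(LINT y|lborel. k y) = 1" using m by (simp add: k_def m_def)
  have kni: "integrable lborel (\<lambda>y. norm y * k y)"
    by (rule integrable_continuous_compact_support[of _ \<rho>]) (auto intro!: continuous_intros kc simp: kout)
  have kn: "(LINT y|lborel. norm y * k y) \<le> \<epsilon>"
    using N(2) m unfolding m_def[symmetric] k_def by (simp add: divide_le_eq)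
  have Wc: "continuous_on S W" for S
  proof (rule lipschitz_on_continuous_on)
    show "K-lipschitz_on S W" using lip K by (intro lipschitz_onI) (auto simp: dist_norm)
  qed
  have Wk: "integrable lborel (\<lambda>y. W (z - y) * k y)" for z
    by (rule integrable_continuous_compact_support[of _ \<rho>])
       (auto intro!: continuous_intros kc continuous_on_compose2[OF Wc[of UNIV]] simp: kout)
  obtain q where q: "\<And>z :: real ^ 'v. (LINT y|lborel. W y * (1 - (norm (z - y))\<^sup>2 * (1 / \<rho>\<^sup>2)) ^ Suc N) = meval q (($) z)"
    using landau_integral_polynomial[OF Wc supp, where c = "1 / \<rho>\<^sup>2" and N = "Suc N"] by blast
  define p where "p = mconst (1 / m) * q"
  have p: "meval p (($) z) = (LINT y|lborel. W (z - y) * k y)" if z: "norm z \<le> r" for z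
  proof -
    have "(LINT y|lborel. W (z - y) * k y) = (LINT y|lborel. W (z - (z - y)) * k (z - y))"
      by (rule lborel_integral_reflect_translate)
         (auto intro!: borel_measurable_continuous_onI continuous_intros kc continuous_on_compose2[OF Wc[of UNIV]])
    also have "\<dots> = (LINT y|lborel. (1 / m) * (W y * (1 - (norm (z - y))\<^sup>2 * (1 / \<rho>\<^sup>2)) ^ Suc N))"
    proof (rule Bochner_Integration.integral_cong[OF refl])
      fix y
      show "W (z - (z - y)) * k (z - y) = (1 / m) * (W y * (1 - (norm (z - y))\<^sup>2 * (1 / \<rho>\<^sup>2)) ^ Suc N)"
      proof (cases "norm y \<le> r")
        case True
        have "norm (z - y) \<le> \<rho>" using z True norm_triangle_ineq4[of z y] by (simp add: \<rho>_def)
        hence "(norm (z - y))\<^sup>2 \<le> \<rho>\<^sup>2" by (intro power_mono) auto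
        hence "max 0 (1 - (norm (z - y))\<^sup>2 * (1 / \<rho>\<^sup>2)) = 1 - (norm (z - y))\<^sup>2 * (1 / \<rho>\<^sup>2)" using \<rho> by (simp add: max_def)
        thus ?thesis by (simp add: k_def landau_kernel_def)
      qed (simp add: supp)
    qed
    also have "\<dots> = meval p (($) z)" by (simp add: p_def q[symmetric])
    finally show ?thesis by simp
  qed
  show ?thesis
  proof (intro exI[of _ p] conjI allI impI)
    fix z :: "real ^ 'v" assume z: "norm z \<le> r"
    have "meval p (($) z) - W z = (LINT y|lborel. W (z - y) * k y) - (LINT y|lborel. W z * k y)"
      using p[OF z] k1 by simp
    also have "\<dots> = (LINT y|lborel. (W (z - y) - W z) * k y)"
      using Wk ki by (subst Bochner_Integration.integral_diff[symmetric]) (auto simp: algebra_simps)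
    also have "\<bar>\<dots>\<bar> \<le> (LINT y|lborel. \<bar>(W (z - y) - W z) * k y\<bar>)" by (rule integral_abs_bound)
    also have "\<dots> \<le> (LINT y|lborel. K * (norm y * k y))"
    proof (rule integral_mono)
      have "integrable lborel (\<lambda>y. W (z - y) * k y - W z * k y)" by (intro Bochner_Integration.integrable_diff Wk Bochner_Integration.integrable_mult_right ki)
      thus "integrable lborel (\<lambda>y. \<bar>(W (z - y) - W z) * k y\<bar>)" by (intro integrable_abs) (simp add: algebra_simps)
      show "integrable lborel (\<lambda>y. K * (norm y * k y))" by (intro Bochner_Integration.integrable_mult_right kni)
      show "\<bar>(W (z - y) - W z) * k y\<bar> \<le> K * (norm y * k y)" for y
        using lip[of "z - y" z] k0[of y] by (auto simp: abs_mult mult.assoc[symmetric] intro!: mult_right_mono)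
    qed
    also have "\<dots> \<le> K * \<epsilon>" using kn K by (simp add: mult_left_mono)
    finally show "\<bar>meval p (($) z) - W z\<bar> \<le> K * \<epsilon>" .
  next
    fix z v :: "real ^ 'v" and A C h0 :: real
    assume z: "norm z < r" and A: "A \<ge> 0" and h0: "h0 > 0"
      and H: "\<forall>y h. 0 < h \<longrightarrow> h < h0 \<longrightarrow> W (z - y + h *\<^sub>R v) - W (z - y) \<le> A * norm y * h + C * h\<^sup>2"
    let ?D = "\<Sum>i\<in>UNIV. v $ i * meval (mpartial i p) (($) z)"
    have "((\<lambda>h. meval p (\<lambda>i. z $ i + h * v $ i)) has_real_derivative (\<Sum>i\<in>UNIV. v $ i * meval (mpartial i p) (\<lambda>i. z $ i + 0 * v $ i))) (at 0)"
      by (rule meval_has_derivative_curve) (auto intro!: derivative_eq_intros)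
    moreover have "(\<lambda>i. z $ i + h * v $ i) = ($) (z + h *\<^sub>R v)" for h by (rule ext) simp
    ultimately have "((\<lambda>h. meval p (($) (z + h *\<^sub>R v))) has_real_derivative ?D) (at 0)" by simp
    hence "((\<lambda>h. (meval p (($) (z + h *\<^sub>R v)) - meval p (($) z)) / h) \<longlongrightarrow> ?D) (at 0)"
      unfolding has_field_derivative_iff by simp
    hence lim: "((\<lambda>h. (meval p (($) (z + h *\<^sub>R v)) - meval p (($) z)) / h) \<longlongrightarrow> ?D) (at_right 0)"
      by (rule tendsto_mono[rotated]) (simp add: at_within_le_at)
    have lim2: "((\<lambda>h. A * \<epsilon> + C * h) \<longlongrightarrow> A * \<epsilon> + C * 0) (at_right 0)" by (intro tendsto_intros)
    \<comment> \<open>Keeps z + h v in the ball of radius \<open>r\<close>, where \<open>p\<close>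
      is known to equal the convolution.\<close>
    define h1 where "h1 = min h0 ((r - norm z) / (norm v + 1))"
    have h1: "h1 > 0" using h0 z by (simp add: h1_def add_nonneg_pos)
    have "eventually (\<lambda>h. h \<in> {0<..<h1}) (at_right 0)" by (rule eventually_at_right_real[OF h1])
    hence "eventually (\<lambda>h. (meval p (($) (z + h *\<^sub>R v)) - meval p (($) z)) / h \<le> A * \<epsilon> + C * h) (at_right 0)"
    proof eventually_elim
      case (elim h)
      hence h: "0 < h" "h < h0" "h < (r - norm z) / (norm v + 1)" by (auto simp: h1_def)
      have "h * (norm v + 1) < r - norm z" using h(3) by (simp add: pos_less_divide_eq add_nonneg_pos)
      hence "norm z + h * norm v \<le> r" using h(1) by (simp add: algebra_simps)
      hence zh: "norm (z + h *\<^sub>R v) \<le> r" using norm_triangle_ineq[of z "h *\<^sub>R v"] h(1) by simp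
      have "meval p (($) (z + h *\<^sub>R v)) - meval p (($) z) = (LINT y|lborel. W (z + h *\<^sub>R v - y) * k y) - (LINT y|lborel. W (z - y) * k y)"
        using p[OF zh] p[of z] z by simp
      also have "\<dots> = (LINT y|lborel. W (z + h *\<^sub>R v - y) * k y - W (z - y) * k y)"
        by (rule Bochner_Integration.integral_diff[symmetric, OF Wk Wk])
      also have "\<dots> \<le> (LINT y|lborel. (A * h) * (norm y * k y) + (C * h\<^sup>2) * k y)"
      proof (rule integral_mono)
        show "integrable lborel (\<lambda>y. W (z + h *\<^sub>R v - y) * k y - W (z - y) * k y)" by (intro Bochner_Integration.integrable_diff Wk)
        show "integrable lborel (\<lambda>y. (A * h) * (norm y * k y) + (C * h\<^sup>2) * k y)" by (intro Bochner_Integration.integrable_add Bochner_Integration.integrable_mult_right kni ki)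
        fix y
        \<comment> \<open>Integrated against \<open>k\<close>, the term with |y| produces the first
          moment and the term with h^2 the total mass 1.\<close>
        have "W (z - y + h *\<^sub>R v) - W (z - y) \<le> A * norm y * h + C * h\<^sup>2" using H h by blast
        hence "(W (z - y + h *\<^sub>R v) - W (z - y)) * k y \<le> (A * norm y * h + C * h\<^sup>2) * k y" by (rule mult_right_mono[OF _ k0])
        moreover have "z - y + h *\<^sub>R v = z + h *\<^sub>R v - y" by simp
        ultimately show "W (z + h *\<^sub>R v - y) * k y - W (z - y) * k y \<le> (A * h) * (norm y * k y) + (C * h\<^sup>2) * k y"
          by (simp add: algebra_simps)
      qed
      also have "\<dots> = (A * h) * (LINT y|lborel. norm y * k y) + C * h\<^sup>2"
        using kni ki k1 by (subst Bochner_Integration.integral_add) auto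
      also have "\<dots> \<le> (A * h) * \<epsilon> + C * h\<^sup>2" using kn A h by (intro add_right_mono mult_left_mono) auto
      also have "\<dots> = (A * \<epsilon> + C * h) * h" by (simp add: power2_eq_square algebra_simps)
      finally show ?case using h(1) by (simp add: pos_divide_le_eq)
    qed
    from tendsto_le[OF _ lim2 lim this] show "?D \<le> A * \<epsilon>" by simp
  qed
qed

subsection \<open>Space-time points\<close>

text \<open>Space-time as a single Euclidean space indexed like R[x,t]: the kernel and Lebesgue
  measure apply directly, and the mollified polynomial already has the type required of
  \<psi>.\<close>

definition st_space :: "real ^ ('n::finite + unit) \<Rightarrow> real ^ 'n" where
  "st_space z = (\<chi> i. z $ Inl i)"

definition st_time :: "real ^ ('n::finite + unit) \<Rightarrow> real" where
  "st_time z = z $ Inr ()"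

definition st_point :: "real ^ 'n::finite \<Rightarrow> real \<Rightarrow> real ^ ('n + unit)" where
  "st_point x t = (\<chi> v. case_sum (\<lambda>i. x $ i) (\<lambda>_. t) v)"

lemma st_point_simps [simp]: "st_space (st_point x t) = x" "st_time (st_point x t) = t"
  by (simp_all add: st_space_def st_time_def st_point_def vec_eq_iff)

lemma st_point_nth [simp]: "st_point x t $ Inl i = x $ i" "st_point x t $ Inr j = t"
  by (simp_all add: st_point_def)

lemma st_linear:
  "st_space (y + z) = st_space y + st_space z" "st_space (y - z) = st_space y - st_space z" "st_space (c *\<^sub>R z) = c *\<^sub>R st_space z"
  "st_time (y + z) = st_time y + st_time z" "st_time (y - z) = st_time y - st_time z" "st_time (c *\<^sub>R z) = c * st_time z"
  by (simp_all add: st_space_def st_time_def vec_eq_iff)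

lemma sum_UNIV_sum_type: "(\<Sum>v\<in>(UNIV :: ('a::finite + 'b::finite) set). q v) = (\<Sum>a\<in>UNIV. q (Inl a)) + (\<Sum>b\<in>UNIV. q (Inr b))"
  using sum.Plus[of "UNIV :: 'a set" "UNIV :: 'b set" q] by (simp add: comp_def)

lemma norm_st: "(norm z)\<^sup>2 = (norm (st_space z))\<^sup>2 + (st_time z)\<^sup>2"
  by (simp add: power2_norm_vec sum_UNIV_sum_type st_space_def st_time_def UNIV_unit)

lemma norm_st_space_le: "norm (st_space z) \<le> norm z"
  by (rule power2_le_imp_le) (auto simp: norm_st)

lemma abs_st_time_le: "\<bar>st_time z\<bar> \<le> norm z"
  unfolding st_time_def by (rule component_le_norm_cart)

lemma norm_le_st: "norm z \<le> norm (st_space z) + \<bar>st_time z\<bar>"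
  by (rule power2_le_imp_le) (auto simp: norm_st power2_sum)

lemma eval_xt_conv_st: "eval_xt p x t = meval p (($) (st_point x t))"
proof -
  have "($) (st_point x t) = case_sum (\<lambda>i. x $ i) (\<lambda>_. t)" by (rule ext) (simp add: st_point_def)
  thus ?thesis by (simp add: eval_xt_def)
qed

lemma ball_set_iff: "x \<in> ball_set R \<longleftrightarrow> (norm x)\<^sup>2 \<le> R"
  by (simp add: ball_set_def power2_norm_vec)

subsection \<open>Smooth strict subsolutions near the value function\<close>

context reach_problem
begin

text \<open>The value function is continued in time beyond \<open>[0,T]\<close> with a slope steep enough to keep it
  decreasing along trajectories, and cut off in space-time; only \<open>W\<close> near \<open>\<parallel>z\<parallel> \<le> r\<close> matters.\<close>

lemma value_extension:
  assumes "r \<ge> 0"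
  shows "\<exists>W :: real ^ ('n + unit) \<Rightarrow> real. \<exists>K A C h0. K \<ge> 0 \<and> A \<ge> 0 \<and> h0 > 0 \<and>
    (\<forall>y z. \<bar>W y - W z\<bar> \<le> K * norm (y - z)) \<and> (\<forall>z. norm z > r + 3 \<longrightarrow> W z = 0) \<and>
    (\<forall>z. norm z \<le> r \<longrightarrow> st_time z \<in> {0..T} \<longrightarrow> W z = u (st_space z) (st_time z)) \<and>
    (\<forall>z d y h. norm z \<le> r \<longrightarrow> d \<in> D \<longrightarrow> 0 < h \<longrightarrow> h < h0 \<longrightarrow>
       W (z - y + h *\<^sub>R st_point (F (st_space z) d) 1) - W (z - y) \<le> A * norm y * h + C * h\<^sup>2)"
proof -
  \<comment> \<open>From |z| \<le> r a shift by |y| \<le> 1 and a step of length at most 1 lead no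
    further than r + 2, where the cutoff \<open>ct\<close> is still 1; it falls to 0 over the last
    unit.\<close>
  define \<rho> where "\<rho> = r + 3"
  have \<rho>: "\<rho> \<ge> 0" using assms by (simp add: \<rho>_def)
  obtain K where K: "K \<ge> 0" and K': "\<forall>x y t s. norm x \<le> \<rho> \<longrightarrow> norm y \<le> \<rho> \<longrightarrow> t \<in> {0..T} \<longrightarrow> s \<in> {0..T} \<longrightarrow>
    \<bar>u x t - u y s\<bar> \<le> K * (norm (x - y) + \<bar>t - s\<bar>)"
    using value_lipschitz[OF \<rho>] by (elim exE conjE)
  note Klip = K'[rule_format]
  obtain C where C: "C \<ge> 0" and C': "\<forall>x d t h. norm x \<le> \<rho> \<longrightarrow> d \<in> D \<longrightarrow> 0 \<le> t \<longrightarrow> 0 \<le> h \<longrightarrow> t + h \<le> T \<longrightarrow>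
    u (x + h *\<^sub>R F x d) (t + h) \<le> u x t + C * h\<^sup>2"
    using value_directional_decrease[OF \<rho>] by (elim exE conjE)
  note Cdec = C'[rule_format]
  obtain c0 where c0: "c0 \<ge> 0" "\<forall>d\<in>D. \<forall>x. norm (F x d) \<le> c0 + L * norm x" using F_growth by blast
  define M where "M = c0 + L * \<rho>"
  have M0: "M \<ge> 0" using c0(1) L_nonneg \<rho> by (simp add: M_def)
  have M: "norm (F x d) \<le> M" if "norm x \<le> \<rho>" "d \<in> D" for x d
    using c0(2)[rule_format, OF that(2), of x] mult_left_mono[OF that(1) L_nonneg] by (simp add: M_def)
  define cl where "cl s = max 0 (min T s)" for s :: real
  have cl: "cl s \<in> {0..T}" for s using T_pos by (auto simp: cl_def)
  have cl_lip: "\<bar>cl s - cl q\<bar> \<le> \<bar>s - q\<bar>" "\<bar>(s - cl s) - (q - cl q)\<bar> \<le> \<bar>s - q\<bar>" for s q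
    using T_pos by (auto simp: cl_def max_def min_def)
  have cl_mono: "cl s \<le> cl (s + h)" "cl (s + h) - cl s \<le> h" if "0 \<le> h" for s h
    using T_pos that by (auto simp: cl_def max_def min_def)
  \<comment> \<open>Outside [0,T] the clamped clock stands still while the state moves on, which can
    raise \<open>u\<close> at rate at most K M; the artificial slope in time pays for exactly
    this.\<close>
  define c1 where "c1 = K * M"
  have c1: "c1 \<ge> 0" using K M0 by (simp add: c1_def)
  define w where "w z = u (st_space z) (cl (st_time z)) - c1 * (st_time z - cl (st_time z))" for z
  define Kw where "Kw = 2 * K + c1"
  have Kw: "Kw \<ge> 0" using K c1 by (simp add: Kw_def)
  have wlip: "\<bar>w y - w z\<bar> \<le> Kw * norm (y - z)" if "norm y \<le> \<rho>" "norm z \<le> \<rho>" for y z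
  proof -
    have n: "norm (st_space y - st_space z) \<le> norm (y - z)" "\<bar>st_time y - st_time z\<bar> \<le> norm (y - z)"
      using norm_st_space_le[of "y - z"] abs_st_time_le[of "y - z"] by (simp_all add: st_linear)
    have "\<bar>u (st_space y) (cl (st_time y)) - u (st_space z) (cl (st_time z))\<bar> \<le> K * (norm (st_space y - st_space z) + \<bar>cl (st_time y) - cl (st_time z)\<bar>)"
      using that norm_st_space_le[of y] norm_st_space_le[of z] cl by (intro Klip) auto
    also have "\<dots> \<le> K * (norm (y - z) + norm (y - z))"
      using n cl_lip(1)[of "st_time y" "st_time z"] K by (intro mult_left_mono add_mono) auto
    finally have 1: "\<bar>u (st_space y) (cl (st_time y)) - u (st_space z) (cl (st_time z))\<bar> \<le> 2 * K * norm (y - z)" by simp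
    have "\<bar>c1 * (st_time y - cl (st_time y)) - c1 * (st_time z - cl (st_time z))\<bar> = c1 * \<bar>(st_time y - cl (st_time y)) - (st_time z - cl (st_time z))\<bar>"
      using c1 by (simp add: right_diff_distrib[symmetric] abs_mult)
    also have "\<dots> \<le> c1 * norm (y - z)" using n cl_lip(2)[of "st_time y" "st_time z"] c1 by (intro mult_left_mono) auto
    finally have 2: "\<bar>c1 * (st_time y - cl (st_time y)) - c1 * (st_time z - cl (st_time z))\<bar> \<le> c1 * norm (y - z)" .
    have "Kw * norm (y - z) = 2 * K * norm (y - z) + c1 * norm (y - z)" by (simp add: Kw_def algebra_simps)
    thus ?thesis using 1 2 unfolding w_def by linarith
  qed
  define Bw where "Bw = \<bar>w 0\<bar> + Kw * \<rho>"
  have Bw: "\<bar>w z\<bar> \<le> Bw" if "norm z \<le> \<rho>" for z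
    using wlip[OF that, of 0] \<rho> mult_left_mono[OF that Kw] by (simp add: Bw_def)
  have Bw0: "Bw \<ge> 0" using Kw \<rho> by (simp add: Bw_def)
  define ct where "ct z = max 0 (min 1 (\<rho> - norm z))" for z :: "real ^ ('n + unit)"
  have ct_lip: "\<bar>ct y - ct z\<bar> \<le> norm (y - z)" for y z
    using norm_triangle_ineq3[of y z] by (auto simp: ct_def max_def min_def)
  have ct01: "0 \<le> ct z" "ct z \<le> 1" for z by (auto simp: ct_def)
  have ct1: "ct z = 1" if "norm z \<le> r + 2" for z using that by (auto simp: ct_def \<rho>_def)
  have ct0: "ct z = 0" if "norm z > \<rho>" for z using that by (auto simp: ct_def)
  define W where "W z = ct z * w z" for z
  define KW where "KW = Kw + Bw"
  have KW: "KW \<ge> 0" using Kw Bw0 by (simp add: KW_def)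
  have half: "\<bar>W y - W z\<bar> \<le> KW * norm (y - z)" if y: "norm y \<le> \<rho>" for y z
  proof (cases "norm z \<le> \<rho>")
    case True
    have "W y - W z = ct y * (w y - w z) + (ct y - ct z) * w z" by (simp add: W_def algebra_simps)
    also have "\<bar>\<dots>\<bar> \<le> \<bar>ct y\<bar> * \<bar>w y - w z\<bar> + \<bar>ct y - ct z\<bar> * \<bar>w z\<bar>"
      by (rule order_trans[OF abs_triangle_ineq]) (simp add: abs_mult)
    also have "\<dots> \<le> 1 * (Kw * norm (y - z)) + norm (y - z) * Bw"
      using ct01[of y] wlip[OF y True] ct_lip[of y z] Bw[OF True] by (intro add_mono mult_mono) auto
    also have "\<dots> = KW * norm (y - z)" by (simp add: KW_def algebra_simps)
    finally show ?thesis .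
  next
    case False
    hence z: "ct z = 0" using ct0 by simp
    have "\<bar>W y - W z\<bar> = \<bar>ct y - ct z\<bar> * \<bar>w y\<bar>" by (simp add: W_def z abs_mult)
    also have "\<dots> \<le> norm (y - z) * Bw" using ct_lip[of y z] Bw[OF y] by (intro mult_mono) auto
    also have "\<dots> \<le> KW * norm (y - z)" using Kw by (simp add: KW_def algebra_simps)
    finally show ?thesis .
  qed
  have Wlip: "\<bar>W y - W z\<bar> \<le> KW * norm (y - z)" for y z
  proof (cases "norm y \<le> \<rho>")
    case False
    show ?thesis
    proof (cases "norm z \<le> \<rho>")
      case True
      thus ?thesis using half[of z y] by (simp add: norm_minus_commute abs_minus_commute)
    next
      case z: False
      thus ?thesis using False ct0[of y] ct0[of z] KW by (simp add: W_def)
    qed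
  qed (rule half)
  \<comment> \<open>K L measures the change of the field between z and z - y when |y| \<le> 1. For
    |y| > 1 the Lipschitz bound KW (M + 1) h suffices, since the factor |y| only enlarges the right
    side.\<close>
  define A where "A = K * L + KW * (M + 1)"
  \<comment> \<open>The velocity (F, 1) has norm at most M + 1, so steps below \<open>h0\<close>
    move by at most 1.\<close>
  define h0 where "h0 = 1 / (M + 1)"
  have h0: "h0 > 0" using M0 by (simp add: h0_def)
  have A0: "A \<ge> 0" using K L_nonneg KW M0 by (simp add: A_def)
  have dir: "W (z - y + h *\<^sub>R st_point (F (st_space z) d) 1) - W (z - y) \<le> A * norm y * h + C * h\<^sup>2"
    if z: "norm z \<le> r" and d: "d \<in> D" and h: "0 < h" "h < h0" for z d y h
  proof -
    define v where "v = st_point (F (st_space z) d) 1"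
    have Fz: "norm (F (st_space z) d) \<le> M" using z norm_st_space_le[of z] d by (intro M) (auto simp: \<rho>_def)
    have v: "norm v \<le> M + 1" using norm_le_st[of v] Fz by (simp add: v_def)
    have hM: "h * (M + 1) \<le> 1" using h M0 by (simp add: h0_def pos_less_divide_eq)
    have hv: "norm (h *\<^sub>R v) \<le> 1"
    proof -
      have "norm (h *\<^sub>R v) = h * norm v" using h by simp
      also have "\<dots> \<le> h * (M + 1)" using v h by (intro mult_left_mono) auto
      finally show ?thesis using hM by simp
    qed
    have "W (z - y + h *\<^sub>R v) - W (z - y) \<le> A * norm y * h + C * h\<^sup>2"
    proof (cases "norm y \<le> 1")
      case False
      have "W (z - y + h *\<^sub>R v) - W (z - y) \<le> KW * norm (h *\<^sub>R v)"
        using Wlip[of "z - y + h *\<^sub>R v" "z - y"] by simp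
      also have "\<dots> \<le> KW * (h * (M + 1))" using v h KW by (intro mult_left_mono) (auto intro!: mult_left_mono)
      also have "\<dots> = (KW * (M + 1)) * 1 * h" by simp
      also have "\<dots> \<le> A * norm y * h"
        using False KW M0 K L_nonneg h by (intro mult_right_mono mult_mono) (auto simp: A_def)
      also have "\<dots> \<le> A * norm y * h + C * h\<^sup>2" using C by simp
      finally show ?thesis .
    next
      case True
      define z' where "z' = z - y"
      define x' where "x' = st_space z'"
      define t' where "t' = st_time z'"
      have nz': "norm z' \<le> r + 1" unfolding z'_def using norm_triangle_ineq4[of z y] z True by simp
      have nzv: "norm (z' + h *\<^sub>R v) \<le> r + 2" using norm_triangle_ineq[of z' "h *\<^sub>R v"] nz' hv by simp
      have W1: "W z' = w z'" "W (z' + h *\<^sub>R v) = w (z' + h *\<^sub>R v)" using ct1 nz' nzv by (auto simp: W_def)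
      have nx': "norm x' \<le> r + 1" using norm_st_space_le[of z'] nz' by (simp add: x'_def)
      have Fx': "norm (F x' d) \<le> M" using nx' d by (intro M) (auto simp: \<rho>_def)
      define \<tau> where "\<tau> = cl t'"
      \<comment> \<open>The time that really elapses on the clamped clock. Then \<open>s1\<close>
        replaces the field at z by the field at the shifted point, \<open>s2\<close> shortens the
        step from h to \<eta> at the cost that \<open>c1\<close> compensates, and \<open>s3\<close>
        is the Euler estimate for the step \<eta>.\<close>
      define \<eta> where "\<eta> = cl (t' + h) - cl t'"
      have \<eta>: "0 \<le> \<eta>" "\<eta> \<le> h" using cl_mono[of h t'] h by (auto simp: \<eta>_def)
      have \<tau>: "0 \<le> \<tau>" "\<tau> + \<eta> \<le> T" "\<tau> \<in> {0..T}" "\<tau> + \<eta> \<in> {0..T}" using cl[of t'] cl[of "t' + h"] by (auto simp: \<tau>_def \<eta>_def)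
      have nF: "norm (x' + s *\<^sub>R q) \<le> \<rho>" if "0 \<le> s" "s \<le> h" "norm q \<le> M" for s q
      proof -
        have "norm (x' + s *\<^sub>R q) \<le> norm x' + s * norm q" using that by (intro order_trans[OF norm_triangle_ineq]) simp
        also have "s * norm q \<le> h * (M + 1)" using that M0 h by (intro mult_mono) auto
        finally show ?thesis using nx' hM by (simp add: \<rho>_def)
      qed
      have s1: "u (x' + h *\<^sub>R F (st_space z) d) (\<tau> + \<eta>) \<le> u (x' + h *\<^sub>R F x' d) (\<tau> + \<eta>) + K * L * norm y * h"
      proof -
        have "\<bar>u (x' + h *\<^sub>R F (st_space z) d) (\<tau> + \<eta>) - u (x' + h *\<^sub>R F x' d) (\<tau> + \<eta>)\<bar>
            \<le> K * (norm ((x' + h *\<^sub>R F (st_space z) d) - (x' + h *\<^sub>R F x' d)) + \<bar>(\<tau> + \<eta>) - (\<tau> + \<eta>)\<bar>)"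
          using h Fz Fx' \<tau>(4) by (intro Klip nF) auto
        also have "(x' + h *\<^sub>R F (st_space z) d) - (x' + h *\<^sub>R F x' d) = h *\<^sub>R (F (st_space z) d - F x' d)" by (simp add: algebra_simps)
        also have "norm (h *\<^sub>R (F (st_space z) d - F x' d)) \<le> h * (L * norm y)"
        proof -
          have "norm (F (st_space z) d - F x' d) \<le> L * norm (st_space z - x')" by (rule F_lipschitz[OF d])
          also have "st_space z - x' = st_space y" by (simp add: x'_def z'_def st_linear)
          also have "L * norm (st_space y) \<le> L * norm y" using norm_st_space_le L_nonneg by (intro mult_left_mono) auto
          finally show ?thesis using h by (simp add: mult_left_mono)
        qed
        finally have "\<bar>u (x' + h *\<^sub>R F (st_space z) d) (\<tau> + \<eta>) - u (x' + h *\<^sub>R F x' d) (\<tau> + \<eta>)\<bar> \<le> K * (h * (L * norm y))"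
          using K by (simp add: mult_left_mono)
        moreover have "K * (h * (L * norm y)) = K * L * norm y * h" by simp
        ultimately show ?thesis by linarith
      qed
      have s2: "u (x' + h *\<^sub>R F x' d) (\<tau> + \<eta>) \<le> u (x' + \<eta> *\<^sub>R F x' d) (\<tau> + \<eta>) + c1 * (h - \<eta>)"
      proof -
        have "\<bar>u (x' + h *\<^sub>R F x' d) (\<tau> + \<eta>) - u (x' + \<eta> *\<^sub>R F x' d) (\<tau> + \<eta>)\<bar>
            \<le> K * (norm ((x' + h *\<^sub>R F x' d) - (x' + \<eta> *\<^sub>R F x' d)) + \<bar>(\<tau> + \<eta>) - (\<tau> + \<eta>)\<bar>)"
          using h Fx' \<tau>(4) \<eta> by (intro Klip nF) auto
        also have "(x' + h *\<^sub>R F x' d) - (x' + \<eta> *\<^sub>R F x' d) = (h - \<eta>) *\<^sub>R F x' d" by (simp add: algebra_simps)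
        also have "norm ((h - \<eta>) *\<^sub>R F x' d) \<le> (h - \<eta>) * M" using \<eta> Fx' by (simp add: mult_left_mono)
        finally have "\<bar>u (x' + h *\<^sub>R F x' d) (\<tau> + \<eta>) - u (x' + \<eta> *\<^sub>R F x' d) (\<tau> + \<eta>)\<bar> \<le> K * ((h - \<eta>) * M)"
          using K by (simp add: mult_left_mono)
        moreover have "K * ((h - \<eta>) * M) = c1 * (h - \<eta>)" by (simp add: c1_def)
        ultimately show ?thesis by linarith
      qed
      have s3: "u (x' + \<eta> *\<^sub>R F x' d) (\<tau> + \<eta>) \<le> u x' \<tau> + C * \<eta>\<^sup>2"
        using nx' d \<tau> \<eta> by (intro Cdec) (auto simp: \<rho>_def)
      have s4: "C * \<eta>\<^sup>2 \<le> C * h\<^sup>2" using C \<eta> by (intro mult_left_mono power_mono) auto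
      have e1: "w (z' + h *\<^sub>R v) = u (x' + h *\<^sub>R F (st_space z) d) (\<tau> + \<eta>) - c1 * (t' + h - (\<tau> + \<eta>))"
        unfolding w_def by (simp add: st_linear v_def x'_def t'_def \<tau>_def \<eta>_def)
      have e2: "w z' = u x' \<tau> - c1 * (t' - \<tau>)" unfolding w_def by (simp add: x'_def t'_def \<tau>_def)
      have "w (z' + h *\<^sub>R v) - w z' = u (x' + h *\<^sub>R F (st_space z) d) (\<tau> + \<eta>) - u x' \<tau> - c1 * (h - \<eta>)"
        unfolding e1 e2 by (simp add: algebra_simps)
      also have "\<dots> \<le> K * L * norm y * h + C * h\<^sup>2" using s1 s2 s3 s4 by linarith
      also have "K * L * norm y * h \<le> A * norm y * h"
        using KW M0 h by (intro mult_right_mono) (auto simp: A_def)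
      finally show ?thesis using W1 unfolding z'_def by simp
    qed
    thus ?thesis unfolding v_def .
  qed
  have Wu: "W z = u (st_space z) (st_time z)" if "norm z \<le> r" "st_time z \<in> {0..T}" for z
  proof -
    have "cl (st_time z) = st_time z" using that by (auto simp: cl_def)
    thus ?thesis using ct1[of z] that by (simp add: W_def w_def)
  qed
  have Wout: "W z = 0" if "norm z > r + 3" for z using ct0[of z] that by (simp add: W_def \<rho>_def)
  show ?thesis
    by (rule exI[of _ W], rule exI[of _ KW], rule exI[of _ A], rule exI[of _ C], rule exI[of _ h0])
       (intro conjI allI impI KW A0 h0 Wlip Wout Wu dir)
qed

text \<open>Two corrections are added to the mollification: slope -(A + 1) \<epsilon> in time beats
  the derivative defect A \<epsilon>, and the constant (K + 1) \<epsilon> beats the approximation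
  error K \<epsilon>.\<close>

theorem strict_polynomial_subsolution:
  assumes R: "R > 0" and \<eta>: "\<eta> > 0"
  shows "\<exists>\<psi> :: ('n + unit) mpoly.
    (\<forall>x\<in>ball_set R. \<forall>t\<in>{0..T}. \<bar>eval_xt \<psi> x t - u x t\<bar> \<le> \<eta>) \<and>
    (\<forall>x\<in>ball_set R. \<forall>t\<in>{0..T}. \<forall>d\<in>D. eval_xt (mpartial (Inr ()) \<psi>) x t + (\<Sum>i\<in>UNIV. eval_xt (mpartial (Inl i) \<psi>) x t * F x d $ i) < 0) \<and>
    (\<forall>x\<in>ball_set R. \<forall>t\<in>{0..T}. u x t < eval_xt \<psi> x t)"
proof -
  \<comment> \<open>Bounds the norm of (x,t); \<open>R\<close> is the square of the radius of the
    ball.\<close>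
  define r where "r = sqrt R + T"
  have r: "r \<ge> 0" using R T_pos by (simp add: r_def)
  obtain W :: "real ^ ('n + unit) \<Rightarrow> real" and K A C h0 where K: "K \<ge> 0" and A: "A \<ge> 0" and h0: "h0 > 0"
    and lip: "\<forall>y z. \<bar>W y - W z\<bar> \<le> K * norm (y - z)" and out: "\<forall>z. norm z > r + 3 \<longrightarrow> W z = 0"
    and Wu: "\<forall>z. norm z \<le> r \<longrightarrow> st_time z \<in> {0..T} \<longrightarrow> W z = u (st_space z) (st_time z)"
    and dir: "\<forall>z d y h. norm z \<le> r \<longrightarrow> d \<in> D \<longrightarrow> 0 < h \<longrightarrow> h < h0 \<longrightarrow>
       W (z - y + h *\<^sub>R st_point (F (st_space z) d) 1) - W (z - y) \<le> A * norm y * h + C * h\<^sup>2"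
    using value_extension[OF r] by (elim exE conjE)
  \<comment> \<open>The total deviation K \<epsilon> + a T + b equals S \<epsilon>, so \<epsilon> =
    \<eta> / S.\<close>
  define S where "S = 2 * K + 1 + (A + 1) * T"
  have S: "S > 0" using K A T_pos by (simp add: S_def add_nonneg_pos add_pos_nonneg)
  define \<epsilon> where "\<epsilon> = \<eta> / S"
  have \<epsilon>: "\<epsilon> > 0" using \<eta> S by (simp add: \<epsilon>_def)
  have r3: "r + 3 > 0" using r by simp
  obtain p where p1: "\<forall>z. norm z \<le> r + 3 \<longrightarrow> \<bar>meval p (($) z) - W z\<bar> \<le> K * \<epsilon>"
    and p2: "\<forall>z v A C h0. norm z < r + 3 \<longrightarrow> A \<ge> 0 \<longrightarrow> h0 > 0 \<longrightarrow>
      (\<forall>y h. 0 < h \<longrightarrow> h < h0 \<longrightarrow> W (z - y + h *\<^sub>R v) - W (z - y) \<le> A * norm y * h + C * h\<^sup>2) \<longrightarrow>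
      (\<Sum>i\<in>UNIV. v $ i * meval (mpartial i p) (($) z)) \<le> A * \<epsilon>"
    using polynomial_mollification[of W K "r + 3", OF lip[rule_format] out r3 K \<epsilon>] by (elim exE conjE)
  define a where "a = (A + 1) * \<epsilon>"
  define b where "b = (K + 1) * \<epsilon>"
  define \<psi> where "\<psi> = p + Poly_Mapping.single 0 (a * T + b) + Poly_Mapping.single (Poly_Mapping.single (Inr ()) 1) (- a)"
  have ev: "eval_xt \<psi> x t = eval_xt p x t + a * (T - t) + b" for x t
    unfolding eval_xt_def by (simp add: \<psi>_def algebra_simps)
  have d1: "eval_xt (mpartial (Inr ()) \<psi>) x t = eval_xt (mpartial (Inr ()) p) x t - a" for x t
    unfolding eval_xt_def by (simp add: \<psi>_def)
  have d2: "eval_xt (mpartial (Inl i) \<psi>) x t = eval_xt (mpartial (Inl i) p) x t" for x t i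
    unfolding eval_xt_def by (simp add: \<psi>_def lookup_single)
  have nz: "norm (st_point x t) \<le> r" if "x \<in> ball_set R" "t \<in> {0..T}" for x t
  proof -
    have "norm x \<le> sqrt R" using that(1) by (simp add: ball_set_iff real_le_rsqrt)
    thus ?thesis using norm_le_st[of "st_point x t"] that(2) by (simp add: r_def)
  qed
  have close: "\<bar>eval_xt p x t - u x t\<bar> \<le> K * \<epsilon>" if xt: "x \<in> ball_set R" "t \<in> {0..T}" for x t
    using p1[rule_format, of "st_point x t"] Wu[rule_format, of "st_point x t"] nz[OF xt] xt(2)
    by (simp add: eval_xt_conv_st)
  show ?thesis
  proof (intro exI[of _ \<psi>] conjI ballI)
    fix x :: "real ^ 'n" and t assume xt: "x \<in> ball_set R" "t \<in> {0..T}"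
    have at: "0 \<le> a * (T - t)" "a * (T - t) \<le> a * T" using xt A \<epsilon> by (auto simp: a_def intro!: mult_left_mono)
    have b: "b = K * \<epsilon> + \<epsilon>" by (simp add: b_def algebra_simps)
    have "K * \<epsilon> + (a * T + b) = S * \<epsilon>" by (simp add: a_def b_def S_def algebra_simps)
    hence tot: "K * \<epsilon> + (a * T + b) = \<eta>" using S by (simp add: \<epsilon>_def)
    show "\<bar>eval_xt \<psi> x t - u x t\<bar> \<le> \<eta>"
      using close[OF xt] at tot b \<epsilon> mult_nonneg_nonneg[OF K less_imp_le[OF \<epsilon>]] unfolding ev by linarith
    show "u x t < eval_xt \<psi> x t" using close[OF xt] at b \<epsilon> unfolding ev by linarith
    fix d assume d: "d \<in> D"
    let ?v = "st_point (F x d) 1"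
    have "(\<Sum>i\<in>UNIV. ?v $ i * meval (mpartial i p) (($) (st_point x t))) \<le> A * \<epsilon>"
    proof (rule p2[rule_format, OF _ A h0])
      show "norm (st_point x t) < r + 3" using nz[OF xt] by simp
      show "W (st_point x t - y + h *\<^sub>R ?v) - W (st_point x t - y) \<le> A * norm y * h + C * h\<^sup>2" if "0 < h" "h < h0" for y h
        using dir[rule_format, OF nz[OF xt] d that, of y] by simp
    qed
    also have "A * \<epsilon> < a" using \<epsilon> by (simp add: a_def algebra_simps)
    finally have "(\<Sum>i\<in>UNIV. ?v $ i * meval (mpartial i p) (($) (st_point x t))) < a" .
    hence "(\<Sum>i\<in>UNIV. F x d $ i * eval_xt (mpartial (Inl i) p) x t) + eval_xt (mpartial (Inr ()) p) x t < a"
      by (simp add: sum_UNIV_sum_type UNIV_unit eval_xt_conv_st)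
    thus "eval_xt (mpartial (Inr ()) \<psi>) x t + (\<Sum>i\<in>UNIV. eval_xt (mpartial (Inl i) \<psi>) x t * F x d $ i) < 0"
      unfolding d1 d2 by (simp add: mult.commute)
  qed
qed

end

subsection \<open>Sum-of-squares certificates\<close>

definition generated_module :: "'i set \<Rightarrow> ('i \<Rightarrow> 'v mpoly) \<Rightarrow> 'v mpoly set" where
  "generated_module I G = {s0 + (\<Sum>i\<in>I. s i * G i) | s0 s. is_sos s0 \<and> (\<forall>i\<in>I. is_sos (s i))}"

lemma generated_moduleI:
  "p = s0 + (\<Sum>i\<in>I. s i * G i) \<Longrightarrow> is_sos s0 \<Longrightarrow> (\<And>i. i \<in> I \<Longrightarrow> is_sos (s i)) \<Longrightarrow> p \<in> generated_module I G"
  unfolding generated_module_def by blast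

lemma quadratic_module_generated:
  fixes G :: "'i \<Rightarrow> 'v::finite mpoly"
  shows "quadratic_module (generated_module I G)"
  unfolding quadratic_module_def
proof (intro conjI allI ballI impI)
  fix p :: "'v mpoly" assume "is_sos p"
  thus "p \<in> generated_module I G" by (intro generated_moduleI[where s = "\<lambda>_. 0"]) (simp_all add: is_sos_0)
next
  fix p q assume "p \<in> generated_module I G" "q \<in> generated_module I G"
  then obtain s0 s t0 t where *: "p = s0 + (\<Sum>i\<in>I. s i * G i)" "q = t0 + (\<Sum>i\<in>I. t i * G i)"
    "is_sos s0" "is_sos t0" "\<forall>i\<in>I. is_sos (s i)" "\<forall>i\<in>I. is_sos (t i)" by (auto simp: generated_module_def)
  have "p + q = (s0 + t0) + (\<Sum>i\<in>I. (s i + t i) * G i)" by (simp add: * sum.distrib distrib_right)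
  thus "p + q \<in> generated_module I G" by (rule generated_moduleI) (use * in \<open>auto intro: is_sos_add\<close>)
next
  fix s p :: "'v mpoly" assume "p \<in> generated_module I G" and s: "is_sos s"
  then obtain s0 t where *: "p = s0 + (\<Sum>i\<in>I. t i * G i)" "is_sos s0" "\<forall>i\<in>I. is_sos (t i)" by (auto simp: generated_module_def)
  have "s * p = s * s0 + (\<Sum>i\<in>I. (s * t i) * G i)" by (simp add: * distrib_left sum_distrib_left mult.assoc)
  thus "s * p \<in> generated_module I G" by (rule generated_moduleI) (use * s in \<open>auto intro: is_sos_mult\<close>)
qed

lemma generator_in_module:
  fixes G :: "'i \<Rightarrow> 'v::finite mpoly"
  assumes "finite I" "i \<in> I"
  shows "G i \<in> generated_module I G"
proof -
  have "(\<Sum>j\<in>I. (if j = i then 1 else 0) * G j) = (\<Sum>j\<in>I. if j = i then G j else 0)"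
    by (intro sum.cong) auto
  hence "G i = 0 + (\<Sum>j\<in>I. (if j = i then 1 else 0) * G j)" using assms by simp
  thus ?thesis
  proof (rule generated_moduleI)
    show "is_sos (if j = i then 1 else 0 :: 'v mpoly)" for j
      using is_sos_square[of "1 :: 'v mpoly"] by (simp add: is_sos_0)
  qed (rule is_sos_0)
qed

lemma mconst_mult_in_module:
  assumes "quadratic_module M" "p \<in> M" "c \<ge> 0"
  shows "mconst c * p \<in> (M :: 'v::finite mpoly set)"
  using assms is_sos_mconst[OF assms(3)] unfolding quadratic_module_def by blast

lemma module_add: "quadratic_module M \<Longrightarrow> p \<in> M \<Longrightarrow> q \<in> M \<Longrightarrow> p + q \<in> M"
  unfolding quadratic_module_def by blast

lemma module_square: "quadratic_module M \<Longrightarrow> p ^ 2 \<in> M"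
  unfolding quadratic_module_def using is_sos_square by blast

text \<open>Here the only constraint is the ball polynomial, which is its own archimedean
  witness.\<close>

lemma target_certificate:
  fixes q :: "'n::finite mpoly"
  assumes R: "R > 0" and pos: "\<And>x. x \<in> ball_set R \<Longrightarrow> meval q (($) x) > 0"
  shows "\<exists>s6 s7. is_sos s6 \<and> is_sos s7 \<and> q = s6 + s7 * ball_poly R"
proof -
  let ?G = "\<lambda>_ :: nat. ball_poly R :: 'n mpoly"
  have "q \<in> generated_module {0} ?G"
  proof (rule putinar[OF quadratic_module_generated _ R, where g = ?G and I = "{0}"])
    show "ball_poly R \<in> generated_module {0} ?G" by (rule generator_in_module) auto
    fix a :: "'n \<Rightarrow> real" assume "\<And>i. i \<in> {0 :: nat} \<Longrightarrow> meval (ball_poly R) a \<ge> 0"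
    hence "(\<chi> i. a i) \<in> ball_set R" by (auto simp: ball_set_def)
    moreover have "($) (\<chi> i. a i) = a" by (rule ext) simp
    ultimately show "meval q a > 0" using pos by metis
  qed (auto intro: generator_in_module)
  thus ?thesis by (auto simp: generated_module_def)
qed

lemma time_interval_iff: "t * (T - t) \<ge> 0 \<longleftrightarrow> t \<in> {0..T}" if "T > 0" for t T :: real
  using that by (auto simp: zero_le_mult_iff)

lemma state_certificate:
  fixes q :: "('n::finite + unit) mpoly"
  assumes R: "R > 0" and T: "T > 0" and pos: "\<And>x t. x \<in> ball_set R \<Longrightarrow> t \<in> {0..T} \<Longrightarrow> eval_xt q x t > 0"
  shows "\<exists>s3 s4 s5. is_sos s3 \<and> is_sos s4 \<and> is_sos s5 \<and> q = s3 + s4 * mrename Inl (ball_poly R) + s5 * time_poly T"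
proof -
  define G where "G i = (if i = 0 then mrename Inl (ball_poly R) else time_poly T :: ('n + unit) mpoly)" for i :: nat
  let ?M = "generated_module {0, 1} G"
  note M = quadratic_module_generated[of "{0, 1}" G]
  have G01: "G 0 \<in> ?M" "G 1 \<in> ?M" by (rule generator_in_module; simp)+
  \<comment> \<open>The time generator bounds t because T^2 - t^2 = 2 t (T - t) + (T - t)^2.\<close>
  have "ball_poly (R + T\<^sup>2) = G 0 + (mconst 2 * G 1 + (mconst T - mvar (Inr ())) ^ 2)"
    by (rule mpoly_eqI) (simp add: G_def sum_UNIV_sum_type UNIV_unit, simp add: power2_eq_square algebra_simps)
  also have "\<dots> \<in> ?M"
    by (intro module_add[OF M] mconst_mult_in_module[OF M] module_square[OF M] G01) auto
  finally have arch: "ball_poly (R + T\<^sup>2) \<in> ?M" .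
  have N: "R + T\<^sup>2 > 0" using R by (simp add: add_pos_nonneg)
  have "q \<in> ?M"
  proof (rule putinar[OF M arch N, where g = G and I = "{0, 1}"])
    fix a :: "'n + unit \<Rightarrow> real" assume a: "\<And>i. i \<in> {0, 1} \<Longrightarrow> meval (G i) a \<ge> 0"
    define x :: "real ^ 'n" where "x = (\<chi> i. a (Inl i))"
    have "x \<in> ball_set R" using a[of 0] by (simp add: G_def ball_set_def x_def)
    moreover have "a (Inr ()) \<in> {0..T}" using a[of 1] time_interval_iff[OF T] by (simp add: G_def)
    moreover have "case_sum (($) x) (\<lambda>_. a (Inr ())) = a" by (rule ext) (simp add: x_def split: sum.split)
    ultimately show "meval q a > 0" using pos[of x "a (Inr ())"] by (simp add: eval_xt_def)
  qed (use G01 in auto)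
  then obtain s0 s where "q = s0 + (\<Sum>i\<in>{0, 1}. s i * G i)" "is_sos s0" "\<forall>i\<in>{0, 1}. is_sos (s i)"
    unfolding generated_module_def by blast
  thus ?thesis by (intro exI[of _ s0] exI[of _ "s 0"] exI[of _ "s 1"]) (simp add: G_def add.assoc)
qed

lemma dynamics_certificate:
  fixes q :: "(('n::finite + unit) + 'm::finite) mpoly" and h :: "nat \<Rightarrow> 'm mpoly"
  assumes R: "R > 0" and T: "T > 0" and RD: "RD \<ge> 0" "k \<in> {1..nD}" "h k = ball_poly RD"
    and pos: "\<And>x t d. x \<in> ball_set R \<Longrightarrow> t \<in> {0..T} \<Longrightarrow> d \<in> disturbance_set nD h \<Longrightarrow>
      meval q (case_sum (case_sum (($) x) (\<lambda>_. t)) (($) d)) > 0"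
  shows "\<exists>s0 s1 s2 s'. is_sos s0 \<and> is_sos s1 \<and> is_sos s2 \<and> (\<forall>r\<in>{1..nD}. is_sos (s' r)) \<and>
    q = s0 + s1 * mrename (Inl \<circ> Inl) (ball_poly R) + s2 * mrename Inl (time_poly T) + (\<Sum>r\<in>{1..nD}. s' r * mrename Inr (h r))"
proof -
  define G :: "nat + bool \<Rightarrow> (('n + unit) + 'm) mpoly" where
    "G = case_sum (\<lambda>r. mrename Inr (h r)) (\<lambda>b. if b then mrename (Inl \<circ> Inl) (ball_poly R) else mrename Inl (time_poly T))"
  define I where "I = Inl ` {1..nD} \<union> (Inr ` UNIV :: (nat + bool) set)"
  have fin: "finite I" by (simp add: I_def)
  have inI: "Inr b \<in> I" "r \<in> {1..nD} \<Longrightarrow> Inl r \<in> I" for b r by (auto simp: I_def)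
  let ?M = "generated_module I G"
  note M = quadratic_module_generated[of I G]
  have GI: "G i \<in> ?M" if "i \<in> I" for i by (rule generator_in_module[OF fin that])
  have GM: "G (Inl k) \<in> ?M" "G (Inr True) \<in> ?M" "G (Inr False) \<in> ?M" by (rule GI; use RD(2) in \<open>simp add: inI\<close>)+
  \<comment> \<open>The same identity for t, with the generator RD - |d|^2 added; this is where the
    assumption on the disturbance constraints makes the module archimedean.\<close>
  have "ball_poly (R + T\<^sup>2 + RD) = G (Inr True) + (mconst 2 * G (Inr False) + ((mconst T - mvar (Inl (Inr ()))) ^ 2 + G (Inl k)))"
    by (rule mpoly_eqI) (simp add: G_def RD(3) sum_UNIV_sum_type UNIV_unit, simp add: power2_eq_square algebra_simps)
  also have "\<dots> \<in> ?M"
    by (intro module_add[OF M] mconst_mult_in_module[OF M] module_square[OF M] GM) auto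
  finally have arch: "ball_poly (R + T\<^sup>2 + RD) \<in> ?M" .
  have N: "R + T\<^sup>2 + RD > 0" using R RD by (simp add: add_pos_nonneg)
  have "q \<in> ?M"
  proof (rule putinar[OF M arch N fin GI])
    fix a :: "('n + unit) + 'm \<Rightarrow> real" assume a: "\<And>i. i \<in> I \<Longrightarrow> meval (G i) a \<ge> 0"
    define x :: "real ^ 'n" where "x = (\<chi> i. a (Inl (Inl i)))"
    define d :: "real ^ 'm" where "d = (\<chi> j. a (Inr j))"
    define t where "t = a (Inl (Inr ()))"
    have "x \<in> ball_set R" using a[OF inI(1), of True] by (simp add: G_def ball_set_def x_def)
    moreover have "t \<in> {0..T}" using a[OF inI(1), of False] time_interval_iff[OF T] by (simp add: G_def t_def)
    moreover have "d \<in> disturbance_set nD h"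
      unfolding disturbance_set_def
    proof (intro CollectI ballI)
      fix i assume "i \<in> {1..nD}"
      from a[OF inI(2)[OF this]] show "meval (h i) (\<lambda>j. d $ j) \<ge> 0" by (simp add: G_def d_def)
    qed
    moreover have "case_sum (case_sum (($) x) (\<lambda>_. t)) (($) d) = a"
      by (rule ext) (simp add: x_def d_def t_def split: sum.split)
    ultimately show "meval q a > 0" using pos[of x t d] by simp
  qed
  then obtain s0 s where s: "q = s0 + (\<Sum>i\<in>I. s i * G i)" "is_sos s0" "\<forall>i\<in>I. is_sos (s i)"
    unfolding generated_module_def by blast
  have "(\<Sum>i\<in>I. s i * G i) = (\<Sum>i\<in>Inl ` {1..nD}. s i * G i) + (\<Sum>i\<in>Inr ` UNIV. s i * G i)"
    unfolding I_def by (rule sum.union_disjoint) auto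
  also have "(\<Sum>i\<in>Inl ` {1..nD}. s i * G i) = (\<Sum>r\<in>{1..nD}. s (Inl r) * mrename Inr (h r))"
    by (subst sum.reindex) (auto simp: G_def)
  also have "(\<Sum>i\<in>Inr ` UNIV. s i * G i) = s (Inr True) * mrename (Inl \<circ> Inl) (ball_poly R) + s (Inr False) * mrename Inl (time_poly T)"
    by (subst sum.reindex) (auto simp: G_def UNIV_bool)
  finally have "q = s0 + s (Inr True) * mrename (Inl \<circ> Inl) (ball_poly R) + s (Inr False) * mrename Inl (time_poly T)
    + (\<Sum>r\<in>{1..nD}. s (Inl r) * mrename Inr (h r))" using s(1) by (simp add: algebra_simps)
  thus ?thesis using s(2,3)
    by (intro exI[of _ s0] exI[of _ "s (Inr True)"] exI[of _ "s (Inr False)"] exI[of _ "\<lambda>r. s (Inl r)"]) (auto simp: inI)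
qed

lemma sos_constraints_of_strict_subsolution:
  fixes f :: "'n::finite \<Rightarrow> ('n + 'm::finite) mpoly" and \<psi> :: "('n + unit) mpoly"
  assumes R: "R > 0" and T: "T > 0" and RD: "RD \<ge> 0" "k \<in> {1..nD}" "h k = ball_poly RD"
    and dyn: "\<And>x t d. x \<in> ball_set R \<Longrightarrow> t \<in> {0..T} \<Longrightarrow> d \<in> disturbance_set nD h \<Longrightarrow>
      eval_xt (mpartial (Inr ()) \<psi>) x t + (\<Sum>i\<in>UNIV. eval_xt (mpartial (Inl i) \<psi>) x t * eval_xd (f i) x d) < 0"
    and state: "\<And>x t i. x \<in> ball_set R \<Longrightarrow> t \<in> {0..T} \<Longrightarrow> i \<in> {1..nX} \<Longrightarrow> eval_xt (g i) x t < eval_xt \<psi> x t"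
    and target: "\<And>x j. x \<in> ball_set R \<Longrightarrow> j \<in> {1..nTR} \<Longrightarrow> meval (l j) (($) x) < eval_xt \<psi> x T"
  shows "sos_constraints f nD h nX g nTR l R T \<psi>"
proof -
  let ?q = "- (mrename Inl (mpartial (Inr ()) \<psi>) + (\<Sum>i\<in>UNIV. mrename Inl (mpartial (Inl i) \<psi>) * mrename (map_sum Inl id) (f i)))
    :: (('n + unit) + 'm) mpoly"
  have "\<exists>s0 s1 s2 s'. is_sos s0 \<and> is_sos s1 \<and> is_sos s2 \<and> (\<forall>r\<in>{1..nD}. is_sos (s' r)) \<and>
    ?q = s0 + s1 * mrename (Inl \<circ> Inl) (ball_poly R) + s2 * mrename Inl (time_poly T) + (\<Sum>r\<in>{1..nD}. s' r * mrename Inr (h r))"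
  proof (rule dynamics_certificate[where h = h and k = k, OF R T RD])
    fix x :: "real ^ 'n" and t and d :: "real ^ 'm"
    assume xtd: "x \<in> ball_set R" "t \<in> {0..T}" "d \<in> disturbance_set nD h"
    let ?a = "case_sum (case_sum (($) x) (\<lambda>_. t)) (($) d) :: ('n + unit) + 'm \<Rightarrow> real"
    have "(\<lambda>v. ?a (map_sum Inl id v)) = case_sum (($) x) (($) d)" by (rule ext) (simp split: sum.split)
    hence "meval ?q ?a = - (eval_xt (mpartial (Inr ()) \<psi>) x t + (\<Sum>i\<in>UNIV. eval_xt (mpartial (Inl i) \<psi>) x t * eval_xd (f i) x d))"
      by (simp add: eval_xt_def eval_xd_def)
    thus "meval ?q ?a > 0" using dyn[OF xtd] by linarith
  qed
  then obtain s0 s1 s2 s' where S: "is_sos s0" "is_sos s1" "is_sos s2" "\<forall>r\<in>{1..nD}. is_sos (s' r)"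
    "?q = s0 + s1 * mrename (Inl \<circ> Inl) (ball_poly R) + s2 * mrename Inl (time_poly T) + (\<Sum>r\<in>{1..nD}. s' r * mrename Inr (h r))"
    by (elim exE conjE)
  have "\<forall>i\<in>{1..nX}. \<exists>s3 s4 s5. is_sos s3 \<and> is_sos s4 \<and> is_sos s5 \<and> \<psi> - g i = s3 + s4 * mrename Inl (ball_poly R) + s5 * time_poly T"
  proof
    fix i assume i: "i \<in> {1..nX}"
    show "\<exists>s3 s4 s5. is_sos s3 \<and> is_sos s4 \<and> is_sos s5 \<and> \<psi> - g i = s3 + s4 * mrename Inl (ball_poly R) + s5 * time_poly T"
      by (rule state_certificate[OF R T]) (use state[OF _ _ i] in \<open>simp add: eval_xt_def\<close>)
  qed
  then obtain s3 s4 s5 where S2: "\<forall>i\<in>{1..nX}. is_sos (s3 i) \<and> is_sos (s4 i) \<and> is_sos (s5 i) \<and>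
      \<psi> - g i = s3 i + s4 i * mrename Inl (ball_poly R) + s5 i * time_poly T"
    by metis
  have "\<forall>j\<in>{1..nTR}. \<exists>s6 s7. is_sos s6 \<and> is_sos s7 \<and> msubst (case_sum mvar (\<lambda>_. mconst T)) \<psi> - l j = s6 + s7 * ball_poly R"
  proof
    fix j assume j: "j \<in> {1..nTR}"
    show "\<exists>s6 s7. is_sos s6 \<and> is_sos s7 \<and> msubst (case_sum mvar (\<lambda>_. mconst T)) \<psi> - l j = s6 + s7 * ball_poly R"
    proof (rule target_certificate[OF R])
      fix x :: "real ^ 'n" assume x: "x \<in> ball_set R"
      have "(\<lambda>v. meval (case_sum mvar (\<lambda>_. mconst T) v) (($) x)) = case_sum (($) x) (\<lambda>_ :: unit. T)"
        by (rule ext) (simp split: sum.split)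
      thus "meval (msubst (case_sum mvar (\<lambda>_. mconst T)) \<psi> - l j) (($) x) > 0"
        using target[OF x j] by (simp add: eval_xt_def)
    qed
  qed
  then obtain s6 s7 where S3: "\<forall>j\<in>{1..nTR}. is_sos (s6 j) \<and> is_sos (s7 j) \<and>
      msubst (case_sum mvar (\<lambda>_. mconst T)) \<psi> - l j = s6 j + s7 j * ball_poly R"
    by metis
  show ?thesis
    unfolding sos_constraints_def
    by (rule exI[of _ s0], rule exI[of _ s1], rule exI[of _ s2], rule exI[of _ s'], rule exI[of _ s3], rule exI[of _ s4],
        rule exI[of _ s5], rule exI[of _ s6], rule exI[of _ s7])
       (intro conjI S; use S2 S3 in blast)
qed

section \<open>Pacing the degrees, and conclusion\<close>

lemma total_degree_le_exists: "\<exists>k. total_degree_le k (p :: 'v mpoly)"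
  unfolding total_degree_le_def
  by (rule exI[of _ "\<Sum>m\<in>Poly_Mapping.keys p. \<Sum>v\<in>Poly_Mapping.keys m. Poly_Mapping.lookup m v"])
     (intro ballI member_le_sum; simp)

lemma total_degree_le_mono: "total_degree_le k p \<Longrightarrow> k \<le> k' \<Longrightarrow> total_degree_le k' p"
  unfolding total_degree_le_def using order_trans by blast

text \<open>A sequence of approximants is slowed down so that the \<open>k\<close>-th term has degree at most \<open>k + N\<close>.\<close>

lemma degree_paced_sequence:
  fixes P :: "nat \<Rightarrow> 'v mpoly"
  shows "\<exists>N>0. \<exists>J :: nat \<Rightarrow> nat. filterlim J at_top sequentially \<and> (\<forall>k. total_degree_le (k + N) (P (J k)))"
proof -
  have "\<forall>j. \<exists>k. total_degree_le k (P j)" by (intro allI total_degree_le_exists)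
  then obtain e where e: "\<And>j. total_degree_le (e j) (P j)" by metis
  define E where "E j = (\<Sum>i\<le>j. e i)" for j
  have eE: "e j \<le> E j" for j unfolding E_def by (rule member_le_sum) auto
  \<comment> \<open>Makes j = 0 a candidate for every k, so the maximum defining \<open>J k\<close>
    exists; the \<open>+ 1\<close> gives N > 0.\<close>
  define N where "N = E 0 + 1"
  define J where "J k = Max {j. j \<le> k \<and> E j \<le> k + N}" for k
  have fin: "finite {j. j \<le> k \<and> E j \<le> k + N}" for k by simp
  have ne: "{j. j \<le> k \<and> E j \<le> k + N} \<noteq> {}" for k by (auto simp: N_def intro!: exI[of _ 0])
  have J: "E (J k) \<le> k + N" for k using Max_in[OF fin ne, of k] by (simp add: J_def)
  have "J k \<ge> j" if "k \<ge> j" "k \<ge> E j" for j k unfolding J_def by (rule Max_ge[OF fin]) (use that in auto)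
  hence "filterlim J at_top sequentially"
    unfolding filterlim_at_top eventually_sequentially by (intro allI, rename_tac j, rule_tac x = "max j (E j)" in exI) auto
  moreover have "total_degree_le (k + N) (P (J k))" for k
    using total_degree_le_mono[OF e order_trans[OF eE J]] .
  ultimately show ?thesis by (intro exI[of _ N] exI[of _ J] conjI) (auto simp: N_def)
qed

theorem corollary3:
  fixes f :: "'n::finite \<Rightarrow> ('n + 'm::finite) mpoly"
    and h :: "nat \<Rightarrow> 'm mpoly" and nD :: nat
    and g :: "nat \<Rightarrow> ('n + unit) mpoly" and nX :: nat
    and l :: "nat \<Rightarrow> 'n mpoly" and nTR :: nat
    and F :: "real ^ 'n \<Rightarrow> real ^ 'm \<Rightarrow> real ^ 'n"
    and R T RD :: real
    and D :: "(real ^ 'm) set"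
  assumes "D = disturbance_set nD h" and "T > 0" and "R > 0" and "nX \<ge> 1" and "nTR \<ge> 1"
    and "compact D" and "D \<noteq> {}"
    and "\<And>t. t \<in> {0..T} \<Longrightarrow> compact (state_set nX g t)"
    and "\<And>t. t \<in> {0..T} \<Longrightarrow> state_set nX g t \<subseteq> ball_set R"
    and "\<And>t. t \<in> {0..T} \<Longrightarrow> state_boundary nX g t \<inter> frontier (ball_set R) = {}"
    and "continuous_on (UNIV \<times> D) (\<lambda>(x, d). F x d)"
    and "\<exists>L. \<forall>d\<in>D. L-lipschitz_on UNIV (\<lambda>x. F x d)"
    and "\<And>x d. x \<in> ball_set R \<Longrightarrow> d \<in> D \<Longrightarrow> F x d = (\<chi> i. eval_xd (f i) x d)"
    and "RD \<ge> 0" and "\<exists>i\<in>{1..nD}. h i = ball_poly RD"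
  shows "\<exists>N>0. \<exists>\<psi> :: nat \<Rightarrow> ('n + unit) mpoly.
    (\<forall>k\<ge>1. total_degree_le (k + N) (\<psi> (k + N)) \<and>
            sos_constraints f nD h nX g nTR l R T (\<psi> (k + N))) \<and>
    uniform_limit (ball_set R \<times> {0..T})
      (\<lambda>k (x, t). eval_xt (\<psi> (k + N)) x t)
      (\<lambda>(x, t). value_function F D nX g nTR l T x t) sequentially"
proof -
  obtain L where L: "\<And>d. d \<in> D \<Longrightarrow> L-lipschitz_on UNIV (\<lambda>x. F x d)" using assms(12) by blast
  obtain i0 where i0: "i0 \<in> {1..nD}" "h i0 = ball_poly RD" using assms(15) by blast
  interpret reach_problem F D L g nX l nTR T
    by unfold_locales (use assms(2,4-7,11) L in auto)
  \<comment> \<open>On the ball \<open>F\<close> agrees with \<open>f\<close>, so the strict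
    inequality along the Lipschitz field becomes positivity of a genuine polynomial, as Putinar's
    theorem requires.\<close>
  have "\<exists>\<psi> :: ('n + unit) mpoly. sos_constraints f nD h nX g nTR l R T \<psi> \<and>
    (\<forall>x\<in>ball_set R. \<forall>t\<in>{0..T}. \<bar>eval_xt \<psi> x t - u x t\<bar> \<le> 1 / (real j + 1))" for j :: nat
  proof -
    have "1 / (real j + 1) > 0" by simp
    from strict_polynomial_subsolution[OF assms(3) this] obtain \<psi> :: "('n + unit) mpoly" where
      close: "\<forall>x\<in>ball_set R. \<forall>t\<in>{0..T}. \<bar>eval_xt \<psi> x t - u x t\<bar> \<le> 1 / (real j + 1)" and
      dyn: "\<forall>x\<in>ball_set R. \<forall>t\<in>{0..T}. \<forall>d\<in>D. eval_xt (mpartial (Inr ()) \<psi>) x t + (\<Sum>i\<in>UNIV. eval_xt (mpartial (Inl i) \<psi>) x t * F x d $ i) < 0" and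
      above: "\<forall>x\<in>ball_set R. \<forall>t\<in>{0..T}. u x t < eval_xt \<psi> x t"
      by (elim exE conjE)
    have "sos_constraints f nD h nX g nTR l R T \<psi>"
    proof (rule sos_constraints_of_strict_subsolution[where h = h and k = i0, OF assms(3,2,14) i0])
      fix x :: "real ^ 'n" and t and d :: "real ^ 'm" assume "x \<in> ball_set R" "t \<in> {0..T}" "d \<in> disturbance_set nD h"
      thus "eval_xt (mpartial (Inr ()) \<psi>) x t + (\<Sum>i\<in>UNIV. eval_xt (mpartial (Inl i) \<psi>) x t * eval_xd (f i) x d) < 0"
        using dyn[rule_format, of x t d] assms(13)[of x d] assms(1) by simp
    next
      fix x :: "real ^ 'n" and t i assume "x \<in> ball_set R" "t \<in> {0..T}" "i \<in> {1..nX}"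
      thus "eval_xt (g i) x t < eval_xt \<psi> x t"
        using value_ge_state_constraint[of t i x] above[rule_format, of x t] by linarith
    next
      fix x :: "real ^ 'n" and j assume "x \<in> ball_set R" "j \<in> {1..nTR}"
      thus "meval (l j) (($) x) < eval_xt \<psi> x T"
        using value_ge_target_constraint[of j x] above[rule_format, of x T] T_pos by fastforce
    qed
    thus ?thesis using close by blast
  qed
  then obtain P :: "nat \<Rightarrow> ('n + unit) mpoly" where P: "\<forall>j. sos_constraints f nD h nX g nTR l R T (P j) \<and>
    (\<forall>x\<in>ball_set R. \<forall>t\<in>{0..T}. \<bar>eval_xt (P j) x t - u x t\<bar> \<le> 1 / (real j + 1))"
    using choice[of "\<lambda>j \<psi>. sos_constraints f nD h nX g nTR l R T \<psi> \<and>
      (\<forall>x\<in>ball_set R. \<forall>t\<in>{0..T}. \<bar>eval_xt \<psi> x t - u x t\<bar> \<le> 1 / (real j + 1))"] by blast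
  \<comment> \<open>Nothing is known about the degree of \<open>P j\<close>. Since the multipliers
    in the certificates may have any degree, repeating earlier terms until the degree bound has
    grown enough loses nothing.\<close>
  obtain N J where N: "N > 0" and J: "filterlim J at_top sequentially" and deg: "\<forall>k. total_degree_le (k + N) (P (J k))"
    using degree_paced_sequence[of P] by blast
  have "uniform_limit (ball_set R \<times> {0..T}) (\<lambda>k (x, t). eval_xt (P (J k)) x t) (\<lambda>(x, t). u x t) sequentially"
    unfolding uniform_limit_iff
  proof (intro allI impI)
    fix \<epsilon> :: real assume "\<epsilon> > 0"
    have "(\<lambda>j. 1 / (real j + 1)) \<longlonglongrightarrow> 0" by real_asymp
    hence "(\<lambda>k. 1 / (real (J k) + 1)) \<longlonglongrightarrow> 0" using J by (rule filterlim_compose)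
    hence "eventually (\<lambda>k. 1 / (real (J k) + 1) < \<epsilon>) sequentially" using \<open>\<epsilon> > 0\<close> by (rule order_tendstoD(2))
    thus "eventually (\<lambda>k. \<forall>xt\<in>ball_set R \<times> {0..T}. dist (case xt of (x, t) \<Rightarrow> eval_xt (P (J k)) x t) (case xt of (x, t) \<Rightarrow> u x t) < \<epsilon>) sequentially"
    proof eventually_elim
      case (elim k)
      show ?case using P elim by (auto simp: dist_real_def intro: le_less_trans)
    qed
  qed
  \<comment> \<open>The shift by \<open>N\<close> makes the term with index k + N equal to
    \<open>P (J k)\<close>.\<close>
  thus ?thesis
    using N deg P by (intro exI[of _ N] conjI exI[of _ "\<lambda>m. P (J (m - N))"]) simp_all
qed

end
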